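(* Consider the planar quadratic quasi-analytic switching system with real parameters $\lambda\neq 0$, $\delta$, $a_{20},a_{11},a_{02},b_{20},b_{11},b_{02}$: $$\begin{cases}\dot x=\delta x-y+(x^2+y^2)^{\frac{\lambda-1}{2}}(a_{20}x^2+a_{11}xy+a_{02}y^2),\\ \dot y=x+\delta y+(x^2+y^2)^{\frac{\lambda-1}{2}}(b_{20}x^2+b_{11}xy+b_{02}y^2),\end{cases}\ (y>0),\qquad \begin{cases}\dot x=\delta x-y,\\ \dot y=x+\delta y,\end{cases}\ (y<0).$$ The origin (if $\lambda>0$), respectively infinity (if $\lambda<0$), is a center of this system if and only if one of the following conditions is satisfied: (i) $\delta=a_{11}=b_{20}=b_{02}=0$; (ii) $\delta=b_{20}=a_{11}+2b_{02}=b_{11}+2a_{20}=0$; (iii) $\delta=a_{20}=b_{02}=a_{11}+b_{20}=b_{11}+a_{02}=0$; (iv) $\delta=\lambda-1=a_{02}=a_{20}=b_{02}+b_{20}=a_{11}-b_{20}=0$; (v) $\delta=\lambda-1=2a_{11}b_{20}+3a_{20}^2-2b_{20}^2=2b_{11}+5a_{20}=0$ and $8a_{02}b_{20}^2+a_{20}(8b_{20}^2-3a_{20}^2)=4b_{02}b_{20}-3a_{20}^2+4b_{20}^2=0$; (vi) $\delta=\lambda-\frac92=12a_{11}b_{20}+27a_{20}^2-4b_{20}^2=4b_{11}+11a_{20}=0$ and $32a_{02}b_{20}^2+3a_{20}(8b_{20}^2-9a_{20}^2)=24b_{02}b_{20}-27a_{20}^2+16b_{20}^2=0$.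
   Context: Generalized polar coordinates: put $x=r^{1/\lambda}\cos\theta$, $y=r^{1/\lambda}\sin\theta$, $r>0$ (so $r=(x^2+y^2)^{\lambda/2}$). Small $r>0$ corresponds to a neighborhood of the origin if $\lambda>0$ and to a neighborhood of infinity if $\lambda<0$. In each half plane the system becomes an equation for $dr/d\theta$ that is analytic for small $r\ge 0$. Orbits of the switching system are obtained by concatenating orbits of the two half-plane systems across $y=0$. Successive function: for small $h>0$, let $\tilde r_1(h)$ be the value at $\theta=\pi$ of the solution of the upper equation ($0\le\theta\le\pi$) with $r(0)=h$, and let $\tilde r_2(h)$ be the value at $\theta=-\pi$ of the solution of the lower equation ($-\pi\le\theta\le0$) with $r(0)=h$. The successive function is $\Delta(h)=\tilde r_1(h)-\tilde r_2(h)$. Center: the origin (if $\lambda>0$) or infinity (if $\lambda<0$) is a center if $\Delta(h)=0$ for all sufficiently small $h>0$, i.e. all orbits sufficiently close to the origin (respectively infinity) are closed.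
   Formalization: Conditions (v) and (vi) are stated with the extra requirement b20 ≠ 0; as printed they fail for b20 = 0 (e.g. λ = 1, a11 = 1, all other parameters 0 satisfies (v) but is not a center), and every center with b20 = 0 in (v) or (vi) already satisfies (ii). *)

theory Defs
  imports "HOL-Analysis.Analysis"
begin

type_synonym planar_field = "real \<Rightarrow> real \<Rightarrow> real \<times> real"

definition upper_field ::
  "real \<Rightarrow> real \<Rightarrow> real \<Rightarrow> real \<Rightarrow> real \<Rightarrow> real \<Rightarrow> real \<Rightarrow> real \<Rightarrow> planar_field" where
  "upper_field lam delta a20 a11 a02 b20 b11 b02 x y =
     (delta * x - y + (x\<^sup>2 + y\<^sup>2) powr ((lam - 1) / 2) * (a20 * x\<^sup>2 + a11 * x * y + a02 * y\<^sup>2),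
      x + delta * y + (x\<^sup>2 + y\<^sup>2) powr ((lam - 1) / 2) * (b20 * x\<^sup>2 + b11 * x * y + b02 * y\<^sup>2))"

definition lower_field :: "real \<Rightarrow> planar_field" where
  "lower_field delta x y = (delta * x - y, x + delta * y)"

text \<open>
  Generalized polar coordinates: x = r powr (1/lam) * cos t, y = r powr (1/lam) * sin t with r > 0,
  so r = (x^2 + y^2) powr (lam/2). Along an orbit of x' = X, y' = Y,
  r' = lam * (x^2 + y^2) powr (lam/2 - 1) * (x * X + y * Y) and
  t' = (x * Y - y * X) / (x^2 + y^2).
\<close>

definition polar_x :: "real \<Rightarrow> real \<Rightarrow> real \<Rightarrow> real" where
  "polar_x lam r t = r powr (1 / lam) * cos t"

definition polar_y :: "real \<Rightarrow> real \<Rightarrow> real \<Rightarrow> real" where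
  "polar_y lam r t = r powr (1 / lam) * sin t"

definition radial_speed :: "real \<Rightarrow> planar_field \<Rightarrow> real \<Rightarrow> real \<Rightarrow> real" where
  "radial_speed lam V r t =
     (let x = polar_x lam r t; y = polar_y lam r t; (X, Y) = V x y
      in lam * (x\<^sup>2 + y\<^sup>2) powr (lam / 2 - 1) * (x * X + y * Y))"

definition angular_speed :: "real \<Rightarrow> planar_field \<Rightarrow> real \<Rightarrow> real \<Rightarrow> real" where
  "angular_speed lam V r t =
     (let x = polar_x lam r t; y = polar_y lam r t; (X, Y) = V x y
      in (x * Y - y * X) / (x\<^sup>2 + y\<^sup>2))"

text \<open>
  A solution of dr/dt = r'/t' on the angular interval between 0 and the end angle, which may be
  negative; the end points, on the switching line y = 0, are included with one-sided derivatives.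
\<close>

definition polar_solution ::
  "real \<Rightarrow> planar_field \<Rightarrow> real \<Rightarrow> real \<Rightarrow> (real \<Rightarrow> real) \<Rightarrow> bool" where
  "polar_solution lam V end_angle h r \<longleftrightarrow>
     r 0 = h \<and>
     (\<forall>t \<in> closed_segment 0 end_angle.
        r t > 0 \<and> angular_speed lam V (r t) t \<noteq> 0 \<and>
        (r has_real_derivative radial_speed lam V (r t) t / angular_speed lam V (r t) t)
          (at t within closed_segment 0 end_angle))"

definition half_return :: "real \<Rightarrow> planar_field \<Rightarrow> real \<Rightarrow> real \<Rightarrow> real" where
  "half_return lam V end_angle h = (THE v. \<exists>r. polar_solution lam V end_angle h r \<and> v = r end_angle)"

definition successive_function :: "real \<Rightarrow> planar_field \<Rightarrow> planar_field \<Rightarrow> real \<Rightarrow> real" where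
  "successive_function lam U L h = half_return lam U pi h - half_return lam L (- pi) h"

text \<open>
  Small r > 0 describes a neighbourhood of the origin if lam > 0 and of infinity if lam < 0, so this
  says that the origin, respectively infinity, is a center of the system with field U for y > 0
  and field L for y < 0. Existence of both half orbits is required explicitly, so that an
  undefined half return value cannot make the successive function vanish.
\<close>

definition switching_center :: "real \<Rightarrow> planar_field \<Rightarrow> planar_field \<Rightarrow> bool" where
  "switching_center lam U L \<longleftrightarrow>
     (\<forall>\<^sub>F h in at_right 0.
        (\<exists>r. polar_solution lam U pi h r) \<and> (\<exists>r. polar_solution lam L (- pi) h r) \<and>
        successive_function lam U L h = 0)"

end

theory Submission
  imports Defs
begin

text \<open>
  In polar coordinates the upper system is \<open>r' = \<lambda> r (\<delta> + r A) / (1 + r B)\<close> with cubic forms \<open>A\<close>, \<open>B\<close> in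
  \<open>(cos \<theta>, sin \<theta>)\<close>; the lower one is linear. A center forces \<open>\<delta> = 0\<close> and \<open>\<integral> A = 0\<close> over \<open>[0, \<pi>]\<close>, and then
  \<open>A = P'\<close> and \<open>B = T - 3 P\<close>, where \<open>P\<close> is a cubic form vanishing at both ends and \<open>T\<close> is a linear form.
  For \<open>z = 1 / r + \<lambda> P\<close> the equation becomes \<open>z' = E / (z - q)\<close> with \<open>E = \<lambda> P' (T - 3 P)\<close>,
  \<open>q = (\<lambda> + 3) P - T\<close>, and \<open>z\<close> must take equal values at both ends for all large initial values. The
  coefficients of a formal first integral \<open>z + \<Sum> G\<^sub>n / z\<^sup>n\<close> therefore vanish at \<open>\<pi>\<close>. Integration by parts turns
  the first five of these conditions into integrals of polynomials in \<open>P\<close>, \<open>T\<close>, \<open>\<integral> P' T\<close> against \<open>T'\<close>, that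
  is, into polynomials in the parameters. If \<open>b20 = 0\<close>, the first one already gives (i) or (ii). Otherwise
  the third one factors into three linear conditions: either \<open>P\<close> is a
  cubic polynomial in \<open>T\<close>, or the first harmonic of \<open>P\<close> is one of two explicit multiples of \<open>T\<close>. In the first
  case only \<open>\<lambda> = 1\<close>, \<open>9 / 2\<close>, \<open>- 16 / 5\<close> survive, and \<open>- 16 / 5\<close> is excluded by the sixth condition;
  the other two cases lead to condition (iv), to the first case, or to a sign contradiction.

  Conversely, the orbits are symmetric under \<open>\<theta> \<mapsto> \<pi> - \<theta>\<close> in (i), a first integral is
  explicit in (ii), (iii), (v) and (vi), and (iv) is a Lienard system which is even in suitable coordinates.
\<close>

section \<open>Polar equations and uniqueness of orbits\<close>

text \<open>No analyticity of the return map is used. Orbits that start at a large \<open>v\<close>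
  stay within a distance of \<open>v\<close> that is independent of \<open>v\<close>, so the first
  integral truncated at order n changes by O(v^(-n-1)) along them, whereas closing up makes this
  change equal to the n-th coefficient at pi divided by v^n. The remaining obstacle is algebraic:
  the conditions are nested integrals, with a free real parameter \<open>lam\<close>. The primitive
  \<open>F\<close> of P' T keeps them manageable, since F' = P' T allows every factor P' to be
  integrated away and leaves single integrals against T'. The case where P is a cubic polynomial in
  T is special because the angle then enters only through x = cos + m sin, which runs from 1 to -1
  whatever m is. Hence the fourth condition becomes a polynomial in \<open>lam\<close> alone. The
  same fact produces the first integrals of (v) and (vi): there r^2 as a function of r x,
  respectively r^(-2/3) as a function of x r^(1/3), satisfies a linear equation.\<close>

definition polar_orbit :: "real \<Rightarrow> real \<Rightarrow> (real \<Rightarrow> real) \<Rightarrow> (real \<Rightarrow> real) \<Rightarrow> real set \<Rightarrow> (real \<Rightarrow> real) \<Rightarrow> bool" where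
  "polar_orbit lam delta A B I r \<longleftrightarrow>
     (\<forall>t\<in>I. r t > 0 \<and> 1 + r t * B t \<noteq> 0 \<and>
        (r has_real_derivative lam * r t * (delta + r t * A t) / (1 + r t * B t)) (at t within I))"

definition radial_form :: "real \<Rightarrow> real \<Rightarrow> real \<Rightarrow> real \<Rightarrow> real \<Rightarrow> real \<Rightarrow> real \<Rightarrow> real" where
  "radial_form a20 a11 a02 b20 b11 b02 t =
     cos t * (a20 * (cos t)\<^sup>2 + a11 * cos t * sin t + a02 * (sin t)\<^sup>2)
     + sin t * (b20 * (cos t)\<^sup>2 + b11 * cos t * sin t + b02 * (sin t)\<^sup>2)"

definition angular_form :: "real \<Rightarrow> real \<Rightarrow> real \<Rightarrow> real \<Rightarrow> real \<Rightarrow> real \<Rightarrow> real \<Rightarrow> real" where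
  "angular_form a20 a11 a02 b20 b11 b02 t =
     cos t * (b20 * (cos t)\<^sup>2 + b11 * cos t * sin t + b02 * (sin t)\<^sup>2)
     - sin t * (a20 * (cos t)\<^sup>2 + a11 * cos t * sin t + a02 * (sin t)\<^sup>2)"

lemma polar_norm: "(polar_x lam r t)\<^sup>2 + (polar_y lam r t)\<^sup>2 = (r powr (1 / lam))\<^sup>2"
proof -
  have "(polar_x lam r t)\<^sup>2 + (polar_y lam r t)\<^sup>2 = (r powr (1 / lam))\<^sup>2 * ((cos t)\<^sup>2 + (sin t)\<^sup>2)"
    unfolding polar_x_def polar_y_def by (simp only: power_mult_distrib distrib_left)
  then show ?thesis by simp
qed

text \<open>Once the factor p = r^(1/lam) is taken out of the field, all powers collapse: it enters
  the radial speed as (p^2)^(lam/2) = r and cancels from the angular speed.\<close>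

lemma polar_speeds:
  assumes "lam \<noteq> 0" "r > 0"
    and V: "V (polar_x lam r t) (polar_y lam r t) = (r powr (1 / lam) * X, r powr (1 / lam) * Y)"
  shows "radial_speed lam V r t = lam * r * (cos t * X + sin t * Y)"
    and "angular_speed lam V r t = cos t * Y - sin t * X"
proof -
  define p where "p = r powr (1 / lam)"
  have p: "p > 0" using assms by (simp add: p_def)
  have "(p\<^sup>2) powr (lam / 2 - 1) * p\<^sup>2 = (p\<^sup>2) powr (lam / 2)"
    using powr_add[of "p\<^sup>2" "lam / 2 - 1" 1] p by simp
  also have "\<dots> = r"
    using assms p by (simp add: p_def powr_powr flip: powr_numeral)
  finally have r: "(p\<^sup>2) powr (lam / 2 - 1) * p\<^sup>2 = r" .
  have "radial_speed lam V r t = lam * (p\<^sup>2) powr (lam / 2 - 1) * (p * cos t * (p * X) + p * sin t * (p * Y))"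
    unfolding radial_speed_def Let_def V polar_norm by (simp add: polar_x_def polar_y_def p_def)
  also have "\<dots> = lam * ((p\<^sup>2) powr (lam / 2 - 1) * p\<^sup>2) * (cos t * X + sin t * Y)"
    by (simp add: algebra_simps power2_eq_square)
  finally show "radial_speed lam V r t = lam * r * (cos t * X + sin t * Y)" by (simp add: r)
  show "angular_speed lam V r t = cos t * Y - sin t * X"
    unfolding angular_speed_def Let_def V polar_norm using p
    by (simp add: polar_x_def polar_y_def p_def[symmetric] field_simps power2_eq_square)
qed

text \<open>The reason for the exponent in the generalized polar coordinates: the nonlinear factor
  (p^2)^((lam-1)/2) combines with one of the two factors p of a quadratic monomial into p^lam = r,
  so the non-integer powers disappear.\<close>

lemma upper_field_polar:
  assumes "lam \<noteq> 0" "r > 0"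
  defines "p \<equiv> r powr (1 / lam)"
  shows "upper_field lam delta a20 a11 a02 b20 b11 b02 (polar_x lam r t) (polar_y lam r t) =
    (p * (delta * cos t - sin t + r * (a20 * (cos t)\<^sup>2 + a11 * cos t * sin t + a02 * (sin t)\<^sup>2)),
     p * (cos t + delta * sin t + r * (b20 * (cos t)\<^sup>2 + b11 * cos t * sin t + b02 * (sin t)\<^sup>2)))"
proof -
  have p: "p > 0" using assms by simp
  define w where "w = (p\<^sup>2) powr ((lam - 1) / 2)"
  have "w * p = p powr (lam - 1) * p powr 1"
    using p by (simp add: w_def powr_powr diff_divide_distrib flip: powr_numeral)
  also have "\<dots> = p powr lam"
    unfolding powr_add[symmetric] by simp
  also have "\<dots> = r" using assms by (simp add: p_def powr_powr)
  finally have r: "r = w * p" by simp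
  have "polar_x lam r t = p * cos t" "polar_y lam r t = p * sin t"
    by (simp_all add: polar_x_def polar_y_def p_def)
  then show ?thesis
    unfolding upper_field_def polar_norm p_def[symmetric] w_def[symmetric] prod.inject
    using r by (intro conjI; algebra)
qed

lemma closed_segment_0_pi: "closed_segment 0 pi = {0..pi}" "closed_segment 0 (- pi) = {- pi..0}"
  by (simp_all add: closed_segment_eq_real_ivl not_le)

lemma polar_solution_upper:
  assumes "lam \<noteq> 0"
  shows "polar_solution lam (upper_field lam delta a20 a11 a02 b20 b11 b02) pi h r \<longleftrightarrow>
    r 0 = h \<and> polar_orbit lam delta (radial_form a20 a11 a02 b20 b11 b02)
      (angular_form a20 a11 a02 b20 b11 b02) {0..pi} r"
proof -
  have "radial_speed lam (upper_field lam delta a20 a11 a02 b20 b11 b02) (r t) t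
      = lam * r t * (delta + r t * radial_form a20 a11 a02 b20 b11 b02 t)"
     "angular_speed lam (upper_field lam delta a20 a11 a02 b20 b11 b02) (r t) t
      = 1 + r t * angular_form a20 a11 a02 b20 b11 b02 t" if "r t > 0" for t
  proof -
    have cs: "cos t * cos t = 1 - sin t * sin t"
      using sin_cos_squared_add3[of t] by linarith
    show "radial_speed lam (upper_field lam delta a20 a11 a02 b20 b11 b02) (r t) t
      = lam * r t * (delta + r t * radial_form a20 a11 a02 b20 b11 b02 t)"
      unfolding polar_speeds(1)[where V="upper_field lam delta a20 a11 a02 b20 b11 b02", OF assms that upper_field_polar[OF
          assms that]]
        radial_form_def
      using cs by algebra
    show "angular_speed lam (upper_field lam delta a20 a11 a02 b20 b11 b02) (r t) t
      = 1 + r t * angular_form a20 a11 a02 b20 b11 b02 t"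
      unfolding polar_speeds(2)[where V="upper_field lam delta a20 a11 a02 b20 b11 b02", OF assms that upper_field_polar[OF
          assms that]]
        angular_form_def
      using cs by algebra
  qed
  then show ?thesis
    unfolding polar_solution_def polar_orbit_def closed_segment_0_pi by (auto cong: conj_cong)
qed

lemma polar_solution_lower:
  assumes "lam \<noteq> 0"
  shows "polar_solution lam (lower_field delta) (- pi) h r \<longleftrightarrow>
    r 0 = h \<and> polar_orbit lam delta (\<lambda>_. 0) (\<lambda>_. 0) {- pi..0} r"
proof -
  have f: "lower_field delta (polar_x lam (r t) t) (polar_y lam (r t) t)
      = (r t powr (1 / lam) * (delta * cos t - sin t), r t powr (1 / lam) * (cos t + delta * sin t))" for t
    by (simp add: lower_field_def polar_x_def polar_y_def algebra_simps)
  have "radial_speed lam (lower_field delta) (r t) t = lam * r t * delta"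
     "angular_speed lam (lower_field delta) (r t) t = 1" if "r t > 0" for t
  proof -
    have cs: "cos t * cos t = 1 - sin t * sin t"
      using sin_cos_squared_add3[of t] by linarith
    show "radial_speed lam (lower_field delta) (r t) t = lam * r t * delta"
      unfolding polar_speeds(1)[where V="lower_field delta", OF assms that f] using cs by algebra
    show "angular_speed lam (lower_field delta) (r t) t = 1"
      unfolding polar_speeds(2)[where V="lower_field delta", OF assms that f] using cs by algebra
  qed
  then show ?thesis
    unfolding polar_solution_def polar_orbit_def closed_segment_0_pi by (auto cong: conj_cong)
qed

text \<open>The integrating factor exp(- k), with k a primitive of \<open>K\<close>, makes the
  product constant. The zero \<open>c\<close> may lie anywhere in the interval, so uniqueness
  follows in both directions.\<close>

lemma linear_ode_zero:
  fixes w K :: "real \<Rightarrow> real"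
  assumes K: "continuous_on {a..b} K" and c: "c \<in> {a..b}" "w c = 0" and t: "t \<in> {a..b}"
    and w: "\<And>s. s \<in> {a..b} \<Longrightarrow> (w has_real_derivative K s * w s) (at s within {a..b})"
  shows "w t = 0"
proof -
  define k where "k s = integral {a..s} K" for s
  have k: "(k has_real_derivative K s) (at s within {a..b})" if "s \<in> {a..b}" for s
    unfolding k_def using integral_has_real_derivative[OF K that] .
  have "((\<lambda>s. w s * exp (- k s)) has_real_derivative 0) (at s within {a..b})" if "s \<in> {a..b}" for s
    by (rule derivative_eq_intros w k that refl | simp)+
  then have "\<exists>d. \<forall>s\<in>{a..b}. w s * exp (- k s) = d"
    by (intro has_field_derivative_zero_constant) auto
  then have "w t * exp (- k t) = w c * exp (- k c)" using c t by metis
  then show ?thesis using c by simp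
qed

text \<open>The right-hand sides at two given solutions differ by \<open>K\<close> times r - s,
  where \<open>K\<close> is continuous because neither denominator vanishes. The difference thus
  solves a linear equation, and no Lipschitz estimate is needed.\<close>

lemma polar_orbit_unique:
  assumes A: "continuous_on {a..b} A" and B: "continuous_on {a..b} B"
    and r: "polar_orbit lam delta A B {a..b} r" and s: "polar_orbit lam delta A B {a..b} s"
    and eq: "c \<in> {a..b}" "r c = s c" and t: "t \<in> {a..b}"
  shows "r t = s t"
proof -
  have cr: "continuous_on {a..b} r" and cs: "continuous_on {a..b} s"
    using r s unfolding polar_orbit_def continuous_on_eq_continuous_within
    by (meson DERIV_continuous)+
  define K where "K x = lam * (delta + A x * (r x + s x) + A x * B x * r x * s x)
      / ((1 + r x * B x) * (1 + s x * B x))" for x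
  have nz: "1 + r x * B x \<noteq> 0" "1 + s x * B x \<noteq> 0" if "x \<in> {a..b}" for x
    using r s that unfolding polar_orbit_def by auto
  have K: "continuous_on {a..b} K"
    unfolding K_def using nz by (intro continuous_intros A B cr cs) auto
  have "r t - s t = 0"
  proof (rule linear_ode_zero[OF K eq(1) _ t, where w = "\<lambda>x. r x - s x"])
    fix x assume x: "x \<in> {a..b}"
    have "lam * r x * (delta + r x * A x) / (1 + r x * B x) - lam * s x * (delta + s x * A x) / (1 + s x * B x)
        = K x * (r x - s x)"
      unfolding K_def using nz[OF x] by (simp add: divide_simps) algebra
    then show "((\<lambda>x. r x - s x) has_real_derivative K x * (r x - s x)) (at x within {a..b})"
      using r s x unfolding polar_orbit_def by (auto intro!: derivative_eq_intros)
  qed (use eq in auto)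
  then show ?thesis by simp
qed

section \<open>Existence of orbits for small radii\<close>

text \<open>The constant m / (K - m)^2 becomes small as the truncation level \<open>K\<close> grows,
  which is what makes the Picard map contract on the whole interval at once.\<close>

lemma ratio_lipschitz:
  fixes v w m M K :: real
  assumes "\<bar>M\<bar> \<le> m" "K > m" "v \<ge> K" "w \<ge> K"
  shows "\<bar>v / (v + M) - w / (w + M)\<bar> \<le> m / (K - m)\<^sup>2 * \<bar>v - w\<bar>"
proof -
  have pos: "v + M \<ge> K - m" "w + M \<ge> K - m" "K - m > 0" using assms by auto
  have "v / (v + M) - w / (w + M) = M * (v - w) / ((v + M) * (w + M))"
    using pos by (simp add: divide_simps) algebra
  then have "\<bar>v / (v + M) - w / (w + M)\<bar> = \<bar>M\<bar> * \<bar>v - w\<bar> / ((v + M) * (w + M))"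
    using pos by (simp add: abs_mult)
  also have "\<dots> \<le> m * \<bar>v - w\<bar> / (K - m)\<^sup>2"
    unfolding power2_eq_square using assms pos
    by (intro frac_le mult_mono mult_nonneg_nonneg mult_pos_pos) auto
  finally show ?thesis by simp
qed

lemma bounded_on_interval:
  fixes f :: "real \<Rightarrow> real"
  assumes "continuous_on {a..b} f"
  obtains K where "K \<ge> 0" "\<And>t. t \<in> {a..b} \<Longrightarrow> \<bar>f t\<bar> \<le> K"
proof -
  obtain K where "\<forall>x\<in>f ` {a..b}. \<bar>x\<bar> \<le> K"
    using compact_continuous_image[OF assms, THEN compact_imp_bounded] unfolding bounded_real by auto
  then have "\<bar>f t\<bar> \<le> max K 0" if "t \<in> {a..b}" for t using that by force
  then show ?thesis using that[of "max K 0"] by auto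
qed

text \<open>Picard iteration is run on the vector field truncated below at \<open>K\<close>, which is globally
  Lipschitz with a small constant; the fixed point never meets the truncation.\<close>

lemma radial_ode_exists:
  fixes N M :: "real \<Rightarrow> real"
  assumes N: "continuous_on {0..b} N" and M: "continuous_on {0..b} M" and b: "b \<ge> 0"
  shows "\<exists>C U. \<forall>v\<ge>U. \<exists>u. u 0 = v \<and> (\<forall>t\<in>{0..b}. \<bar>u t - v\<bar> \<le> C \<and> u t > 0 \<and> u t + M t > 0 \<and>
      (u has_real_derivative N t * u t / (u t + M t)) (at t within {0..b}))"
proof -
  obtain n0 where n0: "\<And>t. t \<in> {0..b} \<Longrightarrow> \<bar>N t\<bar> \<le> n0" using bounded_on_interval[OF N] by blast
  define n where "n = max 1 n0"
  have n: "\<bar>N t\<bar> \<le> n" if "t \<in> {0..b}" for t using n0[OF that] by (simp add: n_def)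
  have n1: "n \<ge> 1" by (simp add: n_def)
  obtain m0 where m0: "\<And>t. t \<in> {0..b} \<Longrightarrow> \<bar>M t\<bar> \<le> m0" using bounded_on_interval[OF M] by blast
  define m where "m = max 1 m0"
  have m: "\<bar>M t\<bar> \<le> m" if "t \<in> {0..b}" for t using m0[OF that] by (simp add: m_def)
  have m1: "m \<ge> 1" by (simp add: m_def)
  \<comment> \<open>Since max K w is at most twice max K w + M s, the truncated field is bounded by
    2 n. A solution therefore moves by at most \<open>C\<close>, and one that starts above K + C
    stays above \<open>K\<close>.\<close>
  define C where "C = 2 * n * b"
  \<comment> \<open>Chosen so that K - m is at least m + 2 n b m. As this number is at least 1, its
    square is at least 2 n b m, which gives the contraction constant 1 / 2.\<close>
  define K where "K = 2 * m + 2 * n * b * m"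
  have C: "C \<ge> 0" using n1 b by (simp add: C_def)
  have K: "K \<ge> 2 * m" "K - m \<ge> m + 2 * n * b * m" using n1 m1 b by (auto simp: K_def)
  have Lip: "n * (m / (K - m)\<^sup>2) * b \<le> 1 / 2"
  proof -
    have "1 \<le> m + 2 * n * b * m" using m1 n1 b by (smt (verit) mult_nonneg_nonneg)
    then have "(K - m)\<^sup>2 \<ge> (m + 2 * n * b * m) * 1"
      unfolding power2_eq_square using K by (intro mult_mono) auto
    then have "2 * (n * m * b) \<le> (K - m)\<^sup>2" using m1 by (simp add: algebra_simps)
    then show ?thesis using m1 K by (simp add: field_simps)
  qed
  have "\<exists>u. u 0 = v \<and> (\<forall>t\<in>{0..b}. \<bar>u t - v\<bar> \<le> C \<and> u t > 0 \<and> u t + M t > 0 \<and>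
      (u has_real_derivative N t * u t / (u t + M t)) (at t within {0..b}))" if v: "v \<ge> K + C" for v
  proof -
    define g where "g s w = N s * max K w / (max K w + M s)" for s w
    have den: "max K w + M s \<ge> m" "max K w + M s > 0" if "s \<in> {0..b}" for s w
      using m[OF that] K m1 by auto
    have gcont: "continuous_on {0..b} (\<lambda>s. g s (f s))" if "continuous_on {0..b} f" for f
      unfolding g_def using den(2) that
      by (intro continuous_intros N M) (auto simp: less_le)
    have gbound: "\<bar>g s w\<bar> \<le> 2 * n" if "s \<in> {0..b}" for s w
    proof -
      have "max K w \<le> 2 * (max K w + M s)" using m[OF that] K m1 by auto
      then have "\<bar>max K w / (max K w + M s)\<bar> \<le> 2" using den[OF that, of w] m1 K by (simp add: field_simps)
      then have "\<bar>N s\<bar> * \<bar>max K w / (max K w + M s)\<bar> \<le> n * 2" using n[OF that] n1 by (intro mult_mono) auto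
      then show ?thesis by (simp add: g_def abs_mult)
    qed
    have glip: "\<bar>g s w - g s w'\<bar> \<le> n * (m / (K - m)\<^sup>2) * \<bar>w - w'\<bar>" if s: "s \<in> {0..b}" for s w w'
    proof -
      have "\<bar>g s w - g s w'\<bar> = \<bar>N s\<bar> * \<bar>max K w / (max K w + M s) - max K w' / (max K w' + M s)\<bar>"
        by (simp add: g_def right_diff_distrib flip: abs_mult)
      also have "\<dots> \<le> n * (m / (K - m)\<^sup>2 * \<bar>max K w - max K w'\<bar>)"
        using n[OF s] n1 m[OF s] K m1 by (intro mult_mono ratio_lipschitz) auto
      also have "\<dots> \<le> n * (m / (K - m)\<^sup>2 * \<bar>w - w'\<bar>)"
        using n1 m1 by (intro mult_left_mono) auto
      finally show ?thesis by simp
    qed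
    \<comment> \<open>Clamping the time to the interval lets the iteration live in the complete
      space of bounded continuous functions on the whole line.\<close>
    define cl where "cl t = max 0 (min b t)" for t
    have cl: "cl t \<in> {0..b}" for t using b by (auto simp: cl_def)
    have clc: "continuous_on UNIV cl" unfolding cl_def by (intro continuous_intros)
    define J where "J f t = v + integral {0..cl t} (\<lambda>s. g s (apply_bcontfun f s))" for f :: "real \<Rightarrow>\<^sub>C real" and t
    have cf: "continuous_on S (apply_bcontfun f)" for S and f :: "real \<Rightarrow>\<^sub>C real"
      by (rule continuous_on_subset[OF continuous_on_apply_bcontfun]) auto
    have int: "(\<lambda>s. g s (apply_bcontfun f s)) integrable_on {0..t}" if "t \<in> {0..b}" for f :: "real \<Rightarrow>\<^sub>C real" and t
      using that by (intro integrable_continuous_real continuous_on_subset[OF gcont[OF cf]]) auto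
    have Jb: "\<bar>J f t - v\<bar> \<le> C" for f t
    proof -
      have "norm (integral {0..cl t} (\<lambda>s. g s (apply_bcontfun f s))) \<le> 2 * n * (cl t - 0)"
        using cl[of t] by (intro integral_bound continuous_on_subset[OF gcont[OF cf]]) (auto intro!: gbound)
      also have "\<dots> \<le> C" unfolding C_def using cl[of t] n1 by auto
      finally show ?thesis by (simp add: J_def)
    qed
    have Jc: "J f \<in> bcontfun" for f
    proof -
      have "continuous_on {0..b} (\<lambda>t. integral {0..t} (\<lambda>s. g s (apply_bcontfun f s)))"
        by (rule indefinite_integral_continuous_1[OF int]) (use b in auto)
      then have "continuous_on UNIV (\<lambda>t. integral {0..cl t} (\<lambda>s. g s (apply_bcontfun f s)))"
        by (rule continuous_on_compose2[OF _ clc]) (use cl in auto)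
      then have "continuous_on UNIV (J f)" unfolding J_def by (intro continuous_intros)
      moreover have "bounded (range (J f))"
        unfolding bounded_def by (rule exI[of _ v], rule exI[of _ C]) (use Jb in \<open>auto simp: dist_real_def abs_minus_commute\<close>)
      ultimately show ?thesis by (simp add: bcontfun_def)
    qed
    have "\<exists>!f. (Bcontfun \<circ> J) f = f"
    proof (rule banach_fix_type[where c = "1/2"])
      show "\<forall>f1 f2. dist ((Bcontfun \<circ> J) f1) ((Bcontfun \<circ> J) f2) \<le> 1 / 2 * dist f1 f2"
      proof (intro allI)
      fix f1 f2 :: "real \<Rightarrow>\<^sub>C real"
      have "dist (Bcontfun (J f1)) (Bcontfun (J f2)) \<le> 1 / 2 * dist f1 f2"
      proof (rule dist_bound)
        fix t
        have "dist (J f1 t) (J f2 t) = norm (integral {0..cl t} (\<lambda>s. g s (apply_bcontfun f1 s) - g s (apply_bcontfun f2 s)))"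
          by (simp add: J_def dist_real_def integral_diff[OF int[OF cl] int[OF cl]])
        also have "\<dots> \<le> n * (m / (K - m)\<^sup>2) * dist f1 f2 * (cl t - 0)"
        proof (rule integral_bound)
          show "continuous_on {0..cl t} (\<lambda>s. g s (apply_bcontfun f1 s) - g s (apply_bcontfun f2 s))"
            using cl[of t] by (intro continuous_intros continuous_on_subset[OF gcont[OF cf]]) auto
          fix s assume "s \<in> {0..cl t}"
          then have s: "s \<in> {0..b}" using cl[of t] by auto
          have "norm (g s (apply_bcontfun f1 s) - g s (apply_bcontfun f2 s))
              \<le> n * (m / (K - m)\<^sup>2) * dist (apply_bcontfun f1 s) (apply_bcontfun f2 s)"
            using glip[OF s] by (simp add: dist_real_def)
          also have "\<dots> \<le> n * (m / (K - m)\<^sup>2) * dist f1 f2"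
            using n1 m1 by (intro mult_left_mono dist_bounded) auto
          finally show "norm (g s (apply_bcontfun f1 s) - g s (apply_bcontfun f2 s))
              \<le> n * (m / (K - m)\<^sup>2) * dist f1 f2" .
        qed (use cl[of t] in auto)
        also have "\<dots> \<le> n * (m / (K - m)\<^sup>2) * dist f1 f2 * b"
          using cl[of t] n1 m1 by (intro mult_left_mono) auto
        also have "\<dots> = (n * (m / (K - m)\<^sup>2) * b) * dist f1 f2" by simp
        also have "\<dots> \<le> 1 / 2 * dist f1 f2" using Lip by (intro mult_right_mono) auto
        finally show "dist (apply_bcontfun (Bcontfun (J f1)) t) (apply_bcontfun (Bcontfun (J f2)) t) \<le> 1 / 2 * dist f1 f2"
          by (simp add: Bcontfun_inverse[OF Jc])
      qed
      then show "dist ((Bcontfun \<circ> J) f1) ((Bcontfun \<circ> J) f2) \<le> 1 / 2 * dist f1 f2" by simp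
      qed
    qed auto
    then obtain f where f: "Bcontfun (J f) = f" by auto
    define u where "u = apply_bcontfun f"
    have u: "u = J f" unfolding u_def using arg_cong[OF f, of apply_bcontfun, unfolded Bcontfun_inverse[OF Jc]] by (rule sym)
    have us: "u s = v + integral {0..s} (\<lambda>x. g x (u x))" if "s \<in> {0..b}" for s
    proof -
      have "cl s = s" using that by (simp add: cl_def)
      then show ?thesis using fun_cong[OF u, of s] by (simp add: J_def u_def)
    qed
    have ub: "\<bar>u t - v\<bar> \<le> C" for t using Jb[of f t] fun_cong[OF u, of t] by simp
    have uK: "u t \<ge> K" for t using v ub[of t] by linarith
    have "u 0 = v" using us[of 0] b by simp
    moreover have "u t > 0 \<and> u t + M t > 0 \<and>
      (u has_real_derivative N t * u t / (u t + M t)) (at t within {0..b})" if t: "t \<in> {0..b}" for t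
    proof -
      have "((\<lambda>t. v + integral {0..t} (\<lambda>s. g s (u s))) has_real_derivative g t (u t)) (at t within {0..b})"
        using integral_has_real_derivative[OF gcont[OF cf[of _ f]] t]
        by (auto intro!: derivative_eq_intros simp: u_def)
      then have "(u has_real_derivative g t (u t)) (at t within {0..b})"
        by (rule has_field_derivative_transform_within[OF _ zero_less_one t]) (rule us[symmetric])
      moreover have "g t (u t) = N t * u t / (u t + M t)" using uK[of t] by (simp add: g_def max_def)
      ultimately show ?thesis using uK[of t] m[OF t] K m1 by auto
    qed
    ultimately show ?thesis using ub by blast
  qed
  then show ?thesis by blast
qed

section \<open>Half return maps and the center condition in terms of upper orbits\<close>

lemma half_return_eq:
  assumes "polar_solution lam V e h r" "\<And>s. polar_solution lam V e h s \<Longrightarrow> s e = r e"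
  shows "half_return lam V e h = r e"
  unfolding half_return_def using assms by (intro the_equality) blast+

lemma continuous_on_forms:
  "continuous_on S (radial_form a20 a11 a02 b20 b11 b02)"
  "continuous_on S (angular_form a20 a11 a02 b20 b11 b02)"
  unfolding radial_form_def angular_form_def by (intro continuous_intros)+

lemma lower_return:
  assumes "lam \<noteq> 0" "h > 0"
  shows "\<exists>r. polar_solution lam (lower_field delta) (- pi) h r"
    and "half_return lam (lower_field delta) (- pi) h = h * exp (- lam * delta * pi)"
proof -
  define r where "r t = h * exp (lam * delta * t)" for t
  have r: "polar_solution lam (lower_field delta) (- pi) h r"
    unfolding polar_solution_lower[OF assms(1)] polar_orbit_def r_def
    using assms(2) by (auto intro!: derivative_eq_intros)
  then show "\<exists>r. polar_solution lam (lower_field delta) (- pi) h r" by blast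
  have "half_return lam (lower_field delta) (- pi) h = r (- pi)"
  proof (rule half_return_eq[OF r])
    fix s assume "polar_solution lam (lower_field delta) (- pi) h s"
    then show "s (- pi) = r (- pi)"
      using r unfolding polar_solution_lower[OF assms(1)]
      by (intro polar_orbit_unique[where r = s and s = r and t = "- pi" and c = 0
          and a = "- pi" and b = 0 and A = "\<lambda>_. 0" and B = "\<lambda>_. 0" and lam = lam and delta = delta]) simp_all
  qed
  then show "half_return lam (lower_field delta) (- pi) h = h * exp (- lam * delta * pi)"
    by (simp add: r_def)
qed

text \<open>The lower equation is linear and its half return is explicit, so only the upper orbit
  remains to be discussed.\<close>

lemma switching_center_iff:
  fixes a20 a11 a02 b20 b11 b02 :: real
  assumes "lam \<noteq> 0"
  defines "A \<equiv> radial_form a20 a11 a02 b20 b11 b02" and "B \<equiv> angular_form a20 a11 a02 b20 b11 b02"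
  shows "switching_center lam (upper_field lam delta a20 a11 a02 b20 b11 b02) (lower_field delta) \<longleftrightarrow>
    (\<forall>\<^sub>F h in at_right 0. \<exists>r. r 0 = h \<and> polar_orbit lam delta A B {0..pi} r \<and> r pi = h * exp (- lam * delta * pi))"
  unfolding switching_center_def
proof (rule eventually_cong)
  show "\<forall>\<^sub>F h::real in at_right 0. 0 < h" by (simp add: eventually_at_right_less)
  fix h :: real assume h: "0 < h"
  let ?U = "upper_field lam delta a20 a11 a02 b20 b11 b02"
  have upper: "half_return lam ?U pi h = r pi" if "polar_solution lam ?U pi h r" for r
  proof (rule half_return_eq[OF that])
    fix s assume "polar_solution lam ?U pi h s"
    then show "s pi = r pi"
      using that unfolding polar_solution_upper[OF assms(1)]
      by (intro polar_orbit_unique[OF continuous_on_forms(1)[of _ a20 a11 a02 b20 b11 b02]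
          continuous_on_forms(2)[of _ a20 a11 a02 b20 b11 b02], where r = s and s = r and t = pi and c = 0
          and a = 0 and b = pi and lam = lam and delta = delta]) simp_all
  qed
  show "((\<exists>r. polar_solution lam ?U pi h r) \<and> (\<exists>r. polar_solution lam (lower_field delta) (- pi) h r) \<and>
        successive_function lam ?U (lower_field delta) h = 0) =
    (\<exists>r. r 0 = h \<and> polar_orbit lam delta A B {0..pi} r \<and> r pi = h * exp (- lam * delta * pi))"
  proof (cases "\<exists>r. polar_solution lam ?U pi h r")
    case True
    then obtain r where r: "polar_solution lam ?U pi h r" by blast
    show ?thesis
      unfolding successive_function_def lower_return(2)[OF assms(1) h] A_def B_def
      using lower_return(1)[OF assms(1) h, of delta] r upper polar_solution_upper[OF assms(1)]
      by (metis eq_iff_diff_eq_0)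
  next
    case False
    then show ?thesis unfolding A_def B_def using polar_solution_upper[OF assms(1)] by blast
  qed
qed

text \<open>Substituting r = exp(lam delta t) / u removes the linear term and sends small r to large
  u, in the form treated by \<open>radial_ode_exists\<close>. That \<open>C\<close> does not depend
  on \<open>v\<close> is essential for the asymptotic arguments below.\<close>

lemma polar_orbit_exists:
  assumes A: "continuous_on {0..pi} A" and B: "continuous_on {0..pi} B"
  shows "\<exists>C U. \<forall>v\<ge>U. \<exists>u. u 0 = v \<and> (\<forall>t\<in>{0..pi}. \<bar>u t - v\<bar> \<le> C \<and> u t > 0) \<and>
      polar_orbit lam delta A B {0..pi} (\<lambda>t. exp (lam * delta * t) / u t)"
proof -
  define e where "e t = exp (lam * delta * t)" for t
  define M where "M t = e t * B t" for t
  define N where "N t = - lam * e t * (A t - delta * B t)" for t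
  have cM: "continuous_on {0..pi} M" and cN: "continuous_on {0..pi} N"
    unfolding M_def N_def e_def by (intro continuous_intros A B)+
  obtain C U where ex: "\<forall>v\<ge>U. \<exists>u. u 0 = v \<and> (\<forall>t\<in>{0..pi}. \<bar>u t - v\<bar> \<le> C \<and> u t > 0 \<and> u t + M t > 0 \<and>
      (u has_real_derivative N t * u t / (u t + M t)) (at t within {0..pi}))"
    using radial_ode_exists[OF cN cM pi_ge_zero] by blast
  show ?thesis
  proof (rule exI[of _ C], rule exI[of _ U], intro allI impI)
    fix v assume "v \<ge> U"
    then obtain u where u: "u 0 = v" "\<forall>t\<in>{0..pi}. \<bar>u t - v\<bar> \<le> C \<and> u t > 0 \<and> u t + M t > 0 \<and>
      (u has_real_derivative N t * u t / (u t + M t)) (at t within {0..pi})" using ex by blast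
    have "polar_orbit lam delta A B {0..pi} (\<lambda>t. e t / u t)"
      unfolding polar_orbit_def
    proof (intro ballI conjI)
      fix t assume t: "t \<in> {0..pi}"
      note ut = u(2)[rule_format, OF t]
      have pos: "u t > 0" "u t + e t * B t > 0" "e t > 0" using ut by (auto simp: M_def e_def)
      show "e t / u t > 0" using pos by simp
      have *: "1 + e t / u t * B t = (u t + e t * B t) / u t" using pos by (simp add: field_simps)
      show "1 + e t / u t * B t \<noteq> 0" unfolding * using pos by simp
      have "((\<lambda>t. e t / u t) has_real_derivative
          (lam * delta * e t * u t - e t * (N t * u t / (u t + M t))) / (u t * u t)) (at t within {0..pi})"
        using ut pos unfolding e_def by (auto intro!: derivative_eq_intros)
      moreover have "(lam * delta * e t * u t - e t * (N t * u t / (u t + M t))) / (u t * u t)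
          = lam * (e t / u t) * (delta + e t / u t * A t) / (1 + e t / u t * B t)"
        unfolding * N_def M_def using pos by (simp add: divide_simps) algebra
      ultimately show "((\<lambda>t. e t / u t) has_real_derivative
          lam * (e t / u t) * (delta + e t / u t * A t) / (1 + e t / u t * B t)) (at t within {0..pi})" by simp
    qed
    then show "\<exists>u. u 0 = v \<and> (\<forall>t\<in>{0..pi}. \<bar>u t - v\<bar> \<le> C \<and> u t > 0) \<and>
      polar_orbit lam delta A B {0..pi} (\<lambda>t. exp (lam * delta * t) / u t)"
      using u unfolding e_def by blast
  qed
qed

lemma eventually_at_right_0_inverse:
  "(\<forall>\<^sub>F h::real in at_right 0. P h) \<longleftrightarrow> (\<exists>U>0. \<forall>v\<ge>U. P (1 / v))"
proof -
  have "(\<forall>\<^sub>F h::real in at_right 0. P h) \<longleftrightarrow> (\<forall>\<^sub>F v in at_top. P (inverse v))"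
    by (simp add: at_right_to_top eventually_filtermap)
  also have "\<dots> \<longleftrightarrow> (\<exists>U>0. \<forall>v\<ge>U. P (1 / v))"
    unfolding eventually_at_top_linorder inverse_eq_divide
    by (metis max.bounded_iff max.cobounded1 less_max_iff_disj zero_less_one)
  finally show ?thesis .
qed

text \<open>Orbits supplied by the center condition come without bounds. Uniqueness identifies them
  with those of \<open>polar_orbit_exists\<close>, which stay within \<open>C\<close> of their
  initial value.\<close>

lemma center_orbits:
  fixes a20 a11 a02 b20 b11 b02 :: real
  assumes "lam \<noteq> 0"
    and center: "switching_center lam (upper_field lam delta a20 a11 a02 b20 b11 b02) (lower_field delta)"
  defines "A \<equiv> radial_form a20 a11 a02 b20 b11 b02" and "B \<equiv> angular_form a20 a11 a02 b20 b11 b02"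
  shows "\<exists>C U. \<forall>v\<ge>U. \<exists>u. u 0 = v \<and> (\<forall>t\<in>{0..pi}. \<bar>u t - v\<bar> \<le> C \<and> u t > 0) \<and>
      polar_orbit lam delta A B {0..pi} (\<lambda>t. exp (lam * delta * t) / u t) \<and> u pi = v * exp (2 * lam * delta * pi)"
proof -
  have c: "continuous_on {0..pi} A" "continuous_on {0..pi} B"
    unfolding A_def B_def by (rule continuous_on_forms)+
  obtain C U where ex: "\<forall>v\<ge>U. \<exists>u. u 0 = v \<and> (\<forall>t\<in>{0..pi}. \<bar>u t - v\<bar> \<le> C \<and> u t > 0) \<and>
      polar_orbit lam delta A B {0..pi} (\<lambda>t. exp (lam * delta * t) / u t)"
    using polar_orbit_exists[OF c] by blast
  obtain W where W: "W > 0" "\<forall>v\<ge>W. \<exists>r. r 0 = 1 / v \<and> polar_orbit lam delta A B {0..pi} r \<and>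
      r pi = 1 / v * exp (- lam * delta * pi)"
    using center unfolding switching_center_iff[OF assms(1)] eventually_at_right_0_inverse A_def B_def by auto
  show ?thesis
  proof (rule exI[of _ C], rule exI[of _ "max U W"], intro allI impI)
    fix v assume v: "v \<ge> max U W"
    then have "v \<ge> U" "v \<ge> W" by simp_all
    obtain u where u: "u 0 = v" "\<forall>t\<in>{0..pi}. \<bar>u t - v\<bar> \<le> C \<and> u t > 0"
      "polar_orbit lam delta A B {0..pi} (\<lambda>t. exp (lam * delta * t) / u t)" using ex \<open>v \<ge> U\<close> by blast
    obtain r where r: "r 0 = 1 / v" "polar_orbit lam delta A B {0..pi} r" "r pi = 1 / v * exp (- lam * delta * pi)"
      using W(2) \<open>v \<ge> W\<close> by blast
    have "exp (lam * delta * pi) / u pi = r pi"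
      by (rule polar_orbit_unique[OF c u(3) r(2), where c = 0]) (use u(1) r(1) in auto)
    moreover have "u pi > 0" "v > 0" using u(2) \<open>v \<ge> W\<close> W(1) by auto
    ultimately have "u pi = v * (exp (lam * delta * pi) / exp (- lam * delta * pi))"
      unfolding r(3) by (simp add: field_simps)
    also have "\<dots> = v * exp (2 * lam * delta * pi)"
      by (simp flip: exp_diff)
    finally show "\<exists>u. u 0 = v \<and> (\<forall>t\<in>{0..pi}. \<bar>u t - v\<bar> \<le> C \<and> u t > 0) \<and>
      polar_orbit lam delta A B {0..pi} (\<lambda>t. exp (lam * delta * t) / u t) \<and> u pi = v * exp (2 * lam * delta * pi)"
      using u by blast
  qed
qed

text \<open>On the orbit from \<open>v\<close> the difference u pi - v equals v (exp(2 lam delta pi)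
  - 1), which is unbounded in \<open>v\<close> unless the exponent is zero, although it has to stay
  below \<open>C\<close>.\<close>

lemma center_delta_zero:
  assumes "lam \<noteq> 0"
    and "switching_center lam (upper_field lam delta a20 a11 a02 b20 b11 b02) (lower_field delta)"
  shows "delta = 0"
proof (rule ccontr)
  assume "delta \<noteq> 0"
  obtain C U where ex: "\<forall>v\<ge>U. \<exists>u. u 0 = v \<and> (\<forall>t\<in>{0..pi}. \<bar>u t - v\<bar> \<le> C \<and> u t > 0) \<and>
      polar_orbit lam delta (radial_form a20 a11 a02 b20 b11 b02) (angular_form a20 a11 a02 b20 b11 b02) {0..pi}
        (\<lambda>t. exp (lam * delta * t) / u t) \<and> u pi = v * exp (2 * lam * delta * pi)"
    using center_orbits[OF assms] by blast
  define k where "k = \<bar>exp (2 * lam * delta * pi) - 1\<bar>"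
  have k: "k > 0" using \<open>delta \<noteq> 0\<close> assms(1) by (simp add: k_def)
  define v where "v = max (max U 1) (C / k + 1)"
  have v: "v \<ge> U" "v \<ge> 1" "v > C / k" by (auto simp: v_def)
  obtain u where u: "\<bar>u pi - v\<bar> \<le> C" "u pi = v * exp (2 * lam * delta * pi)"
    using ex v(1) pi_ge_zero by (metis atLeastAtMost_iff order_refl)
  have "\<bar>u pi - v\<bar> = v * k" using v 
    using abs_mult[of v "exp (2 * lam * delta * pi) - 1"] unfolding u(2) k_def by (simp add: right_diff_distrib)
  moreover have "v * k > C" using v(3) k by (simp add: field_simps)
  ultimately show False using u by simp
qed

section \<open>The equation of u = 1 / r for delta = 0\<close>

definition recip_orbit :: "real \<Rightarrow> (real \<Rightarrow> real) \<Rightarrow> (real \<Rightarrow> real) \<Rightarrow> (real \<Rightarrow> real) \<Rightarrow> bool" where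
  "recip_orbit lam A B u \<longleftrightarrow>
     (\<forall>t\<in>{0..pi}. u t > 0 \<and> u t + B t \<noteq> 0 \<and>
        (u has_real_derivative - lam * A t * u t / (u t + B t)) (at t within {0..pi}))"

lemma has_real_derivative_recip:
  fixes f :: "real \<Rightarrow> real"
  assumes "(f has_real_derivative d) (at t within S)" "f t \<noteq> 0"
  shows "((\<lambda>t. 1 / f t) has_real_derivative - d / (f t)\<^sup>2) (at t within S)"
  using assms by (auto intro!: derivative_eq_intros simp: power2_eq_square)

lemma recip_orbit_iff: "polar_orbit lam 0 A B {0..pi} (\<lambda>t. 1 / u t) \<longleftrightarrow> recip_orbit lam A B u"
proof -
  have "(1 / u t > 0 \<and> 1 + 1 / u t * B t \<noteq> 0 \<and>
        ((\<lambda>t. 1 / u t) has_real_derivative lam * (1 / u t) * (0 + 1 / u t * A t) / (1 + 1 / u t * B t)) (at t within {0..pi})) \<longleftrightarrow>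
     (u t > 0 \<and> u t + B t \<noteq> 0 \<and>
        (u has_real_derivative - lam * A t * u t / (u t + B t)) (at t within {0..pi}))" for t
  proof (cases "u t > 0 \<and> u t + B t \<noteq> 0")
    case True
    have *: "lam * (1 / u t) * (0 + 1 / u t * A t) / (1 + 1 / u t * B t) = lam * A t / (u t * (u t + B t))"
      using True by (simp add: field_simps)
    have 1: "((\<lambda>t. 1 / u t) has_real_derivative lam * A t / (u t * (u t + B t))) (at t within {0..pi})"
      if "(u has_real_derivative - lam * A t * u t / (u t + B t)) (at t within {0..pi})"
      by (rule DERIV_cong[OF has_real_derivative_recip[OF that]]) (use True in \<open>simp_all add: power2_eq_square\<close>)
    have 2: "(u has_real_derivative - lam * A t * u t / (u t + B t)) (at t within {0..pi})"
      if "((\<lambda>t. 1 / u t) has_real_derivative lam * A t / (u t * (u t + B t))) (at t within {0..pi})"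
    proof -
      have "((\<lambda>t. 1 / (1 / u t)) has_real_derivative - lam * A t * u t / (u t + B t)) (at t within {0..pi})"
        by (rule DERIV_cong[OF has_real_derivative_recip[OF that]]) (use True in \<open>simp_all add: power2_eq_square\<close>)
      then show ?thesis by simp
    qed
    have "1 + 1 / u t * B t \<noteq> 0" using True by (simp add: field_simps)
    then show ?thesis using True 1 2 unfolding * by auto
  next
    case False
    then show ?thesis by (auto simp: field_simps)
  qed
  then show ?thesis unfolding polar_orbit_def recip_orbit_def by blast
qed

lemma center_recip_orbits:
  assumes "lam \<noteq> 0"
    and "switching_center lam (upper_field lam 0 a20 a11 a02 b20 b11 b02) (lower_field 0)"
  shows "\<exists>C U. \<forall>v\<ge>U. \<exists>u. u 0 = v \<and> (\<forall>t\<in>{0..pi}. \<bar>u t - v\<bar> \<le> C) \<and> u pi = v \<and>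
      recip_orbit lam (radial_form a20 a11 a02 b20 b11 b02) (angular_form a20 a11 a02 b20 b11 b02) u"
proof -
  obtain C U where ex: "\<forall>v\<ge>U. \<exists>u. u 0 = v \<and> (\<forall>t\<in>{0..pi}. \<bar>u t - v\<bar> \<le> C \<and> u t > 0) \<and>
      polar_orbit lam 0 (radial_form a20 a11 a02 b20 b11 b02) (angular_form a20 a11 a02 b20 b11 b02) {0..pi}
        (\<lambda>t. exp (lam * 0 * t) / u t) \<and> u pi = v * exp (2 * lam * 0 * pi)"
    using center_orbits[OF assms] by blast
  then show ?thesis
    by (simp only: mult_zero_left mult_zero_right exp_zero recip_orbit_iff mult_1_right) blast
qed

text \<open>Existence of orbits and a bound \<open>C\<close> on their variation come from
  \<open>polar_orbit_exists\<close>. A sufficiency proof only has to show that a given orbit closes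
  up; as it does not know \<open>C\<close>, its threshold is allowed to depend on it.\<close>

lemma centerI:
  assumes "lam \<noteq> 0"
    and ret: "\<And>C. \<exists>U. \<forall>v\<ge>U. \<forall>u. u 0 = v \<longrightarrow> (\<forall>t\<in>{0..pi}. \<bar>u t - v\<bar> \<le> C) \<longrightarrow>
      recip_orbit lam (radial_form a20 a11 a02 b20 b11 b02) (angular_form a20 a11 a02 b20 b11 b02) u \<longrightarrow> u pi = v"
  shows "switching_center lam (upper_field lam 0 a20 a11 a02 b20 b11 b02) (lower_field 0)"
proof -
  obtain C U where ex: "\<forall>v\<ge>U. \<exists>u. u 0 = v \<and> (\<forall>t\<in>{0..pi}. \<bar>u t - v\<bar> \<le> C \<and> u t > 0) \<and>
      polar_orbit lam 0 (radial_form a20 a11 a02 b20 b11 b02) (angular_form a20 a11 a02 b20 b11 b02) {0..pi}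
        (\<lambda>t. exp (lam * 0 * t) / u t)"
    using polar_orbit_exists[OF continuous_on_forms(1)[of _ a20 a11 a02 b20 b11 b02]
        continuous_on_forms(2)[of _ a20 a11 a02 b20 b11 b02], of lam 0] by blast
  obtain W where W: "\<And>v u. v \<ge> W \<Longrightarrow> u 0 = v \<Longrightarrow> (\<forall>t\<in>{0..pi}. \<bar>u t - v\<bar> \<le> C) \<Longrightarrow>
      recip_orbit lam (radial_form a20 a11 a02 b20 b11 b02) (angular_form a20 a11 a02 b20 b11 b02) u \<Longrightarrow> u pi = v"
    using ret[of C] by blast
  show ?thesis
    unfolding switching_center_iff[OF assms(1)] eventually_at_right_0_inverse
  proof (intro exI[of _ "max 1 (max U W)"] conjI allI impI)
    fix v assume v: "max 1 (max U W) \<le> v"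
    then obtain u where u: "u 0 = v" "\<forall>t\<in>{0..pi}. \<bar>u t - v\<bar> \<le> C"
      "recip_orbit lam (radial_form a20 a11 a02 b20 b11 b02) (angular_form a20 a11 a02 b20 b11 b02) u"
      using ex by (auto simp: recip_orbit_iff)
    then have "u pi = v" using W[of v u] v by simp
    then show "\<exists>r. r 0 = 1 / v \<and> polar_orbit lam 0 (radial_form a20 a11 a02 b20 b11 b02)
        (angular_form a20 a11 a02 b20 b11 b02) {0..pi} r \<and> r pi = 1 / v * exp (- lam * 0 * pi)"
      using u by (intro exI[of _ "\<lambda>t. 1 / u t"]) (simp add: recip_orbit_iff)
  qed simp
qed

section \<open>Coefficients of the formal first integral\<close>

text \<open>A formal first integral \<open>z + (\<Sum>n\<ge>1. G n / z ^ n)\<close> of \<open>z' = E / (z - q)\<close>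
  has coefficients with \<open>G n' = obstr E q n\<close>.\<close>

fun obstr :: "(real \<Rightarrow> real) \<Rightarrow> (real \<Rightarrow> real) \<Rightarrow> nat \<Rightarrow> real \<Rightarrow> real" where
  "obstr E q 0 t = 0"
| "obstr E q (Suc 0) t = - E t"
| "obstr E q (Suc (Suc n)) t = q t * obstr E q (Suc n) t + real n * integral {0..t} (obstr E q n) * E t"

lemma continuous_on_integral_0:
  fixes f :: "real \<Rightarrow> real"
  assumes "continuous_on {0..b} f"
  shows "continuous_on {0..b} (\<lambda>t. integral {0..t} f)"
  by (rule indefinite_integral_continuous_1[OF integrable_continuous_real[OF assms]])

lemma continuous_on_obstr:
  assumes "continuous_on {0..b} E" "continuous_on {0..b} q"
  shows "continuous_on {0..b} (obstr E q n)"
proof (induction n rule: less_induct)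
  case (less n)
  consider "n = 0" | "n = Suc 0" | m where "n = Suc (Suc m)" by (metis not0_implies_Suc)
  then show ?case
  proof cases
    case 3
    then have "continuous_on {0..b} (obstr E q (Suc m))" "continuous_on {0..b} (\<lambda>t. integral {0..t} (obstr E q m))"
      using less continuous_on_integral_0 by auto
    then show ?thesis
      unfolding 3 obstr.simps by (intro continuous_intros assms)
  qed (auto intro!: continuous_intros assms)
qed

text \<open>The derivative of the truncated first integral, multiplied by z - q. The recursion of
  \<open>obstr\<close> is the one that cancels all lower orders in 1 / z, so only two terms of
  orders n and n + 1 survive.\<close>

lemma obstr_telescope:
  fixes E q :: "real \<Rightarrow> real"
  defines "G \<equiv> \<lambda>n t. integral {0..t} (obstr E q n)"
  assumes z: "z \<noteq> 0" "z \<noteq> q t"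
  defines "z' \<equiv> E t / (z - q t)"
  shows "(z - q t) * (z' + (\<Sum>k=1..n. obstr E q k t / z ^ k - real k * G k t * z' / z ^ Suc k))
    = - obstr E q (Suc n) t / z ^ n - real n * G n t * E t / z ^ Suc n"
proof (induction n)
  case 0
  then show ?case using z by (simp add: z'_def)
next
  case (Suc n)
  define S where "S = z' + (\<Sum>k=1..n. obstr E q k t / z ^ k - real k * G k t * z' / z ^ Suc k)"
  have zz: "(z - q t) * z' = E t" using z by (simp add: z'_def)
  have "(z - q t) * (z' + (\<Sum>k=1..Suc n. obstr E q k t / z ^ k - real k * G k t * z' / z ^ Suc k))
      = (z - q t) * S + (z - q t) * obstr E q (Suc n) t / z ^ Suc n
        - real (Suc n) * G (Suc n) t * ((z - q t) * z') / z ^ Suc (Suc n)"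
    by (simp add: S_def algebra_simps diff_divide_distrib)
  also have "(z - q t) * S = - obstr E q (Suc n) t / z ^ n - real n * G n t * E t / z ^ Suc n"
    using Suc by (simp add: S_def)
  also have "- obstr E q (Suc n) t / z ^ n - real n * G n t * E t / z ^ Suc n
      + (z - q t) * obstr E q (Suc n) t / z ^ Suc n - real (Suc n) * G (Suc n) t * ((z - q t) * z') / z ^ Suc (Suc n)
     = - obstr E q (Suc (Suc n)) t / z ^ Suc n - real (Suc n) * G (Suc n) t * E t / z ^ Suc (Suc n)"
    unfolding zz obstr.simps using z(1) by (simp add: field_simps G_def)
  finally show ?case .
qed

text \<open>By induction the coefficients below n vanish at \<open>b\<close>, so over a closed orbit
  the truncated first integral changes by exactly G n b / v^n. Its derivative is O(v^(-n-1)) by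
  \<open>obstr_telescope\<close>. Hence G n b = O(1 / v), and letting \<open>v\<close> tend to
  infinity gives zero.\<close>

theorem obstr_integral_zero:
  fixes E q :: "real \<Rightarrow> real"
  assumes E: "continuous_on {0..b} E" and q: "continuous_on {0..b} q" and b: "b \<ge> 0"
    and orbits: "\<forall>v\<ge>U. \<exists>z. z 0 = v \<and> z b = v \<and> (\<forall>t\<in>{0..b}. \<bar>z t - v\<bar> \<le> C \<and>
        (z has_real_derivative E t / (z t - q t)) (at t within {0..b}))"
  shows "integral {0..b} (obstr E q n) = 0"
proof (induction n rule: less_induct)
  case (less n)
  define G where "G n t = integral {0..t} (obstr E q n)" for n t
  have G': "(G k has_real_derivative obstr E q k t) (at t within {0..b})" if "t \<in> {0..b}" for k t
    unfolding G_def by (rule integral_has_real_derivative[OF continuous_on_obstr[OF E q] that])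
  have G0: "G k 0 = 0" for k by (simp add: G_def)
  have Gb: "G k b = 0" if "k < n" for k using less that by (simp add: G_def)
  show ?case
  proof (cases "n = 0")
    case True
    then show ?thesis using Gb by simp
  next
    case False
    have "continuous_on {0..b} (G n)"
      unfolding G_def by (rule continuous_on_integral_0[OF continuous_on_obstr[OF E q]])
    then have "continuous_on {0..b} (\<lambda>t. real n * G n t * E t)" by (intro continuous_intros E)
    then obtain D2 where D2: "D2 \<ge> 0" "\<And>t. t \<in> {0..b} \<Longrightarrow> \<bar>real n * G n t * E t\<bar> \<le> D2"
      using bounded_on_interval by blast
    obtain D1 where D1: "D1 \<ge> 0" "\<And>t. t \<in> {0..b} \<Longrightarrow> \<bar>obstr E q (Suc n) t\<bar> \<le> D1"
      using bounded_on_interval[OF continuous_on_obstr[OF E q]] by blast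
    obtain Q where Q: "Q \<ge> 0" "\<And>t. t \<in> {0..b} \<Longrightarrow> \<bar>q t\<bar> \<le> Q"
      using bounded_on_interval[OF q] by blast
    define K where "K = (D1 + D2) * 2 ^ n * 4 * b"
    have bound: "\<bar>G n b\<bar> \<le> K / v" if v: "v \<ge> U" "v \<ge> 2 * C" "v \<ge> 4 * Q" "v \<ge> 2" for v
    proof -
      obtain z where z: "z 0 = v" "z b = v" and z': "\<And>t. t \<in> {0..b} \<Longrightarrow> \<bar>z t - v\<bar> \<le> C"
        "\<And>t. t \<in> {0..b} \<Longrightarrow> (z has_real_derivative E t / (z t - q t)) (at t within {0..b})"
        using orbits v(1) by blast
      have zb: "z t \<ge> v / 2" "z t \<ge> 1" "z t - q t \<ge> v / 4" if "t \<in> {0..b}" for t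
        using z'(1)[OF that] Q(2)[OF that] v by (auto simp: abs_le_iff field_simps)
      define F where "F t = z t + (\<Sum>k=1..n. G k t / z t ^ k)" for t
      define F' where "F' t = E t / (z t - q t) + (\<Sum>k=1..n. obstr E q k t / z t ^ k
          - real k * G k t * (E t / (z t - q t)) / z t ^ Suc k)" for t
      have F: "(F has_real_derivative F' t) (at t within {0..b})" if t: "t \<in> {0..b}" for t
      proof -
        have "((\<lambda>t. G k t / z t ^ k) has_real_derivative obstr E q k t / z t ^ k
          - real k * G k t * (E t / (z t - q t)) / z t ^ Suc k) (at t within {0..b})" if "k \<in> {1..n}" for k
        proof (rule DERIV_cong[OF DERIV_divide[OF G'[OF t] DERIV_power[OF z'(2)[OF t]]]])
          obtain j where j: "k = Suc j" using \<open>k \<in> {1..n}\<close> by (cases k) auto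
          show "z t ^ k \<noteq> 0" using zb[OF t] by simp
          show "(obstr E q k t * z t ^ k - G k t * (real k * (E t / (z t - q t) * z t ^ (k - Suc 0)))) /
            (z t ^ k * z t ^ k) = obstr E q k t / z t ^ k - real k * G k t * (E t / (z t - q t)) / z t ^ Suc k"
            unfolding j using zb[OF t] by (simp add: diff_divide_distrib) 
        qed
        then show ?thesis unfolding F_def F'_def by (intro DERIV_add z'(2)[OF t] DERIV_sum) auto
      qed
      have F'b: "\<bar>F' t\<bar> \<le> (D1 + D2) * 2 ^ n * 4 / v ^ Suc n" if t: "t \<in> {0..b}" for t
      proof -
        note zt = zb[OF t]
        have zq: "z t - q t > 0" "z t > 0" "z t ^ n > 0" using zt v by auto
        have "(z t - q t) * F' t = - obstr E q (Suc n) t / z t ^ n - real n * G n t * E t / z t ^ Suc n"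
          unfolding F'_def G_def by (rule obstr_telescope) (use zq in auto)
        then have "\<bar>(z t - q t) * F' t\<bar> \<le> \<bar>obstr E q (Suc n) t / z t ^ n\<bar> + \<bar>real n * G n t * E t / z t ^ Suc n\<bar>"
          by linarith
        also have "\<dots> \<le> D1 / z t ^ n + D2 / z t ^ n"
        proof (rule add_mono)
          show "\<bar>obstr E q (Suc n) t / z t ^ n\<bar> \<le> D1 / z t ^ n"
            using D1(2)[OF t] zq by (simp add: abs_divide divide_right_mono)
          have "\<bar>real n * G n t * E t / z t ^ Suc n\<bar> = \<bar>real n * G n t * E t\<bar> / z t ^ Suc n"
            using zq by (simp add: abs_divide del: power_Suc)
          also have "\<dots> \<le> D2 / z t ^ n"
            using D2(1) D2(2)[OF t] zq zt power_increasing[of n "Suc n" "z t"] by (intro frac_le) auto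
          finally show "\<bar>real n * G n t * E t / z t ^ Suc n\<bar> \<le> D2 / z t ^ n" .
        qed
        also have "\<dots> = (D1 + D2) / z t ^ n" by (simp add: add_divide_distrib)
        also have "\<dots> \<le> (D1 + D2) / (v / 2) ^ n"
          using D1(1) D2(1) zt v by (intro divide_left_mono power_mono mult_pos_pos zero_less_power) auto
        finally have *: "(z t - q t) * \<bar>F' t\<bar> \<le> (D1 + D2) / (v / 2) ^ n"
          using zq by (simp add: abs_mult)
        have "(v / 4) * \<bar>F' t\<bar> \<le> (z t - q t) * \<bar>F' t\<bar>" using zt by (intro mult_right_mono) auto
        with * have "(v / 4) * \<bar>F' t\<bar> \<le> (D1 + D2) / (v / 2) ^ n" by linarith
        then show ?thesis using v by (simp add: field_simps power_divide)
      qed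
      have "norm (F b - F 0) \<le> (D1 + D2) * 2 ^ n * 4 / v ^ Suc n * norm (b - 0)"
        by (rule field_differentiable_bound[of "{0..b}"]) (use F F'b b in auto)
      moreover have "F b - F 0 = G n b / v ^ n"
      proof -
        have "(\<Sum>k=1..n. G k b / z b ^ k) = (\<Sum>k\<in>{n}. G k b / z b ^ k)"
          using False by (intro sum.mono_neutral_right) (auto simp: Gb)
        then show ?thesis using z by (simp add: F_def G0)
      qed
      ultimately have "\<bar>G n b\<bar> / v ^ n \<le> K / v ^ Suc n"
        using v b by (simp add: K_def abs_divide)
      then show ?thesis using v by (simp add: field_simps)
    qed
    have "\<forall>\<^sub>F v in at_top. \<bar>G n b\<bar> \<le> K / v"
      using eventually_ge_at_top[of U] eventually_ge_at_top[of "2 * C"] eventually_ge_at_top[of "4 * Q"]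
        eventually_ge_at_top[of 2]
      by eventually_elim (rule bound)
    moreover have "((\<lambda>v. K / v) \<longlongrightarrow> 0) at_top"
      by (rule tendsto_divide_0[OF tendsto_const]) (simp add: filterlim_at_top_imp_at_infinity filterlim_ident)
    ultimately have "\<bar>G n b\<bar> \<le> 0"
      by (intro tendsto_lowerbound[of "\<lambda>v. K / v" 0 at_top]) auto
    then show ?thesis by (simp add: G_def)
  qed
qed

section \<open>Moments of trigonometric forms\<close>

text \<open>Homogeneous forms in \<open>(cos t, sin t)\<close>: the list holds the coefficients by increasing power of the sine.\<close>

fun form :: "real list \<Rightarrow> real \<Rightarrow> real" where
  "form [] t = 0"
| "form (x # xs) t = x * cos t ^ length xs + sin t * form xs t"

fun coeffs_add :: "real list \<Rightarrow> real list \<Rightarrow> real list" where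
  "coeffs_add (x # xs) (y # ys) = (x + y) # coeffs_add xs ys"
| "coeffs_add [] ys = []"
| "coeffs_add xs [] = []"

text \<open>The degree of a form is the length of its list minus one, so trailing zeros multiply by
  powers of the cosine; the padding brings both summands to the degree of the product. Singletons
  have their own clause because adding to the empty list would truncate the result.\<close>

fun coeffs_mult :: "real list \<Rightarrow> real list \<Rightarrow> real list" where
  "coeffs_mult [] ys = []"
| "coeffs_mult [x] ys = map ((*) x) ys"
| "coeffs_mult (x # y # xs) ys =
     coeffs_add (map ((*) x) ys @ replicate (length (y # xs)) 0) (0 # coeffs_mult (y # xs) ys)"

lemma length_coeffs_add: "length xs = length ys \<Longrightarrow> length (coeffs_add xs ys) = length ys"
  by (induction xs ys rule: coeffs_add.induct) auto

lemma length_coeffs_mult: "ys \<noteq> [] \<Longrightarrow> xs \<noteq> [] \<Longrightarrow> Suc (length (coeffs_mult xs ys)) = length xs + length ys"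
  by (induction xs ys rule: coeffs_mult.induct) (auto simp: length_coeffs_add)

lemma coeffs_mult_nonempty:
  assumes "xs \<noteq> []" "ys \<noteq> []"
  shows "coeffs_mult xs ys \<noteq> []"
proof -
  have "length xs > 0" "length ys > 0" using assms by auto
  then have "length (coeffs_mult xs ys) > 0" using length_coeffs_mult[OF assms(2,1)] by linarith
  then show ?thesis by auto
qed

lemma form_add: "length xs = length ys \<Longrightarrow> form (coeffs_add xs ys) t = form xs t + form ys t"
  by (induction xs ys rule: coeffs_add.induct) (auto simp: length_coeffs_add algebra_simps)

lemma form_map: "form (map ((*) x) ys) t = x * form ys t"
  by (induction ys) (auto simp: algebra_simps)

lemma form_replicate_0: "form (replicate n 0) t = 0"
  by (induction n) auto

lemma form_append_0: "form (ys @ replicate n 0) t = form ys t * cos t ^ n"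
  by (induction ys) (auto simp: form_replicate_0 algebra_simps power_add)

lemma form_mult: "ys \<noteq> [] \<Longrightarrow> form (coeffs_mult xs ys) t = form xs t * form ys t"
proof (induction xs ys rule: coeffs_mult.induct)
  case (3 x y xs ys)
  have "length (map ((*) x) ys @ replicate (length (y # xs)) 0) = length (0 # coeffs_mult (y # xs) ys)"
    using length_coeffs_mult[of ys "y # xs"] 3(2) by simp
  then have "form (coeffs_mult (x # y # xs) ys) t
      = form (map ((*) x) ys @ replicate (length (y # xs)) 0) t + form (0 # coeffs_mult (y # xs) ys) t"
    unfolding coeffs_mult.simps by (rule form_add)
  then show ?case
    using 3(1)[OF 3(2)] by (simp add: form_append_0 form_map algebra_simps del: replicate.simps)
qed (auto simp: form_map)

section \<open>Integrals of forms over [0, pi]\<close>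

definition moment :: "nat \<Rightarrow> nat \<Rightarrow> real" where
  "moment i j = integral {0..pi} (\<lambda>t. cos t ^ i * sin t ^ j)"

lemma moment_integrable: "(\<lambda>t. cos t ^ i * sin t ^ j :: real) integrable_on {0..pi}"
  by (intro integrable_continuous_real continuous_intros)

lemma integral_derivative_zero:
  fixes f g :: "real \<Rightarrow> real"
  assumes "a \<le> b" "\<And>t. t \<in> {a..b} \<Longrightarrow> (f has_real_derivative g t) (at t within {a..b})" "f a = f b"
  shows "integral {a..b} g = 0"
  using fundamental_theorem_of_calculus[of a b f g] assms
  by (simp add: has_real_derivative_iff_has_vector_derivative integral_unique)

text \<open>Integrate the derivative of cos^(i+1) sin^(j+1), which vanishes at both ends. Together
  with the analogous step for pure powers of the sine and with \<open>moment_1\<close>, this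
  evaluates every moment.\<close>

lemma moment_cos_step: "moment (Suc (Suc i)) j = real (Suc i) / real (i + j + 2) * moment i j"
proof -
  have trig: "(1 + i) * (X * - s) * (s * Y) + (1 + j) * (Y * c) * (c * X)
      = (i + j + 2) * (c * (c * X) * Y) - (1 + i) * (X * Y)" if "c * c + s * s = 1" for X Y c s i j :: real
    using that by algebra
  have "integral {0..pi} (\<lambda>t. real (i + j + 2) * (cos t ^ Suc (Suc i) * sin t ^ j) - real (Suc i) * (cos t ^ i * sin t ^ j)) =
      0"
  proof (rule integral_derivative_zero[of _ _ "\<lambda>t. cos t ^ Suc i * sin t ^ Suc j"])
    fix t :: real
    have "real (Suc i) * (cos t ^ i * - sin t) * sin t ^ Suc j + real (Suc j) * (sin t ^ j * cos t) * cos t ^ Suc i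
        = real (i + j + 2) * (cos t ^ Suc (Suc i) * sin t ^ j) - real (Suc i) * (cos t ^ i * sin t ^ j)"
      unfolding power_Suc of_nat_add of_nat_Suc of_nat_numeral by (rule trig) (rule sin_cos_squared_add3)
    then show "((\<lambda>t. cos t ^ Suc i * sin t ^ Suc j) has_real_derivative
        real (i + j + 2) * (cos t ^ Suc (Suc i) * sin t ^ j) - real (Suc i) * (cos t ^ i * sin t ^ j)) (at t within {0..pi})"
      by (auto intro!: derivative_eq_intros simp: mult.commute[of "cos t" "sin t ^ j"] mult.commute[of "sin t" "cos t ^ i"] simp
          del: of_nat_Suc power_Suc)
  qed auto
  then have "real (i + j + 2) * moment (Suc (Suc i)) j - real (Suc i) * moment i j = 0"
    unfolding moment_def
    by (subst (asm) integral_diff) (auto simp del: power_Suc of_nat_Suc intro!: moment_integrable integrable_on_cmult_left)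
  then show ?thesis by (simp add: field_simps)
qed

lemma moment_sin_step: "moment 0 (Suc (Suc j)) = real (Suc j) / real (Suc (Suc j)) * moment 0 j"
proof -
  have trig: "s * (s * Y) + (1 + j) * (Y * c) * - c
      = (1 + (1 + j)) * (1 * (s * (s * Y))) - (1 + j) * (1 * Y)" if "c * c + s * s = 1" for Y c s j :: real
    using that by algebra
  have "integral {0..pi} (\<lambda>t. real (Suc (Suc j)) * (cos t ^ 0 * sin t ^ Suc (Suc j)) - real (Suc j) * (cos t ^ 0 * sin t ^ j)) =
      0"
  proof (rule integral_derivative_zero[of _ _ "\<lambda>t. - cos t * sin t ^ Suc j"])
    fix t :: real
    have "sin t * sin t ^ Suc j + real (Suc j) * (sin t ^ j * cos t) * - cos t
        = real (Suc (Suc j)) * (cos t ^ 0 * sin t ^ Suc (Suc j)) - real (Suc j) * (cos t ^ 0 * sin t ^ j)"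
      unfolding power_Suc power_0 of_nat_add of_nat_Suc by (rule trig) (rule sin_cos_squared_add3)
    then show "((\<lambda>t. - cos t * sin t ^ Suc j) has_real_derivative
        real (Suc (Suc j)) * (cos t ^ 0 * sin t ^ Suc (Suc j)) - real (Suc j) * (cos t ^ 0 * sin t ^ j)) (at t within {0..pi})"
      by (auto intro!: derivative_eq_intros simp: mult.commute[of "cos t" "sin t ^ j"] simp del: of_nat_Suc power_Suc power_0)
  qed auto
  then have "real (Suc (Suc j)) * moment 0 (Suc (Suc j)) - real (Suc j) * moment 0 j = 0"
    unfolding moment_def
    by (subst (asm) integral_diff) (auto simp del: power_Suc of_nat_Suc power_0 intro!: moment_integrable
        integrable_on_cmult_left)
  then show ?thesis by (simp add: field_simps)
qed

lemma moment_0_0: "moment 0 0 = pi"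
  by (simp add: moment_def)

lemma moment_0_1: "moment 0 (Suc 0) = 2"
proof -
  have "((\<lambda>t. sin t) has_integral (- cos pi - - cos 0)) {0..pi}"
    by (rule fundamental_theorem_of_calculus)
      (auto intro!: derivative_eq_intros simp flip: has_real_derivative_iff_has_vector_derivative)
  then show ?thesis by (simp add: moment_def integral_unique)
qed

lemma moment_1: "moment (Suc 0) j = 0"
proof -
  have "integral {0..pi} (\<lambda>t. cos t ^ Suc 0 * sin t ^ j) = 0"
    by (rule integral_derivative_zero[of _ _ "\<lambda>t. sin t ^ Suc j / real (Suc j)"])
      (auto intro!: derivative_eq_intros simp del: of_nat_Suc power_Suc)
  then show ?thesis by (simp add: moment_def)
qed

lemmas moment_simps = moment_cos_step moment_sin_step moment_0_0 moment_0_1 moment_1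

fun form_integral :: "nat \<Rightarrow> real list \<Rightarrow> real" where
  "form_integral j [] = 0"
| "form_integral j (x # xs) = x * moment (length xs) j + form_integral (Suc j) xs"

lemma has_integral_form: "(form xs has_integral form_integral 0 xs) {0..pi}"
proof -
  have "((\<lambda>t. sin t ^ j * form xs t) has_integral form_integral j xs) {0..pi}" for j
  proof (induction xs arbitrary: j)
    case (Cons x xs)
    have "((\<lambda>t. x * (cos t ^ length xs * sin t ^ j) + sin t ^ Suc j * form xs t) has_integral
        x * moment (length xs) j + form_integral (Suc j) xs) {0..pi}"
      unfolding moment_def
      by (intro has_integral_add has_integral_mult_right Cons.IH integrable_integral moment_integrable)
    then show ?case by (simp add: algebra_simps)
  qed auto
  from this[of 0] show ?thesis by simp
qed

lemma has_integral_formI: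
  assumes "\<And>t. f t = form xs t" "form_integral 0 xs = I"
  shows "(f has_integral I) {0..pi}"
  using has_integral_form[of xs] assms(2) by (simp add: assms(1)[abs_def])

text \<open>\<open>cubic_moment_ijl\<close> is the integral of \<open>P ^ i * T ^ j * F ^ l * T'\<close> over \<open>[0, pi]\<close>, divided by \<open>pi\<close>
  if the integrand has even degree, for \<open>T = cos + m sin\<close>, \<open>P = sin (a cos\<^sup>2 - k cos sin - (a + k m) / 3 sin\<^sup>2)\<close>
  and the primitive \<open>F\<close> of \<open>P' * T\<close>. The last coefficient of \<open>P\<close> is the one that makes \<open>F\<close> vanish at \<open>pi\<close>.\<close>

definition cubic_moment_110 :: "real \<Rightarrow> real \<Rightarrow> real \<Rightarrow> real" where
  "cubic_moment_110 a k m = 2/5 * a * m + 4/15 * k"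

definition cubic_moment_200 :: "real \<Rightarrow> real \<Rightarrow> real \<Rightarrow> real" where
  "cubic_moment_200 a k m = - 4/35 * a^2 - 8/35 * a * k * m - 16/105 * k^2"

definition cubic_moment_120 :: "real \<Rightarrow> real \<Rightarrow> real \<Rightarrow> real" where
  "cubic_moment_120 a k m = 1/8 * a * m^2 - 1/24 * a + 1/12 * k * m"

definition cubic_moment_210 :: "real \<Rightarrow> real \<Rightarrow> real \<Rightarrow> real" where
  "cubic_moment_210 a k m = - 1/16 * a * k * m^2 + 1/48 * a * k - 1/24 * k^2 * m"

definition cubic_moment_300 :: "real \<Rightarrow> real \<Rightarrow> real \<Rightarrow> real" where
  "cubic_moment_300 a k m = 3/128 * a * k^2 * m^2 - 1/128 * a * k^2 + 1/64 * k^3 * m"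

definition cubic_moment_130 :: "real \<Rightarrow> real \<Rightarrow> real \<Rightarrow> real" where
  "cubic_moment_130 a k m = 12/35 * a * m^3 + 2/35 * a * m + 8/35 * k * m^2 + 4/35 * k"

definition cubic_moment_220 :: "real \<Rightarrow> real \<Rightarrow> real \<Rightarrow> real" where
  "cubic_moment_220 a k m = 8/945 * a^2 * m^2 - 116/2835 * a^2 - 32/189 * a * k * m^3 - 8/567 * a * k * m
      - 64/567 * k^2 * m^2 - 16/315 * k^2"

definition cubic_moment_310 :: "real \<Rightarrow> real \<Rightarrow> real \<Rightarrow> real" where
  "cubic_moment_310 a k m = 12/385 * a^3 * m + 32/3465 * a^2 * k * m^2 + 80/2079 * a^2 * k + 32/495 * a * k^2 * m^3
      + 272/10395 * a * k^2 * m + 64/1485 * k^3 * m^2 + 32/1155 * k^3"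

definition cubic_moment_400 :: "real \<Rightarrow> real \<Rightarrow> real \<Rightarrow> real" where
  "cubic_moment_400 a k m = - 48/5005 * a^4 - 192/5005 * a^3 * k * m - 128/9009 * a^2 * k^2 * m^2 - 4544/135135 * a^2 * k^2
      - 1024/45045 * a * k^3 * m^3 - 3712/135135 * a * k^3 * m - 2048/135135 * k^4 * m^2 - 256/15015 * k^4"

definition cubic_moment_201 :: "real \<Rightarrow> real \<Rightarrow> real \<Rightarrow> real" where
  "cubic_moment_201 a k m = 4/77 * a^3 * m + 424/10395 * a^2 * k * m^2 + 248/4455 * a^2 * k + 592/10395 * a * k^2 * m^3
      + 2416/31185 * a * k^2 * m + 1184/31185 * k^3 * m^2 + 32/693 * k^3"

definition cubic_moment_002 :: "real \<Rightarrow> real \<Rightarrow> real \<Rightarrow> real" where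
  "cubic_moment_002 a k m = - 16/105 * a^2 * m^2 - 4/63 * a^2 - 16/105 * a * k * m^3 - 88/315 * a * k * m
      - 32/315 * k^2 * m^2 - 16/105 * k^2"

definition cubic_moment_140 :: "real \<Rightarrow> real \<Rightarrow> real \<Rightarrow> real" where
  "cubic_moment_140 a k m = 3/32 * a * m^4 + 1/16 * a * m^2 - 1/32 * a + 1/16 * k * m^3 + 1/16 * k * m"

definition cubic_moment_230 :: "real \<Rightarrow> real \<Rightarrow> real \<Rightarrow> real" where
  "cubic_moment_230 a k m = - 3/64 * a * k * m^4 - 1/32 * a * k * m^2 + 1/64 * a * k - 1/32 * k^2 * m^3 - 1/32 * k^2 * m"

definition cubic_moment_320 :: "real \<Rightarrow> real \<Rightarrow> real \<Rightarrow> real" where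
  "cubic_moment_320 a k m = 1/96 * a^3 * m^2 - 1/288 * a^3 + 1/192 * a^2 * k * m^3 + 1/192 * a^2 * k * m + 7/384 * a * k^2 * m^4
      + 1/48 * a * k^2 * m^2 - 1/128 * a * k^2 + 7/576 * k^3 * m^3 + 1/64 * k^3 * m"

definition cubic_moment_410 :: "real \<Rightarrow> real \<Rightarrow> real \<Rightarrow> real" where
  "cubic_moment_410 a k m = - 1/96 * a^3 * k * m^2 + 1/288 * a^3 * k - 1/192 * a^2 * k^2 * m^3 - 1/192 * a^2 * k^2 * m
      - 5/768 * a * k^3 * m^4 - 5/384 * a * k^3 * m^2 + 1/256 * a * k^3 - 5/1152 * k^4 * m^3 - 1/128 * k^4 * m"

definition cubic_moment_500 :: "real \<Rightarrow> real \<Rightarrow> real \<Rightarrow> real" where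
  "cubic_moment_500 a k m = 5/768 * a^3 * k^2 * m^2 - 5/2304 * a^3 * k^2 + 5/1536 * a^2 * k^3 * m^3 + 5/1536 * a^2 * k^3 * m
      + 55/24576 * a * k^4 * m^4 + 85/12288 * a * k^4 * m^2 - 15/8192 * a * k^4 + 55/36864 * k^5 * m^3 + 15/4096 * k^5 * m"

definition cubic_moment_301 :: "real \<Rightarrow> real \<Rightarrow> real \<Rightarrow> real" where
  "cubic_moment_301 a k m = - 17/1536 * a^3 * k * m^2 + 17/4608 * a^3 * k - 13/1536 * a^2 * k^2 * m^3 - 7/1536 * a^2 * k^2 * m
      - 67/12288 * a * k^3 * m^4 - 109/6144 * a * k^3 * m^2 + 19/4096 * a * k^3 - 67/18432 * k^4 * m^3 - 19/2048 * k^4 * m"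

definition cubic_moment_211 :: "real \<Rightarrow> real \<Rightarrow> real \<Rightarrow> real" where
  "cubic_moment_211 a k m = 5/384 * a^3 * m^2 - 5/1152 * a^3 + 11/768 * a^2 * k * m^3 + 1/256 * a^2 * k * m
      + 49/3072 * a * k^2 * m^4 + 53/1536 * a * k^2 * m^2 - 31/3072 * a * k^2 + 49/4608 * k^3 * m^3 + 31/1536 * k^3 * m"

definition cubic_moment_012 :: "real \<Rightarrow> real \<Rightarrow> real \<Rightarrow> real" where
  "cubic_moment_012 a k m = - 3/64 * a^2 * m^3 + 1/64 * a^2 * m - 21/512 * a * k * m^4 - 27/256 * a * k * m^2
      + 15/512 * a * k - 7/256 * k^2 * m^3 - 15/256 * k^2 * m"

lemmas cubic_moment_defs = cubic_moment_110_def cubic_moment_200_def cubic_moment_120_def cubic_moment_210_def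
    cubic_moment_300_def
  cubic_moment_130_def cubic_moment_220_def cubic_moment_310_def cubic_moment_400_def cubic_moment_201_def
  cubic_moment_002_def cubic_moment_140_def cubic_moment_230_def cubic_moment_320_def cubic_moment_410_def
  cubic_moment_500_def cubic_moment_301_def cubic_moment_211_def cubic_moment_012_def

text \<open>The primitive F of P' T, as verified in \<open>has_derivative_quartic\<close>. The
  leading zero makes it divisible by the sine, hence zero at both ends.\<close>

abbreviation quartic_coeffs :: "real \<Rightarrow> real \<Rightarrow> real \<Rightarrow> real list" where
  "quartic_coeffs a k m \<equiv> [0, a, a * m / 2 - k, - (k * m), - (a * m / 2) - k * m\<^sup>2 / 4 - k / 4]"

context
  fixes a k m e :: real
  assumes a: "a = - (3 * e + k * m)"
begin

abbreviation "pc \<equiv> [0, a, - k, e]"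
abbreviation "tc \<equiv> [1, m]"
abbreviation "dc \<equiv> [m, -1 :: real]"
abbreviation "fc \<equiv> quartic_coeffs a k m"

lemmas form_product = form_mult coeffs_mult_nonempty eval_nat_numeral ac_simps

text \<open>All nineteen evaluations run alike: \<open>coeffs_mult\<close> expands the integrand,
  \<open>moment_simps\<close> integrates it, and substituting the context assumption for
  \<open>a\<close> leaves a polynomial identity in \<open>e\<close>, \<open>k\<close> and
  \<open>m\<close>.\<close>

lemma cubic_moment_110: "((\<lambda>t. form pc t * form tc t * form dc t) has_integral cubic_moment_110 a k m) {0..pi}"
  by (rule has_integral_formI[of _ "coeffs_mult pc (coeffs_mult tc dc)"],
      simp add: form_product del: form.simps coeffs_mult.simps,
      simp add: cubic_moment_110_def moment_simps, (simp add: a)?, (simp add: field_simps)?, algebra?)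

lemma cubic_moment_200: "((\<lambda>t. form pc t ^ 2 * form dc t) has_integral cubic_moment_200 a k m) {0..pi}"
  by (rule has_integral_formI[of _ "coeffs_mult pc (coeffs_mult pc dc)"],
      simp add: form_product del: form.simps coeffs_mult.simps,
      simp add: cubic_moment_200_def moment_simps, (simp add: a)?, (simp add: field_simps)?, algebra?)

lemma cubic_moment_120: "((\<lambda>t. form pc t * form tc t ^ 2 * form dc t) has_integral cubic_moment_120 a k m * pi) {0..pi}"
  by (rule has_integral_formI[of _ "coeffs_mult (coeffs_mult pc tc) (coeffs_mult tc dc)"],
      simp add: form_product del: form.simps coeffs_mult.simps,
      simp add: cubic_moment_120_def moment_simps, (simp add: a)?, (simp add: field_simps)?, algebra?)

lemma cubic_moment_210: "((\<lambda>t. form pc t ^ 2 * form tc t * form dc t) has_integral cubic_moment_210 a k m * pi) {0..pi}"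
  by (rule has_integral_formI[of _ "coeffs_mult (coeffs_mult pc pc) (coeffs_mult tc dc)"],
      simp add: form_product del: form.simps coeffs_mult.simps,
      simp add: cubic_moment_210_def moment_simps, (simp add: a)?, (simp add: field_simps)?, algebra?)

lemma cubic_moment_300: "((\<lambda>t. form pc t ^ 3 * form dc t) has_integral cubic_moment_300 a k m * pi) {0..pi}"
  by (rule has_integral_formI[of _ "coeffs_mult (coeffs_mult pc pc) (coeffs_mult pc dc)"],
      simp add: form_product del: form.simps coeffs_mult.simps,
      simp add: cubic_moment_300_def moment_simps, (simp add: a)?, (simp add: field_simps)?, algebra?)

lemma cubic_moment_130: "((\<lambda>t. form pc t * form tc t ^ 3 * form dc t) has_integral cubic_moment_130 a k m) {0..pi}"
  by (rule has_integral_formI[of _ "coeffs_mult (coeffs_mult pc tc) (coeffs_mult tc (coeffs_mult tc dc))"],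
      simp add: form_product del: form.simps coeffs_mult.simps,
      simp add: cubic_moment_130_def moment_simps, (simp add: a)?, (simp add: field_simps)?, algebra?)

lemma cubic_moment_220: "((\<lambda>t. form pc t ^ 2 * form tc t ^ 2 * form dc t) has_integral cubic_moment_220 a k m) {0..pi}"
  by (rule has_integral_formI[of _ "coeffs_mult (coeffs_mult pc pc) (coeffs_mult tc (coeffs_mult tc dc))"],
      simp add: form_product del: form.simps coeffs_mult.simps,
      simp add: cubic_moment_220_def moment_simps, (simp add: a)?, (simp add: field_simps)?, algebra?)

lemma cubic_moment_310: "((\<lambda>t. form pc t ^ 3 * form tc t * form dc t) has_integral cubic_moment_310 a k m) {0..pi}"
  by (rule has_integral_formI[of _ "coeffs_mult (coeffs_mult pc pc) (coeffs_mult pc (coeffs_mult tc dc))"],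
      simp add: form_product del: form.simps coeffs_mult.simps,
      simp add: cubic_moment_310_def moment_simps, (simp add: a)?, (simp add: field_simps)?, algebra?)

lemma cubic_moment_400: "((\<lambda>t. form pc t ^ 4 * form dc t) has_integral cubic_moment_400 a k m) {0..pi}"
  by (rule has_integral_formI[of _ "coeffs_mult (coeffs_mult pc pc) (coeffs_mult pc (coeffs_mult pc dc))"],
      simp add: form_product del: form.simps coeffs_mult.simps,
      simp add: cubic_moment_400_def moment_simps, (simp add: a)?, (simp add: field_simps)?, algebra?)

lemma cubic_moment_201: "((\<lambda>t. form pc t ^ 2 * form fc t * form dc t) has_integral cubic_moment_201 a k m) {0..pi}"
  by (rule has_integral_formI[of _ "coeffs_mult (coeffs_mult pc pc) (coeffs_mult fc dc)"],
      simp add: form_product del: form.simps coeffs_mult.simps,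
      simp add: cubic_moment_201_def moment_simps, (simp add: a)?, (simp add: field_simps)?, algebra?)

lemma cubic_moment_002: "((\<lambda>t. form fc t ^ 2 * form dc t) has_integral cubic_moment_002 a k m) {0..pi}"
  by (rule has_integral_formI[of _ "coeffs_mult fc (coeffs_mult fc dc)"],
      simp add: form_product del: form.simps coeffs_mult.simps,
      simp add: cubic_moment_002_def moment_simps, (simp add: a)?, (simp add: field_simps)?, algebra?)

lemma cubic_moment_140: "((\<lambda>t. form pc t * form tc t ^ 4 * form dc t) has_integral cubic_moment_140 a k m * pi) {0..pi}"
  by (rule has_integral_formI[of _ "coeffs_mult (coeffs_mult pc (coeffs_mult tc tc)) (coeffs_mult tc (coeffs_mult tc dc))"],
      simp add: form_product del: form.simps coeffs_mult.simps,
      simp add: cubic_moment_140_def moment_simps, (simp add: a)?, (simp add: field_simps)?, algebra?)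

lemma cubic_moment_230: "((\<lambda>t. form pc t ^ 2 * form tc t ^ 3 * form dc t) has_integral cubic_moment_230 a k m * pi) {0..pi}"
  by (rule has_integral_formI[of _ "coeffs_mult (coeffs_mult pc (coeffs_mult pc tc)) (coeffs_mult tc (coeffs_mult tc dc))"],
      simp add: form_product del: form.simps coeffs_mult.simps,
      simp add: cubic_moment_230_def moment_simps, (simp add: a)?, (simp add: field_simps)?, algebra?)

lemma cubic_moment_320: "((\<lambda>t. form pc t ^ 3 * form tc t ^ 2 * form dc t) has_integral cubic_moment_320 a k m * pi) {0..pi}"
  by (rule has_integral_formI[of _ "coeffs_mult (coeffs_mult pc (coeffs_mult pc pc)) (coeffs_mult tc (coeffs_mult tc dc))"],
      simp add: form_product del: form.simps coeffs_mult.simps,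
      simp add: cubic_moment_320_def moment_simps, (simp add: a)?, (simp add: field_simps)?, algebra?)

lemma cubic_moment_410: "((\<lambda>t. form pc t ^ 4 * form tc t * form dc t) has_integral cubic_moment_410 a k m * pi) {0..pi}"
  by (rule has_integral_formI[of _ "coeffs_mult (coeffs_mult pc (coeffs_mult pc pc)) (coeffs_mult pc (coeffs_mult tc dc))"],
      simp add: form_product del: form.simps coeffs_mult.simps,
      simp add: cubic_moment_410_def moment_simps, (simp add: a)?, (simp add: field_simps)?, algebra?)

lemma cubic_moment_500: "((\<lambda>t. form pc t ^ 5 * form dc t) has_integral cubic_moment_500 a k m * pi) {0..pi}"
  by (rule has_integral_formI[of _ "coeffs_mult (coeffs_mult pc (coeffs_mult pc pc)) (coeffs_mult pc (coeffs_mult pc dc))"],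
      simp add: form_product del: form.simps coeffs_mult.simps,
      simp add: cubic_moment_500_def moment_simps, (simp add: a)?, (simp add: field_simps)?, algebra?)

lemma cubic_moment_301: "((\<lambda>t. form pc t ^ 3 * form fc t * form dc t) has_integral cubic_moment_301 a k m * pi) {0..pi}"
  by (rule has_integral_formI[of _ "coeffs_mult (coeffs_mult pc pc) (coeffs_mult pc (coeffs_mult fc dc))"],
      simp add: form_product del: form.simps coeffs_mult.simps,
      simp add: cubic_moment_301_def moment_simps, (simp add: a)?, (simp add: field_simps)?, algebra?)

lemma cubic_moment_211: "((\<lambda>t. form pc t ^ 2 * form tc t * form fc t * form dc t) has_integral cubic_moment_211 a k m * pi)
    {0..pi}"
  by (rule has_integral_formI[of _ "coeffs_mult (coeffs_mult pc pc) (coeffs_mult tc (coeffs_mult fc dc))"],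
      simp add: form_product del: form.simps coeffs_mult.simps,
      simp add: cubic_moment_211_def moment_simps, (simp add: a)?, (simp add: field_simps)?, algebra?)

lemma cubic_moment_012: "((\<lambda>t. form tc t * form fc t ^ 2 * form dc t) has_integral cubic_moment_012 a k m * pi) {0..pi}"
  by (rule has_integral_formI[of _ "coeffs_mult (coeffs_mult tc fc) (coeffs_mult fc dc)"],
      simp add: form_product del: form.simps coeffs_mult.simps,
      simp add: cubic_moment_012_def moment_simps, (simp add: a)?, (simp add: field_simps)?, algebra?)

lemmas cubic_moments = cubic_moment_110 cubic_moment_200 cubic_moment_120 cubic_moment_210 cubic_moment_300 cubic_moment_130
  cubic_moment_220 cubic_moment_310 cubic_moment_400 cubic_moment_201 cubic_moment_002 cubic_moment_140
  cubic_moment_230 cubic_moment_320 cubic_moment_410 cubic_moment_500 cubic_moment_301 cubic_moment_211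
  cubic_moment_012

end

section \<open>Integration by parts\<close>

lemma power_derivative_simps: "2 - Suc 0 = 1" "3 - Suc 0 = 2" "4 - Suc 0 = 3" "5 - Suc 0 = 4" "6 - Suc 0 = 5"
  "real (numeral k) = numeral k" "x ^ 1 = (x :: real)"
  by simp_all

text \<open>Up to an exact derivative, \<open>obstr E q n\<close> is \<open>- lam * obstr_weight_n * T'\<close>; the arguments \<open>p\<close>, \<open>y\<close>, \<open>f\<close>
  stand for \<open>P\<close>, \<open>T\<close> and the primitive \<open>F\<close> of \<open>P' * T\<close>.\<close>

definition obstr_weight_2 :: "real \<Rightarrow> real \<Rightarrow> real \<Rightarrow> real \<Rightarrow> real \<Rightarrow> real" where
  "obstr_weight_2 lam n p y f = 2 * p * y - 1 / 2 * (n + 3) * p ^ 2"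

definition obstr_weight_3 :: "real \<Rightarrow> real \<Rightarrow> real \<Rightarrow> real \<Rightarrow> real \<Rightarrow> real" where
  "obstr_weight_3 lam n p y f = - 3 * p * y ^ 2 + (2 * n + 3) * p ^ 2 * y - 1 / 3 * (n ^ 2 + 6 * n) * p ^ 3"

definition obstr_weight_4 :: "real \<Rightarrow> real \<Rightarrow> real \<Rightarrow> real \<Rightarrow> real \<Rightarrow> real" where
  "obstr_weight_4 lam n p y f = 4 * p * y ^ 3 - 9 / 2 * (n + 1) * p ^ 2 * y ^ 2 + (2 * n ^ 2 + 6 * n) * p ^ 3 * y
     - 1 / 4 * (n ^ 3 + 9 * n ^ 2) * p ^ 4
     + 1 / 2 * lam * (n * (- 2 / 3 * p ^ 3 * y + p ^ 2 * f - 1 / 4 * p ^ 4)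
        - f ^ 2 + 3 * p ^ 2 * f - 9 / 4 * p ^ 4)"

definition obstr_weight_5 :: "real \<Rightarrow> real \<Rightarrow> real \<Rightarrow> real \<Rightarrow> real \<Rightarrow> real" where
  "obstr_weight_5 lam n p y f = - 5 * p * y ^ 4 + (8 * n + 6) * p ^ 2 * y ^ 3 - (6 * n ^ 2 + 12 * n) * p ^ 3 * y ^ 2
     + (2 * n ^ 3 + 9 * n ^ 2) * p ^ 4 * y - 1 / 5 * (n ^ 4 + 12 * n ^ 3) * p ^ 5
     + lam * (n ^ 2 * (- 1 / 3 * (p ^ 4 * y) + 2 / 3 * p ^ 3 * f - 3 / 10 * p ^ 5)
        - 2 * n * (- (p ^ 3 * y ^ 2) + 2 * p ^ 2 * f * y - 1 / 2 * (p ^ 4 * y) - 2 * p ^ 3 * f + 9 / 5 * p ^ 5)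
        + 2 * f ^ 2 * y - 6 * p ^ 2 * f * y + 9 / 2 * p ^ 4 * y)"

context
  fixes lam n b :: real and P P' T T' F E q :: "real \<Rightarrow> real"
  assumes b: "b \<ge> 0" and lam: "lam \<noteq> 0" and n: "n = lam + 3"
    and P: "\<And>t. t \<in> {0..b} \<Longrightarrow> (P has_real_derivative P' t) (at t within {0..b})"
    and T: "\<And>t. t \<in> {0..b} \<Longrightarrow> (T has_real_derivative T' t) (at t within {0..b})"
    and F: "\<And>t. t \<in> {0..b} \<Longrightarrow> (F has_real_derivative P' t * T t) (at t within {0..b})"
    and P'c: "continuous_on {0..b} P'" and T'c: "continuous_on {0..b} T'"
    and ends: "P 0 = 0" "P b = 0" "F 0 = 0"
    and E: "E = (\<lambda>t. lam * P' t * (T t - 3 * P t))" and q: "q = (\<lambda>t. n * P t - T t)"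
    and obstr: "\<And>k. integral {0..b} (obstr E q k) = 0"
begin

lemma cont: "continuous_on {0..b} P" "continuous_on {0..b} T" "continuous_on {0..b} F"
  using DERIV_continuous_on[OF P] DERIV_continuous_on[OF T] DERIV_continuous_on[OF F] by blast+

lemma Ec: "continuous_on {0..b} E" and qc: "continuous_on {0..b} q"
  unfolding E q by (intro continuous_intros P'c cont)+

text \<open>The primitive of \<open>E\<close> that vanishes at 0, that is, minus the first
  coefficient of the formal first integral.\<close>

definition "Eint t = lam * (F t - 3 / 2 * P t ^ 2)"

lemma Eint: "t \<in> {0..b} \<Longrightarrow> (Eint has_real_derivative E t) (at t within {0..b})"
  unfolding Eint_def E by (auto intro!: derivative_eq_intros P F simp: algebra_simps)

lemma obstr_1_integral: "t \<in> {0..b} \<Longrightarrow> integral {0..t} (obstr E q (Suc 0)) = - Eint t"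
proof -
  assume t: "t \<in> {0..b}"
  have "(obstr E q (Suc 0) has_integral (- Eint t - - Eint 0)) {0..t}"
  proof (rule fundamental_theorem_of_calculus)
    fix s assume "s \<in> {0..t}"
    then have "s \<in> {0..b}" "{0..t} \<subseteq> {0..b}" using t by auto
    then have "((\<lambda>s. - Eint s) has_real_derivative obstr E q (Suc 0) s) (at s within {0..t})"
      using DERIV_minus[OF DERIV_subset[OF Eint]] by simp
    then show "((\<lambda>s. - Eint s) has_vector_derivative obstr E q (Suc 0) s) (at s within {0..t})"
      by (simp add: has_real_derivative_iff_has_vector_derivative)
  qed (use t in auto)
  then show ?thesis by (simp add: integral_unique Eint_def ends)
qed

text \<open>This is the obstruction of index 1: since P vanishes at \<open>b\<close>, the value of
  \<open>Eint\<close> there is lam F b.\<close>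

lemma F_end: "F b = 0"
  using obstr_1_integral[of b] obstr[of "Suc 0"] b lam by (simp add: Eint_def ends)

lemma Eint_end: "Eint 0 = 0" "Eint b = 0"
  by (simp_all add: Eint_def ends F_end)

lemma obstr_deriv:
  "t \<in> {0..b} \<Longrightarrow> ((\<lambda>t. integral {0..t} (obstr E q k)) has_real_derivative obstr E q k t) (at t within {0..b})"
  by (rule integral_has_real_derivative[OF continuous_on_obstr[OF Ec qc]])

lemma obstr_2: "obstr E q 2 t = - (q t * E t)"
  by (simp add: numeral_2_eq_2)

lemma obstr_3: "t \<in> {0..b} \<Longrightarrow> obstr E q 3 t = - (q t ^ 2 * E t) - Eint t * E t"
proof -
  assume "t \<in> {0..b}"
  then have "obstr E q 3 t = q t * (- (q t * E t)) + - Eint t * E t"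
    unfolding numeral_3_eq_3 obstr.simps(3)[of E q "Suc 0"] obstr_2[unfolded numeral_2_eq_2]
    by (simp only: obstr_1_integral of_nat_Suc of_nat_0 add_0_right mult_1_left)
  then show ?thesis by (simp add: power2_eq_square)
qed

lemma obstr_4: "obstr E q 4 t = q t * obstr E q 3 t + 2 * integral {0..t} (obstr E q 2) * E t"
  using obstr.simps(3)[of E q 2 t] by simp

lemma obstr_5: "obstr E q 5 t = q t * obstr E q 4 t + 3 * integral {0..t} (obstr E q 3) * E t"
  using obstr.simps(3)[of E q 3 t] by simp

text \<open>Frame for the integrations by parts: G collects the boundary terms, which agree at the
  two ends, and W T' is what remains of the obstruction.\<close>

lemma weighted_integral_zero:
  assumes "\<And>t. t \<in> {0..b} \<Longrightarrow> (G has_real_derivative obstr E q k t + lam * (W t * T' t)) (at t within {0..b})"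
    and "G 0 = G b" and "continuous_on {0..b} W"
  shows "((\<lambda>t. W t * T' t) has_integral 0) {0..b}"
proof -
  have W: "(\<lambda>t. W t * T' t) integrable_on {0..b}"
    by (intro integrable_continuous_real continuous_intros assms(3) T'c)
  have W': "(\<lambda>t. lam * (W t * T' t)) integrable_on {0..b}"
    by (intro integrable_continuous_real continuous_intros assms(3) T'c)
  have "obstr E q k integrable_on {0..b}"
    by (intro integrable_continuous_real continuous_on_obstr Ec qc)
  then have "integral {0..b} (\<lambda>t. obstr E q k t + lam * (W t * T' t)) = lam * integral {0..b} (\<lambda>t. W t * T' t)"
    using W W' by (subst integral_add) (auto simp: obstr)
  moreover have "integral {0..b} (\<lambda>t. obstr E q k t + lam * (W t * T' t)) = 0"
    by (rule integral_derivative_zero[OF b assms(1,2)])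
  ultimately have "integral {0..b} (\<lambda>t. W t * T' t) = 0" using lam by simp
  then show ?thesis using integrable_integral[OF W] by simp
qed

text \<open>The witness replaces each monomial P^i T^j P' of the obstruction by P^(i+1) T^j / (i+1).
  Differentiating T^j leaves terms with the factor T', which form the weight.\<close>

lemma weight_2: "((\<lambda>t. obstr_weight_2 lam n (P t) (T t) (F t) * T' t) has_integral 0) {0..b}"
proof (rule weighted_integral_zero)
  fix t assume t: "t \<in> {0..b}"
  have Et: "E t = lam * P' t * (T t - 3 * P t)" and qt: "q t = n * P t - T t" by (simp_all add: E q)
  show "((\<lambda>t. - lam * (- (P t * T t ^ 2) + 1 / 2 * (n + 3) * P t ^ 2 * T t - n * P t ^ 3)) has_real_derivative
      obstr E q 2 t + lam * (obstr_weight_2 lam n (P t) (T t) (F t) * T' t)) (at t within {0..b})"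
    unfolding obstr_2 obstr_weight_2_def by (rule derivative_eq_intros P[OF t] T[OF t] refl)+
      (simp only: Et qt power_derivative_simps, algebra)
qed (auto intro!: continuous_intros cont simp: obstr_weight_2_def ends)

text \<open>The polynomial part is treated as for index 2; the new term - Eint E is exact, with
  primitive - Eint^2 / 2.\<close>

lemma weight_3: "((\<lambda>t. obstr_weight_3 lam n (P t) (T t) (F t) * T' t) has_integral 0) {0..b}"
proof (rule weighted_integral_zero)
  fix t assume t: "t \<in> {0..b}"
  note o = obstr_3[OF t]
  have Et: "E t = lam * P' t * (T t - 3 * P t)" and qt: "q t = n * P t - T t" by (simp_all add: E q)
  show "((\<lambda>t. - lam * (P t * T t ^ 3 - 1 / 2 * (2 * n + 3) * P t ^ 2 * T t ^ 2 + 1 / 3 * (n ^ 2 + 6 * n) * P t ^ 3 * T t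
        - 3 / 4 * n ^ 2 * P t ^ 4) - 1 / 2 * Eint t ^ 2) has_real_derivative
      obstr E q 3 t + lam * (obstr_weight_3 lam n (P t) (T t) (F t) * T' t))
      (at t within {0..b})"
    unfolding o obstr_weight_3_def by (rule derivative_eq_intros P[OF t] T[OF t] Eint[OF t] refl)+
      (simp only: Et qt power_derivative_simps, algebra)
qed (auto intro!: continuous_intros cont simp: obstr_weight_3_def ends Eint_end)

text \<open>Because G' = - q E, the nonlocal term 2 G E is 2 q E Eint up to the derivative of 2 G
  Eint. Altogether q E Eint remains, which is - q' Eint^2 / 2 up to a derivative. With q' = n P' -
  T', the part containing P' is reduced further by F' = P' T.\<close>

lemma weight_4: "((\<lambda>t. obstr_weight_4 lam n (P t) (T t) (F t) * T' t) has_integral 0) {0..b}"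
proof (rule weighted_integral_zero)
  define G where "G t = integral {0..t} (obstr E q 2)" for t
  fix t assume t: "t \<in> {0..b}"
  have G: "(G has_real_derivative - (q t * E t)) (at t within {0..b})"
    using obstr_deriv[OF t, of 2] unfolding obstr_2 G_def .
  have o: "obstr E q 4 t = - (q t ^ 3 * E t) - q t * Eint t * E t + 2 * G t * E t"
    unfolding obstr_4 obstr_3[OF t] G_def[symmetric] by algebra
  have Et: "E t = lam * P' t * (T t - 3 * P t)" and qt: "q t = n * P t - T t"
    and et: "Eint t = lam * (F t - 3 / 2 * P t ^ 2)" by (simp_all add: E q Eint_def)
  show "((\<lambda>t. - lam * (- (P t * T t ^ 4) + 3 / 2 * (n + 1) * P t ^ 2 * T t ^ 3 - (n ^ 2 + 3 * n) * P t ^ 3 * T t ^ 2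
        + 1 / 4 * (n ^ 3 + 9 * n ^ 2) * P t ^ 4 * T t - 3 / 5 * n ^ 3 * P t ^ 5
        + 1 / 2 * lam * (n * (F t ^ 2 * P t - P t ^ 2 * F t * T t + 1 / 3 * (P t ^ 3 * T t ^ 2) - F t * P t ^ 3
          + 1 / 4 * (P t ^ 4 * T t) + 9 / 20 * P t ^ 5)))
        + 1 / 2 * (Eint t ^ 2 * (n * P t - T t)) + 2 * G t * Eint t) has_real_derivative
      obstr E q 4 t + lam * (obstr_weight_4 lam n (P t) (T t) (F t) * T' t)) (at t within {0..b})"
    unfolding o obstr_weight_4_def by (rule derivative_eq_intros P[OF t] T[OF t] F[OF t] Eint[OF t] G refl)+
      (simp only: Et qt et power_derivative_simps, algebra)
qed (auto intro!: continuous_intros cont simp: obstr_weight_4_def ends Eint_end F_end)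

text \<open>Now 2 q G E is the derivative of - G^2, and 3 H E becomes 3 q^2 E Eint + 3 Eint^2 E up
  to the derivative of 3 H Eint. The last summand is exact, and 2 q^2 E Eint remains, which is - 2 q
  q' Eint^2 up to a derivative. The term G^2 has equal end values because the obstruction of index 2
  vanishes.\<close>

lemma weight_5: "((\<lambda>t. obstr_weight_5 lam n (P t) (T t) (F t) * T' t) has_integral 0) {0..b}"
proof (rule weighted_integral_zero)
  define G where "G t = integral {0..t} (obstr E q 2)" for t
  define H where "H t = integral {0..t} (obstr E q 3)" for t
  fix t assume t: "t \<in> {0..b}"
  have G: "(G has_real_derivative - (q t * E t)) (at t within {0..b})"
    using obstr_deriv[OF t, of 2] unfolding obstr_2 G_def .
  note o3 = obstr_3[OF t]
  have H: "(H has_real_derivative - (q t ^ 2 * E t) - Eint t * E t) (at t within {0..b})"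
    using obstr_deriv[OF t, of 3] unfolding o3 H_def .
  have o: "obstr E q 5 t = - (q t ^ 4 * E t) - q t ^ 2 * Eint t * E t + 2 * q t * G t * E t + 3 * H t * E t"
    unfolding obstr_5 obstr_4 obstr_3[OF t] G_def[symmetric] H_def[symmetric] by algebra
  have Et: "E t = lam * P' t * (T t - 3 * P t)" and qt: "q t = n * P t - T t"
    and et: "Eint t = lam * (F t - 3 / 2 * P t ^ 2)" by (simp_all add: E q Eint_def)
  show "((\<lambda>t. - lam * (P t * T t ^ 5 - 1 / 2 * (4 * n + 3) * P t ^ 2 * T t ^ 4 + (2 * n ^ 2 + 4 * n) * P t ^ 3 * T t ^ 3
        - 1 / 2 * (2 * n ^ 3 + 9 * n ^ 2) * P t ^ 4 * T t ^ 2 + 1 / 5 * (n ^ 4 + 12 * n ^ 3) * P t ^ 5 * T t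
            - 1 / 2 * n ^ 4 * P t ^ 6
        + lam * (n ^ 2 * (F t ^ 2 * P t ^ 2 - 2 / 3 * F t * T t * P t ^ 3 + 1 / 6 * (P t ^ 4 * T t ^ 2)
            - 3 * (1 / 2 * (F t * P t ^ 4) - 1 / 10 * (P t ^ 5 * T t)) + 3 / 4 * P t ^ 6)
          - 2 * n * (F t ^ 2 * P t * T t - F t * T t ^ 2 * P t ^ 2 + 1 / 3 * (P t ^ 3 * T t ^ 3)
            - 3 * (1 / 3 * (F t * T t * P t ^ 3) - 1 / 12 * (P t ^ 4 * T t ^ 2)) + 9 / 20 * P t ^ 5 * T t)))
        - G t ^ 2 + 3 * H t * Eint t + Eint t ^ 3 + (n * P t - T t) ^ 2 * Eint t ^ 2) has_real_derivative
      obstr E q 5 t + lam * (obstr_weight_5 lam n (P t) (T t) (F t) * T' t)) (at t within {0..b})"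
    unfolding o obstr_weight_5_def by (rule derivative_eq_intros P[OF t] T[OF t] F[OF t] Eint[OF t] G H refl)+
      (simp only: Et qt et power_derivative_simps, algebra)
qed (auto intro!: continuous_intros cont simp: obstr_weight_5_def ends Eint_end F_end obstr)

end

section \<open>From a center to vanishing obstructions\<close>

lemma obstr_scale: "obstr (\<lambda>t. b\<^sup>2 * E t) (\<lambda>t. b * q t) n t = b ^ Suc n * obstr E q n t"
proof (induction n arbitrary: t rule: less_induct)
  case (less n)
  consider "n = 0" | "n = Suc 0" | m where "n = Suc (Suc m)" by (metis not0_implies_Suc)
  then show ?case
  proof cases
    case 3
    have 1: "obstr (\<lambda>t. b\<^sup>2 * E t) (\<lambda>t. b * q t) (Suc m) t = b ^ Suc (Suc m) * obstr E q (Suc m) t"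
      by (rule less) (simp add: 3)
    have "obstr (\<lambda>t. b\<^sup>2 * E t) (\<lambda>t. b * q t) m = (\<lambda>t. b ^ Suc m * obstr E q m t)"
      by (rule ext, rule less) (simp add: 3)
    then have 2: "integral {0..t} (obstr (\<lambda>t. b\<^sup>2 * E t) (\<lambda>t. b * q t) m) = b ^ Suc m * integral {0..t} (obstr E q m)"
      by simp
    show ?thesis unfolding 3 obstr.simps 1 2 by (simp add: algebra_simps power2_eq_square)
  qed (auto simp: power2_eq_square)
qed

lemma radial_form_eq: "radial_form a20 a11 a02 b20 b11 b02 = form [a20, a11 + b20, a02 + b11, b02]"
  by (simp add: fun_eq_iff radial_form_def power2_eq_square power3_eq_cube algebra_simps)

text \<open>The parametrization used from here on: the relation a11 + b20 + 2 b02 = 0 leaves five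
  parameters, namely the three coefficients of P and the two of T. They are chosen so that the
  radial form is P' and the angular form is T - 3 P.\<close>

lemma line_angular_form:
  fixes a b k m e t :: real
  shows "angular_form a (- b - 2 * k) (3 * e - m) b (m - 2 * a) k t = form [b, m] t - 3 * form [0, a, - k, e] t"
proof -
  have "sin t * sin t = 1 - cos t * cos t" using sin_cos_squared_add3[of t] by linarith
  then show ?thesis unfolding angular_form_def form.simps list.size power2_eq_square power_Suc power_0 by simp algebra
qed

lemma has_derivative_cubic:
  fixes a k e t :: real
  shows "(form [0, a, - k, e] has_real_derivative form [a, - 2 * k, 3 * e - 2 * a, k] t) (at t within S)"
proof -
  have f: "form [0, a, - k, e] = (\<lambda>t. sin t * (a * (cos t * cos t) + sin t * (- k * cos t + sin t * e)))"
    by (simp add: fun_eq_iff)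
  show ?thesis unfolding f
    by (auto intro!: derivative_eq_intros simp: power2_eq_square power3_eq_cube algebra_simps)
qed

lemma has_derivative_line:
  fixes b m t :: real
  shows "(form [b, m] has_real_derivative form [m, - b] t) (at t within S)"
proof -
  have "form [b, m] = (\<lambda>t. b * cos t + sin t * m)" by (simp add: fun_eq_iff)
  then show ?thesis by (auto intro!: derivative_eq_intros)
qed

lemma continuous_on_form: "continuous_on S (form xs)"
proof (induction xs)
  case (Cons x xs)
  then have "continuous_on S (\<lambda>t. x * cos t ^ length xs + sin t * form xs t)" by (intro continuous_intros)
  then show ?case by (simp cong: continuous_on_cong)
qed (simp cong: continuous_on_cong)

text \<open>With R a primitive of A, the function u + lam R has derivative lam A B / (u + B) = O(1 /
  v), so lam R pi is O(1 / v) on closed orbits and hence zero. This has to precede the substitution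
  z = u + lam P, which needs a primitive of A that vanishes at both ends.\<close>

lemma center_mean_zero:
  fixes a20 a11 a02 b20 b11 b02 :: real
  assumes lam: "lam \<noteq> 0"
    and center: "switching_center lam (upper_field lam 0 a20 a11 a02 b20 b11 b02) (lower_field 0)"
  shows "a11 + b20 + 2 * b02 = 0"
proof -
  define A where "A = radial_form a20 a11 a02 b20 b11 b02"
  define B where "B = angular_form a20 a11 a02 b20 b11 b02"
  have Ac: "continuous_on {0..pi} A" and Bc: "continuous_on {0..pi} B"
    unfolding A_def B_def by (rule continuous_on_forms)+
  obtain C U where orbits: "\<forall>v\<ge>U. \<exists>u. u 0 = v \<and> (\<forall>t\<in>{0..pi}. \<bar>u t - v\<bar> \<le> C) \<and> u pi = v \<and> recip_orbit lam A B u"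
    using center_recip_orbits[OF lam center] unfolding A_def B_def by blast
  have "continuous_on {0..pi} (\<lambda>t. lam * A t * B t)" by (intro continuous_intros Ac Bc)
  then obtain K where K: "K \<ge> 0" "\<And>t. t \<in> {0..pi} \<Longrightarrow> \<bar>lam * A t * B t\<bar> \<le> K" using bounded_on_interval by blast
  obtain Q where Q: "Q \<ge> 0" "\<And>t. t \<in> {0..pi} \<Longrightarrow> \<bar>B t\<bar> \<le> Q" using bounded_on_interval[OF Bc] by blast
  define R where "R t = integral {0..t} A" for t
  have R: "(R has_real_derivative A t) (at t within {0..pi})" if "t \<in> {0..pi}" for t
    unfolding R_def by (rule integral_has_real_derivative[OF Ac that])
  have bound: "\<bar>lam * R pi\<bar> \<le> 4 * K * pi / v" if v: "v \<ge> U" "v \<ge> 2 * C" "v \<ge> 4 * Q" "v \<ge> 1" for v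
  proof -
    obtain u where u: "u 0 = v" "\<forall>t\<in>{0..pi}. \<bar>u t - v\<bar> \<le> C" "u pi = v" "recip_orbit lam A B u"
      using orbits v(1) by blast
    have big: "u t + B t \<ge> v / 4" if "t \<in> {0..pi}" for t
    proof -
      have "\<bar>u t - v\<bar> \<le> C" using u(2) that by blast
      then show ?thesis using Q(2)[OF that] v by (auto simp: abs_le_iff field_simps)
    qed
    have "norm ((u pi + lam * R pi) - (u 0 + lam * R 0)) \<le> K / (v / 4) * norm (pi - 0)"
    proof (rule field_differentiable_bound[of "{0..pi}" "\<lambda>t. u t + lam * R t"])
      fix t assume t: "t \<in> {0..pi}"
      have pos: "u t + B t > 0" using big[OF t] v by linarith
      have "(u has_real_derivative - lam * A t * u t / (u t + B t)) (at t within {0..pi})"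
        using u(4) t unfolding recip_orbit_def by blast
      then have "((\<lambda>t. u t + lam * R t) has_real_derivative - lam * A t * u t / (u t + B t) + lam * A t) (at t within {0..pi})"
        by (auto intro!: derivative_eq_intros R t)
      moreover have "- lam * A t * u t / (u t + B t) + lam * A t = lam * A t * B t / (u t + B t)"
        using pos by (simp add: field_simps)
      ultimately show "((\<lambda>t. u t + lam * R t) has_real_derivative lam * A t * B t / (u t + B t)) (at t within {0..pi})"
        by simp
      have "norm (lam * A t * B t / (u t + B t)) = \<bar>lam * A t * B t\<bar> / (u t + B t)" using pos by (simp add: abs_divide)
      also have "\<dots> \<le> K / (v / 4)" using K(2)[OF t] K(1) big[OF t] v by (intro frac_le) auto
      finally show "norm (lam * A t * B t / (u t + B t)) \<le> K / (v / 4)" .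
    qed auto
    then show ?thesis using u by (simp add: R_def mult.commute)
  qed
  have "\<forall>\<^sub>F v in at_top. \<bar>lam * R pi\<bar> \<le> 4 * K * pi / v"
    using eventually_ge_at_top[of U] eventually_ge_at_top[of "2 * C"] eventually_ge_at_top[of "4 * Q"]
      eventually_ge_at_top[of 1]
    by eventually_elim (rule bound)
  moreover have "((\<lambda>v. 4 * K * pi / v) \<longlongrightarrow> 0) at_top"
    by (rule tendsto_divide_0[OF tendsto_const]) (simp add: filterlim_at_top_imp_at_infinity filterlim_ident)
  ultimately have "\<bar>lam * R pi\<bar> \<le> 0"
    by (intro tendsto_lowerbound[of "\<lambda>v. 4 * K * pi / v" 0 at_top]) auto
  then have "R pi = 0" using lam by simp
  moreover have "R pi = form_integral 0 [a20, a11 + b20, a02 + b11, b02]"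
    unfolding R_def A_def radial_form_eq using has_integral_form by (rule integral_unique)
  ultimately show ?thesis by (simp add: moment_simps field_simps)
qed

text \<open>Adding lam P cancels the part of u' that does not decay: z' = lam P' B / (u + B), and u
  + B = z - q. As P vanishes at both ends, \<open>z\<close> closes up exactly when \<open>u\<close>
  does.\<close>

lemma center_obstr:
  fixes a b k m e :: real
  assumes lam: "lam \<noteq> 0"
    and center: "switching_center lam (upper_field lam 0 a (- b - 2 * k) (3 * e - m) b (m - 2 * a) k) (lower_field 0)"
  defines "P \<equiv> form [0, a, - k, e]" and "P' \<equiv> form [a, - 2 * k, 3 * e - 2 * a, k]" and "T \<equiv> form [b, m]"
  shows "integral {0..pi} (obstr (\<lambda>t. lam * P' t * (T t - 3 * P t)) (\<lambda>t. (lam + 3) * P t - T t) n) = 0"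
proof -
  define A where "A = radial_form a (- b - 2 * k) (3 * e - m) b (m - 2 * a) k"
  define B where "B = angular_form a (- b - 2 * k) (3 * e - m) b (m - 2 * a) k"
  have A: "A = P'" unfolding A_def P'_def radial_form_eq by simp
  have B: "B t = T t - 3 * P t" for t unfolding B_def T_def P_def line_angular_form ..
  obtain C U where orbits: "\<forall>v\<ge>U. \<exists>u. u 0 = v \<and> (\<forall>t\<in>{0..pi}. \<bar>u t - v\<bar> \<le> C) \<and> u pi = v \<and> recip_orbit lam A B u"
    using center_recip_orbits[OF lam center] unfolding A_def B_def by blast
  have Pc: "continuous_on {0..pi} P" "continuous_on {0..pi} P'" "continuous_on {0..pi} T"
    unfolding P_def P'_def T_def by (rule continuous_on_form)+
  obtain D where D: "D \<ge> 0" "\<And>t. t \<in> {0..pi} \<Longrightarrow> \<bar>P t\<bar> \<le> D" using bounded_on_interval[OF Pc(1)] by blast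
  show ?thesis
  proof (rule obstr_integral_zero[where U = U and C = "C + \<bar>lam\<bar> * D"])
    show "\<forall>v\<ge>U. \<exists>z. z 0 = v \<and> z pi = v \<and> (\<forall>t\<in>{0..pi}. \<bar>z t - v\<bar> \<le> C + \<bar>lam\<bar> * D \<and>
        (z has_real_derivative lam * P' t * (T t - 3 * P t) / (z t - ((lam + 3) * P t - T t))) (at t within {0..pi}))"
    proof (intro allI impI)
      fix v assume "v \<ge> U"
      then obtain u where u: "u 0 = v" "\<forall>t\<in>{0..pi}. \<bar>u t - v\<bar> \<le> C" "u pi = v" "recip_orbit lam A B u"
        using orbits by blast
      define z where "z t = u t + lam * P t" for t
      have "z 0 = v" "z pi = v" using u by (simp_all add: z_def P_def)
      moreover have "\<bar>z t - v\<bar> \<le> C + \<bar>lam\<bar> * D" if t: "t \<in> {0..pi}" for t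
      proof -
        have "\<bar>lam * P t\<bar> \<le> \<bar>lam\<bar> * D" unfolding abs_mult using D(2)[OF t] by (intro mult_left_mono) auto
        moreover have "\<bar>u t - v\<bar> \<le> C" using u(2) t by blast
        ultimately show ?thesis unfolding z_def by linarith
      qed
      moreover have "(z has_real_derivative lam * P' t * (T t - 3 * P t) / (z t - ((lam + 3) * P t - T t))) (at t within
          {0..pi})"
        if t: "t \<in> {0..pi}" for t
      proof -
        have ut: "u t + B t \<noteq> 0" "(u has_real_derivative - lam * A t * u t / (u t + B t)) (at t within {0..pi})"
          using u(4) t unfolding recip_orbit_def by blast+
        have "(z has_real_derivative - lam * A t * u t / (u t + B t) + lam * P' t) (at t within {0..pi})"
          unfolding z_def P_def P'_def by (intro DERIV_add ut(2) DERIV_cmult has_derivative_cubic)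
        moreover have "- lam * A t * u t / (u t + B t) + lam * P' t = lam * P' t * B t / (u t + B t)"
          using ut(1) by (simp add: A field_simps)
        moreover have "z t - ((lam + 3) * P t - T t) = u t + B t" by (simp add: B z_def algebra_simps)
        ultimately show ?thesis by (simp only: B)
      qed
      ultimately show "\<exists>z. z 0 = v \<and> z pi = v \<and> (\<forall>t\<in>{0..pi}. \<bar>z t - v\<bar> \<le> C + \<bar>lam\<bar> * D \<and>
        (z has_real_derivative lam * P' t * (T t - 3 * P t) / (z t - ((lam + 3) * P t - T t))) (at t within {0..pi}))"
        by blast
    qed
  qed (auto intro!: continuous_intros Pc)
qed

text \<open>\<open>F_end\<close> says that the integral of P' T over [0, pi] vanishes; this integral
  is pi / 8 times the polynomial stated.\<close>

lemma center_first_condition: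
  fixes a b k m e :: real
  assumes lam: "lam \<noteq> 0"
    and center: "switching_center lam (upper_field lam 0 a (- b - 2 * k) (3 * e - m) b (m - 2 * a) k) (lower_field 0)"
  shows "b * (a + 3 * e) + k * m = 0"
proof -
  define P where "P = form [0, a, - k, e]"
  define P' where "P' = form [a, - 2 * k, 3 * e - 2 * a, k]"
  define T where "T = form [b, m]"
  define L where "L = coeffs_mult [a, - 2 * k, 3 * e - 2 * a, k] [b, m]"
  have PT: "P' t * T t = form L t" for t
    unfolding P'_def T_def L_def by (rule form_mult[symmetric]) simp
  define F where "F t = integral {0..t} (\<lambda>t. P' t * T t)" for t
  have facts: "(P has_real_derivative P' t) (at t within S)" "(T has_real_derivative form [m, - b] t) (at t within S)"
      "P 0 = 0" "P pi = 0" "continuous_on S P'" "continuous_on S (form [m, - b])" for t S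
    unfolding P_def P'_def T_def
    by (rule has_derivative_cubic has_derivative_line continuous_on_form | simp)+
  have "F pi = 0"
  proof (rule F_end[where P = P and P' = P' and T = T and T' = "form [m, - b]" and lam = lam and n = "lam + 3"
      and b = pi and F = F and E = "\<lambda>t. lam * P' t * (T t - 3 * P t)" and q = "\<lambda>t. (lam + 3) * P t - T t"])
    show "(F has_real_derivative P' t * T t) (at t within {0..pi})" if "t \<in> {0..pi}" for t
      unfolding F_def PT by (rule integral_has_real_derivative[OF continuous_on_form that])
  qed (use facts center_obstr[OF lam center, folded P_def P'_def T_def] lam in \<open>auto simp: F_def\<close>)
  moreover have "F pi = form_integral 0 L"
    unfolding F_def PT using has_integral_form by (rule integral_unique)
  ultimately have "(b * (a + 3 * e) + k * m) * (pi / 8) = 0"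
    by (simp add: L_def moment_simps field_simps) algebra?
  then show ?thesis by simp
qed

text \<open>The homogenizing scale \<open>s\<close> serves to evaluate at rational \<open>a\<close> and \<open>k\<close> without denominators.\<close>

definition obstr_poly_4 :: "real \<Rightarrow> real \<Rightarrow> real \<Rightarrow> real \<Rightarrow> real \<Rightarrow> real" where
  "obstr_poly_4 lam s a k m = (let n = lam + 3 in
     4 * (s ^ 4 * cubic_moment_130 a k m)
     + - 9 / 2 * (n + 1) * (s ^ 3 * cubic_moment_220 a k m)
     + (2 * n ^ 2 + 6 * n) * (s ^ 2 * cubic_moment_310 a k m)
     + - 1 / 4 * (n ^ 3 + 9 * n ^ 2) * (s ^ 1 * cubic_moment_400 a k m)
     + - 1 / 3 * lam * n * (s ^ 2 * cubic_moment_310 a k m)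
     + 1 / 2 * lam * (n + 3) * (s ^ 2 * cubic_moment_201 a k m)
     + - 1 / 8 * lam * (n + 9) * (s ^ 1 * cubic_moment_400 a k m)
     + - 1 / 2 * lam * (s ^ 3 * cubic_moment_002 a k m))"

definition obstr_poly_5 :: "real \<Rightarrow> real \<Rightarrow> real \<Rightarrow> real \<Rightarrow> real \<Rightarrow> real" where
  "obstr_poly_5 lam s a k m = (let n = lam + 3 in
     - 5 * (s ^ 5 * cubic_moment_140 a k m)
     + (8 * n + 6) * (s ^ 4 * cubic_moment_230 a k m)
     + (- 6 * n ^ 2 - 12 * n + 2 * lam * n) * (s ^ 3 * cubic_moment_320 a k m)
     + (2 * n ^ 3 + 9 * n ^ 2 + lam * (- 1 / 3 * n ^ 2 + n + 9 / 2)) * (s ^ 2 * cubic_moment_410 a k m)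
     + (- 1 / 5 * (n ^ 4 + 12 * n ^ 3) - lam * (3 / 10 * n ^ 2 + 18 / 5 * n)) * (s ^ 1 * cubic_moment_500 a k m)
     + lam * (2 / 3 * n ^ 2 + 4 * n) * (s ^ 2 * cubic_moment_301 a k m)
     + lam * (- 4 * n - 6) * (s ^ 3 * cubic_moment_211 a k m)
     + 2 * lam * (s ^ 4 * cubic_moment_012 a k m))"

text \<open>The obstructions of the system with \<open>b20\<close> scaled to 1.\<close>

definition obstr_free :: "real \<Rightarrow> real \<Rightarrow> real \<Rightarrow> real \<Rightarrow> bool" where
  "obstr_free lam a k m \<longleftrightarrow> (\<forall>n. integral {0..pi} (obstr
     (\<lambda>t. lam * form [a, - 2 * k, 3 * (- (a + k * m) / 3) - 2 * a, k] t * (form [1, m] t - 3 * form [0, a,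
         - k, - (a + k * m) / 3] t))
     (\<lambda>t. (lam + 3) * form [0, a, - k, - (a + k * m) / 3] t - form [1, m] t) n) = 0)"

text \<open>All parameters carry a factor \<open>b\<close>, so E carries b^2 and q carries
  \<open>b\<close>. By \<open>obstr_scale\<close> the obstruction of index n carries b^(n+1), which
  can be cancelled. The first condition determines \<open>e\<close>.\<close>

lemma center_obstr_free:
  fixes a b k m e :: real
  assumes lam: "lam \<noteq> 0" and b: "b \<noteq> 0"
    and center: "switching_center lam (upper_field lam 0 (b * a) (- b - 2 * (b * k)) (3 * (b * e) - b * m) b (b * m
        - 2 * (b * a)) (b * k)) (lower_field 0)"
  shows "e = - (a + k * m) / 3" and "obstr_free lam a k m"
proof -
  have "b * (b * a + 3 * (b * e)) + b * k * (b * m) = 0"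
    by (rule center_first_condition[OF lam center])
  then have "b * b * (a + 3 * e + k * m) = 0" by algebra
  then show e: "e = - (a + k * m) / 3" using b by simp
  define P where "P = form [0, a, - k, e]"
  define P' where "P' = form [a, - 2 * k, 3 * e - 2 * a, k]"
  define T where "T = form [1, m]"
  have s: "form [0, b * a, - (b * k), b * e] t = b * P t" "form [b, b * m] t = b * T t"
    "form [b * a, - 2 * (b * k), 3 * (b * e) - 2 * (b * a), b * k] t = b * P' t" for t
    unfolding P_def P'_def T_def by (simp_all add: algebra_simps)
  have E: "(\<lambda>t. lam * (b * P' t) * (b * T t - 3 * (b * P t))) = (\<lambda>t. b\<^sup>2 * (lam * P' t * (T t - 3 * P t)))"
    "(\<lambda>t. (lam + 3) * (b * P t) - b * T t) = (\<lambda>t. b * ((lam + 3) * P t - T t))"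
    by (simp_all add: fun_eq_iff algebra_simps power2_eq_square)
  have "b ^ Suc n * integral {0..pi} (obstr (\<lambda>t. lam * P' t * (T t - 3 * P t)) (\<lambda>t. (lam + 3) * P t - T t) n) = 0" for n
    using center_obstr[OF lam center, of n] unfolding s E by (simp add: obstr_scale[abs_def])
  then have "integral {0..pi} (obstr (\<lambda>t. lam * P' t * (T t - 3 * P t)) (\<lambda>t. (lam + 3) * P t - T t) n) = 0" for n
    using b by simp
  then show "obstr_free lam a k m"
    unfolding obstr_free_def P_def P'_def T_def e by blast
qed

lemma has_derivative_quartic:
  fixes a k m t :: real
  shows "(form (quartic_coeffs a k m) has_real_derivative
     form [a, - 2 * k, 3 * (- (a + k * m) / 3) - 2 * a, k] t * form [1, m] t) (at t within S)"
proof -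
  have f: "form (quartic_coeffs a k m) = (\<lambda>t. sin t * (a * (cos t * cos t * cos t) + sin t * ((1 / 2 * a * m
      - k) * (cos t * cos t)
      + sin t * (- (k * m) * cos t + sin t * (- 1 / 2 * a * m - 1 / 4 * k * m\<^sup>2 - 1 / 4 * k)))))"
    by (simp add: fun_eq_iff power2_eq_square power3_eq_cube)
  have "3 * (- (a + k * m) / 3) = - (a + k * m)" by simp
  then have g: "form [a, - 2 * k, 3 * (- (a + k * m) / 3) - 2 * a, k] t * form [1, m] t =
      (a * (cos t * cos t * cos t) + sin t * (- 2 * k * (cos t * cos t) + sin t * ((- (a + k * m) - 2 * a) * cos t
          + sin t * k)))
      * (cos t + sin t * m)"
    by (simp only: form.simps list.size) (simp add: power2_eq_square power3_eq_cube)
  show ?thesis unfolding f g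
    by (rule derivative_eq_intros refl)+ algebra
qed

lemma has_integral_zero_transfer:
  fixes f g :: "real \<Rightarrow> real"
  assumes "(f has_integral I) S" "(g has_integral 0) S" "\<And>t. g t = f t"
  shows "I = 0"
  using has_integral_unique[OF assms(1,2)[unfolded assms(3)[abs_def]]] .

text \<open>The weights are expanded into cubic moments. The third equation factors because
  \<open>cubic_moment_210\<close> and \<open>cubic_moment_300\<close> are - k / 2 and 3 k^2 / 16
  times \<open>cubic_moment_120\<close>, which is itself a multiple of a (1 - 3 m^2) - 2 k m; the
  cofactor is a quadratic in k that splits as (n k + 4) ((n + 6) k + 12) with n = lam + 3. The last
  two equations are the obstructions times s^5 and s^6.\<close>

lemma obstr_free_equations:
  assumes lam: "lam \<noteq> 0" and free: "obstr_free lam a k m"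
  shows "(lam + 6) * (3 * a\<^sup>2 + 6 * a * k * m + 4 * k\<^sup>2) + 14 * (3 * a * m + 2 * k) = 0"
    and "(a * (1 - 3 * m\<^sup>2) - 2 * k * m) * (lam * k + 3 * k + 4) * (lam * k + 9 * k + 12) = 0"
    and "obstr_poly_4 lam s (s * a) (s * k) m = 0"
    and "obstr_poly_5 lam s (s * a) (s * k) m = 0"
proof -
  define P where "P = form [0, a, - k, - (a + k * m) / 3]"
  define P' where "P' = form [a, - 2 * k, 3 * (- (a + k * m) / 3) - 2 * a, k]"
  define T where "T = form [1, m]"
  define D where "D = form [m, - 1]"
  define F where "F = form (quartic_coeffs a k m)"
  define n where "n = lam + 3"
  have "a = - (3 * (- (a + k * m) / 3) + k * m)" by (simp add: field_simps)
  note mi = cubic_moments[OF this, folded P_def T_def D_def F_def]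
  have dP: "(P has_real_derivative P' t) (at t within {0..pi})" for t
    unfolding P_def P'_def by (rule has_derivative_cubic)
  have dT: "(T has_real_derivative D t) (at t within {0..pi})" for t
    unfolding T_def D_def by (rule has_derivative_line)
  have dF: "(F has_real_derivative P' t * T t) (at t within {0..pi})" for t
    unfolding T_def P'_def F_def by (rule has_derivative_quartic)
  have c: "continuous_on {0..pi} P'" "continuous_on {0..pi} D"
    unfolding P'_def D_def by (rule continuous_on_form)+
  have ends: "P 0 = 0" "P pi = 0" "F 0 = 0" by (simp_all add: P_def F_def)
  have obs: "integral {0..pi} (obstr (\<lambda>t. lam * P' t * (T t - 3 * P t)) (\<lambda>t. n * P t - T t) j) = 0" for j
    using free unfolding obstr_free_def P_def T_def P'_def n_def by blast
  note wt = pi_ge_zero lam n_def dP dT dF c ends refl refl obs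
  have "((\<lambda>t. 2 * (P t * T t * D t) + (- 1 / 2 * (n + 3)) * (P t ^ 2 * D t)) has_integral
      2 * (cubic_moment_110 a k m) + (- 1 / 2 * (n + 3)) * (cubic_moment_200 a k m)) {0..pi}"
    by (intro has_integral_add has_integral_mult_right mi)
  from has_integral_zero_transfer[OF this weight_2[OF wt]]
  have "2 * (cubic_moment_110 a k m) + (- 1 / 2 * (n + 3)) * (cubic_moment_200 a k m) = 0"
    unfolding obstr_weight_2_def by algebra
  then show "(lam + 6) * (3 * a\<^sup>2 + 6 * a * k * m + 4 * k\<^sup>2) + 14 * (3 * a * m + 2 * k) = 0" unfolding n_def cubic_moment_defs
      by algebra
  have "((\<lambda>t. (- 3) * (P t * T t ^ 2 * D t) + (2 * n + 3) * (P t ^ 2 * T t * D t) + (- 1 / 3 * (n ^ 2 + 6 * n)) * (P t ^ 3 * D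
      t)) has_integral
      (- 3) * (cubic_moment_120 a k m * pi) + (2 * n + 3) * (cubic_moment_210 a k m * pi) + (- 1 / 3 * (n ^ 2
          + 6 * n)) * (cubic_moment_300 a k m * pi)) {0..pi}"
    by (intro has_integral_add has_integral_mult_right mi)
  from has_integral_zero_transfer[OF this weight_3[OF wt]]
  have "(- 3) * (cubic_moment_120 a k m * pi) + (2 * n + 3) * (cubic_moment_210 a k m * pi) + (- 1 / 3 * (n ^ 2
      + 6 * n)) * (cubic_moment_300 a k m * pi) = 0"
    unfolding obstr_weight_3_def by algebra
  then have "pi * ((a * (1 - 3 * m\<^sup>2) - 2 * k * m) * (lam * k + 3 * k + 4) * (lam * k + 9 * k + 12)) = 0" unfolding n_def
      cubic_moment_defs by algebra
  then show "(a * (1 - 3 * m\<^sup>2) - 2 * k * m) * (lam * k + 3 * k + 4) * (lam * k + 9 * k + 12) = 0" by simp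
  have "((\<lambda>t. 4 * (P t * T t ^ 3 * D t) + (- 9 / 2 * (n + 1)) * (P t ^ 2 * T t ^ 2 * D t) + (2 * n ^ 2 + 6 * n) * (P t ^ 3 * T t
      * D t) + (- 1 / 4 * (n ^ 3 + 9 * n ^ 2)) * (P t ^ 4 * D t) + (- 1 / 3 * lam * n) * (P t ^ 3 * T t * D t)
      + 1 / 2 * lam * (n + 3) * (P t ^ 2 * F t * D t) + (- 1 / 8 * lam * (n + 9)) * (P t ^ 4 * D t) + (- 1 / 2 * lam) * (F t ^ 2
      * D t)) has_integral
      4 * (cubic_moment_130 a k m) + (- 9 / 2 * (n + 1)) * (cubic_moment_220 a k m) + (2 * n ^ 2 + 6 * n) * (cubic_moment_310 a
          k m) + (- 1 / 4 * (n ^ 3 + 9 * n ^ 2)) * (cubic_moment_400 a k m) + (- 1 / 3 * lam * n) * (cubic_moment_310 a k m)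
          + 1 / 2 * lam * (n + 3) * (cubic_moment_201 a k m) + (- 1 / 8 * lam * (n + 9)) * (cubic_moment_400 a k m)
          + (- 1 / 2 * lam) * (cubic_moment_002 a k m)) {0..pi}"
    by (intro has_integral_add has_integral_mult_right mi)
  from has_integral_zero_transfer[OF this weight_4[OF wt]]
  have "4 * (cubic_moment_130 a k m) + (- 9 / 2 * (n + 1)) * (cubic_moment_220 a k m) + (2 * n ^ 2 + 6 * n) * (cubic_moment_310
      a k m) + (- 1 / 4 * (n ^ 3 + 9 * n ^ 2)) * (cubic_moment_400 a k m) + (- 1 / 3 * lam * n) * (cubic_moment_310 a k m)
      + 1 / 2 * lam * (n + 3) * (cubic_moment_201 a k m) + (- 1 / 8 * lam * (n + 9)) * (cubic_moment_400 a k m)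
      + (- 1 / 2 * lam) * (cubic_moment_002 a k m) = 0"
    unfolding obstr_weight_4_def by algebra
  then show "obstr_poly_4 lam s (s * a) (s * k) m = 0"
    unfolding obstr_poly_4_def Let_def n_def cubic_moment_defs by algebra
  have "((\<lambda>t. (- 5) * (P t * T t ^ 4 * D t) + (8 * n + 6) * (P t ^ 2 * T t ^ 3 * D t) + (- 6 * n ^ 2 - 12 * n
      + 2 * lam * n) * (P t ^ 3 * T t ^ 2 * D t) + (2 * n ^ 3 + 9 * n ^ 2 + lam * (- 1 / 3 * n ^ 2 + n + 9 / 2)) * (P t ^ 4 * T
      t * D t) + (- 1 / 5 * (n ^ 4 + 12 * n ^ 3) - lam * (3 / 10 * n ^ 2 + 18 / 5 * n)) * (P t ^ 5 * D t)
      + lam * (2 / 3 * n ^ 2 + 4 * n) * (P t ^ 3 * F t * D t) + lam * (- 4 * n - 6) * (P t ^ 2 * T t * F t * D t)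
      + 2 * lam * (T t * F t ^ 2 * D t)) has_integral
      (- 5) * (cubic_moment_140 a k m * pi) + (8 * n + 6) * (cubic_moment_230 a k m * pi) + (- 6 * n ^ 2 - 12 * n
          + 2 * lam * n) * (cubic_moment_320 a k m * pi) + (2 * n ^ 3 + 9 * n ^ 2 + lam * (- 1 / 3 * n ^ 2
          + n + 9 / 2)) * (cubic_moment_410 a k m * pi) + (- 1 / 5 * (n ^ 4 + 12 * n ^ 3) - lam * (3 / 10 * n ^ 2
          + 18 / 5 * n)) * (cubic_moment_500 a k m * pi) + lam * (2 / 3 * n ^ 2 + 4 * n) * (cubic_moment_301 a k m * pi)
          + lam * (- 4 * n - 6) * (cubic_moment_211 a k m * pi) + 2 * lam * (cubic_moment_012 a k m * pi)) {0..pi}"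
    by (intro has_integral_add has_integral_mult_right mi)
  from has_integral_zero_transfer[OF this weight_5[OF wt]]
  have "(- 5) * (cubic_moment_140 a k m * pi) + (8 * n + 6) * (cubic_moment_230 a k m * pi) + (- 6 * n ^ 2
      - 12 * n + 2 * lam * n) * (cubic_moment_320 a k m * pi) + (2 * n ^ 3 + 9 * n ^ 2 + lam * (- 1 / 3 * n ^ 2
      + n + 9 / 2)) * (cubic_moment_410 a k m * pi) + (- 1 / 5 * (n ^ 4 + 12 * n ^ 3) - lam * (3 / 10 * n ^ 2
      + 18 / 5 * n)) * (cubic_moment_500 a k m * pi) + lam * (2 / 3 * n ^ 2 + 4 * n) * (cubic_moment_301 a k m * pi)
      + lam * (- 4 * n - 6) * (cubic_moment_211 a k m * pi) + 2 * lam * (cubic_moment_012 a k m * pi) = 0"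
    unfolding obstr_weight_5_def by algebra
  then have "pi * obstr_poly_5 lam s (s * a) (s * k) m = 0"
    unfolding obstr_poly_5_def Let_def n_def cubic_moment_defs by algebra
  then show "obstr_poly_5 lam s (s * a) (s * k) m = 0" by simp
qed

section \<open>Common zeros of the obstructions\<close>

text \<open>The certificates in the next seven lemmas are Bernstein expansions on the respective interval.\<close>

lemma sign_q_right:
  fixes lam :: real
  assumes "0 < lam" "lam < 14"
  shows "- 223 * lam ^ 4 - 8120 * lam ^ 3 + 127950 * lam ^ 2 + 778680 * lam + 741393 > 0"
proof -
  have "0 < 741393 * (14 - lam) ^ 4 + 13867092 * (lam - (0)) ^ 1 * (14 - lam) ^ 3 + 62231118 * (lam - (0)) ^ 2 * (14
      - lam) ^ 2 + 63545252 * (lam - (0)) ^ 3 * (14 - lam) ^ 1 + 5873065 * (lam - (0)) ^ 4"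
    using assms by (intro add_pos_pos mult_pos_pos zero_less_power) simp_all
  also have "\<dots> = 38416 * (- 223 * lam ^ 4 - 8120 * lam ^ 3 + 127950 * lam ^ 2 + 778680 * lam + 741393)"
    by algebra
  finally show ?thesis by simp
qed

lemma sign_p_right1:
  fixes lam :: real
  assumes "0 < lam" "lam < 7"
  shows "1285 * lam ^ 4 - 6580 * lam ^ 3 - 48642 * lam ^ 2 + 434052 * lam + 1764909 > 0"
proof -
  have "0 < 1764909 * (7 - lam) ^ 4 + 10098000 * (lam - (0)) ^ 1 * (7 - lam) ^ 3 + 17321088 * (lam - (0)) ^ 2 * (7
      - lam) ^ 2 + 9150872 * (lam - (0)) ^ 3 * (7 - lam) ^ 1 + 3248160 * (lam - (0)) ^ 4"
    using assms by (intro add_pos_pos mult_pos_pos zero_less_power) simp_all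
  also have "\<dots> = 2401 * (1285 * lam ^ 4 - 6580 * lam ^ 3 - 48642 * lam ^ 2 + 434052 * lam + 1764909)"
    by algebra
  finally show ?thesis by simp
qed

lemma sign_p_right2:
  fixes lam :: real
  assumes "6 < lam" "lam < 14"
  shows "1285 * lam ^ 4 - 6580 * lam ^ 3 - 48642 * lam ^ 2 + 434052 * lam + 1764909 > 0"
proof -
  have "0 < 2862189 * (14 - lam) ^ 4 + 13448340 * (lam - (6)) ^ 1 * (14 - lam) ^ 3 + 30242478 * (lam - (6)) ^ 2 * (14
      - lam) ^ 2 + 44009812 * (lam - (6)) ^ 3 * (14 - lam) ^ 1 + 29616845 * (lam - (6)) ^ 4"
    using assms by (intro add_pos_pos mult_pos_pos zero_less_power) simp_all
  also have "\<dots> = 4096 * (1285 * lam ^ 4 - 6580 * lam ^ 3 - 48642 * lam ^ 2 + 434052 * lam + 1764909)"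
    by algebra
  finally show ?thesis by simp
qed

lemma sign_q_left:
  fixes lam :: real
  assumes "- 93 / 25 < lam" "lam < -9 / 5"
  shows "- 223 * lam ^ 4 - 8120 * lam ^ 3 + 127950 * lam ^ 2 + 778680 * lam + 741393 < 0"
proof -
  have "0 < 3660104448 * (-9 / 5 - lam) ^ 4 + 362979636480 * (lam - (-93 / 25)) ^ 1 * (-9 / 5 - lam) ^ 3 + 778901356800 * (lam
      - (-93 / 25)) ^ 2 * (-9 / 5 - lam) ^ 2 + 496780128000 * (lam - (-93 / 25)) ^ 3 * (-9 / 5 - lam) ^ 1
      + 78382080000 * (lam - (-93 / 25)) ^ 4"
    using assms by (intro add_pos_pos mult_pos_pos zero_less_power) simp_all
  also have "\<dots> = - 5308416 * (- 223 * lam ^ 4 - 8120 * lam ^ 3 + 127950 * lam ^ 2 + 778680 * lam + 741393)"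
    by algebra
  finally show ?thesis by simp
qed

lemma sign_r_left:
  fixes lam :: real
  assumes "- 93 / 25 < lam" "lam < -9 / 5"
  shows "- 6419 * lam ^ 6 - 31564 * lam ^ 5 + 1363197 * lam ^ 4 + 4806072 * lam ^ 3 - 20436705 * lam ^ 2 - 88888428 * lam
      - 81310473 < 0"
proof -
  have "0 < 3500719220883456 * (-9 / 5 - lam) ^ 6 + 30755952639959040 * (lam - (-93 / 25)) ^ 1 * (-9 / 5 - lam) ^ 5
      + 68037012025344000 * (lam - (-93 / 25)) ^ 2 * (-9 / 5 - lam) ^ 4 + 57477128878080000 * (lam - (-93 / 25)) ^ 3 * (-9 / 5
      - lam) ^ 3 + 17208151142400000 * (lam - (-93 / 25)) ^ 4 * (-9 / 5 - lam) ^ 2 + 645924326400000 * (lam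
      - (-93 / 25)) ^ 5 * (-9 / 5 - lam) ^ 1 + 211631616000000 * (lam - (-93 / 25)) ^ 6"
    using assms by (intro add_pos_pos mult_pos_pos zero_less_power) simp_all
  also have "\<dots> = - 12230590464 * (- 6419 * lam ^ 6 - 31564 * lam ^ 5 + 1363197 * lam ^ 4 + 4806072 * lam ^ 3
      - 20436705 * lam ^ 2 - 88888428 * lam - 81310473)"
    by algebra
  finally show ?thesis by simp
qed

lemma sign_c_mid:
  fixes lam :: real
  assumes "- 9 / 5 < lam" "lam < 0"
  shows "23 * lam ^ 2 - 30 * lam - 153 < 0"
proof -
  have "0 < 612 * (0 - lam) ^ 2 + 6300 * (lam - (-9 / 5)) ^ 1 * (0 - lam) ^ 1 + 3825 * (lam - (-9 / 5)) ^ 2"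
    using assms by (intro add_pos_pos mult_pos_pos zero_less_power) simp_all
  also have "\<dots> = - 81 * (23 * lam ^ 2 - 30 * lam - 153)"
    by algebra
  finally show ?thesis by simp
qed

lemma sign_p_mid:
  fixes lam :: real
  assumes "- 9 / 5 < lam" "lam < 0"
  shows "339 * lam ^ 3 + 593 * lam ^ 2 - 6459 * lam - 12393 < 0"
proof -
  have "0 < 102816 * (0 - lam) ^ 3 + 1500660 * (lam - (-9 / 5)) ^ 1 * (0 - lam) ^ 2 + 3194100 * (lam - (-9 / 5)) ^ 2 * (0
      - lam) ^ 1 + 1549125 * (lam - (-9 / 5)) ^ 3"
    using assms by (intro add_pos_pos mult_pos_pos zero_less_power) simp_all
  also have "\<dots> = - 729 * (339 * lam ^ 3 + 593 * lam ^ 2 - 6459 * lam - 12393)"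
    by algebra
  finally show ?thesis by simp
qed


text \<open>The parameter \<open>m\<close> drops out because P is here a polynomial in x = cos + m
  sin (see \<open>aligned_forms\<close>), so the obstruction is an integral over x from 1 to
  -1.\<close>

lemma obstr_poly_4_aligned:
  "obstr_poly_4 lam (lam + 6) (- 14 * m) (- 7 * (1 - 3 * m\<^sup>2)) m
    = - 128 / 715 * (lam - 1) * (lam + 6) * (2 * lam - 9) * (5 * lam + 16)"
  unfolding obstr_poly_4_def Let_def cubic_moment_defs by algebra

text \<open>Here k = - 4 / (lam + 3) and w = (lam + 3) a. The factor linear in \<open>w\<close> is -
  (lam + 3) (a (1 - 3 m^2) - 2 k m), so its vanishing leads back to the aligned case, while 9 + (w -
  m)^2 never vanishes. The next lemma is the analogue for k = - 12 / (lam + 9) and 3 v = (lam + 9)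
  a; its last factor has no definite sign.\<close>

lemma obstr_poly_5_branch_1:
  "obstr_poly_5 lam (lam + 3) w (- 4) m
    = - 1 / 192 * lam\<^sup>2 * (lam - 1) * (lam + 3)\<^sup>2 * (3 * w * m\<^sup>2 - w - 8 * m) * (9 + (w - m)\<^sup>2)"
  unfolding obstr_poly_5_def Let_def cubic_moment_defs by algebra

lemma obstr_poly_5_branch_2:
  "obstr_poly_5 lam (lam + 9) (3 * v) (- 12) m
    = 3 / 64 * lam\<^sup>2 * (lam + 9) * (3 * v * m\<^sup>2 - v - 8 * m)
      * (20 * lam\<^sup>2 * (1 + m\<^sup>2) - 3 * (51 + 10 * lam - lam\<^sup>2) * (9 + (v - m)\<^sup>2))"
  unfolding obstr_poly_5_def Let_def cubic_moment_defs by algebra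

definition branch_2_quartic :: "real \<Rightarrow> real \<Rightarrow> real \<Rightarrow> real" where
  "branch_2_quartic lam v m = (486 * lam^3 + 8991 * lam^2 + 42282 * lam + 52488) * v^4
    + (- 2511 * lam^3 - 50139 * lam^2 - 183708 * lam - 157464) * v^3 * m
    + (2706 * lam^3 + 62580 * lam^2 + 240570 * lam + 157464) * v^2 * m^2
    + (7270 * lam^3 + 162848 * lam^2 + 692550 * lam + 918540) * v^2
    + (8328 * lam^3 - 21432 * lam^2 - 99144 * lam - 52488) * v * m^3
    + (- 16652 * lam^3 - 420772 * lam^2 - 1620324 * lam - 1058508) * v * m
    + (- 22208 * lam^3 + 57152 * lam^2 + 264384 * lam + 139968) * m^2
    + (17760 * lam^3 + 696096 * lam^2 + 2698272 * lam + 1749600)"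

lemma obstr_poly_4_branch_2:
  "obstr_poly_4 lam (lam + 9) (3 * v) (- 12) m = 2 / 5005 * (lam + 9) * branch_2_quartic lam v m"
  unfolding branch_2_quartic_def obstr_poly_4_def Let_def cubic_moment_defs by algebra

text \<open>The second obstruction \<open>rel\<close> expresses v m through v^2. Both other
  conditions can be written in V = v^2 and v m alone, so eliminating v m leaves two quadratic
  equations for V with coefficients in \<open>lam\<close>.\<close>

lemma branch_2_eliminate:
  fixes lam v m :: real
  defines "D \<equiv> 5 * lam + 9"
  assumes rel: "6 * D * (v * m) = 9 * (lam + 6) * v\<^sup>2 + 16 * D"
    and c4: "branch_2_quartic lam v m = 0"
    and c5: "20 * lam\<^sup>2 * (1 + m\<^sup>2) - 3 * (51 + 10 * lam - lam\<^sup>2) * (9 + (v - m)\<^sup>2) = 0"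
    and v: "v \<noteq> 0"
  shows "81 * lam ^ 3 * (lam - 1) * (7 * lam + 51) * (19 * lam + 51) * (v\<^sup>2)\<^sup>2
      + 12 * lam * D * (3487 * lam ^ 4 + 33566 * lam ^ 3 - 26496 * lam ^ 2 - 697086 * lam - 1043199) * v\<^sup>2
      + 64 * D\<^sup>2 * (lam + 9) * (347 * lam ^ 3 - 893 * lam ^ 2 - 4131 * lam - 2187) = 0" (is ?th4)
    and "27 * lam\<^sup>2 * (lam - 1) * (109 * lam + 339) * (v\<^sup>2)\<^sup>2
      + 36 * D * (339 * lam ^ 3 + 593 * lam ^ 2 - 6459 * lam - 12393) * v\<^sup>2 + 256 * D\<^sup>2 * (23 * lam ^ 2 - 30 * lam
          - 153) = 0" (is ?th5)
proof -
  define V where "V = v\<^sup>2"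
  define W where "W = 6 * D * (v * m)"
  have W: "W = 9 * (lam + 6) * V + 16 * D" using rel by (simp add: W_def V_def)
  \<comment> \<open>Multiplying by v^2 supplies a factor \<open>v\<close> for every
    \<open>m\<close>, and (6 D)^3 clears the denominators of v m.\<close>
  have "(486 * lam^3 + 8991 * lam^2 + 42282 * lam + 52488) * (6 * D)^3 * V^3
      + (- 2511 * lam^3 - 50139 * lam^2 - 183708 * lam - 157464) * (6 * D)^2 * W * V^2
      + (2706 * lam^3 + 62580 * lam^2 + 240570 * lam + 157464) * (6 * D) * W^2 * V
      + (7270 * lam^3 + 162848 * lam^2 + 692550 * lam + 918540) * (6 * D)^3 * V^2
      + (8328 * lam^3 - 21432 * lam^2 - 99144 * lam - 52488) * W^3
      + (- 16652 * lam^3 - 420772 * lam^2 - 1620324 * lam - 1058508) * (6 * D)^2 * W * V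
      + (- 22208 * lam^3 + 57152 * lam^2 + 264384 * lam + 139968) * (6 * D) * W^2
      + (17760 * lam^3 + 696096 * lam^2 + 2698272 * lam + 1749600) * (6 * D)^3 * V
      = (6 * D)^3 * v\<^sup>2 * branch_2_quartic lam v m"
    unfolding V_def W_def branch_2_quartic_def by algebra
  also have "\<dots> = 0" using c4 by simp
  finally have "504 * V * (81 * lam ^ 3 * (lam - 1) * (7 * lam + 51) * (19 * lam + 51) * V\<^sup>2
      + 12 * lam * D * (3487 * lam ^ 4 + 33566 * lam ^ 3 - 26496 * lam ^ 2 - 697086 * lam - 1043199) * V
      + 64 * D\<^sup>2 * (lam + 9) * (347 * lam ^ 3 - 893 * lam ^ 2 - 4131 * lam - 2187)) = 0"
    unfolding W D_def by algebra
  then show ?th4 using v by (simp add: V_def)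
  have "20 * lam\<^sup>2 * (36 * D\<^sup>2 * V + W\<^sup>2) - 3 * (51 + 10 * lam - lam\<^sup>2) * (324 * D\<^sup>2 * V + (6 * D * V - W)\<^sup>2)
      = 36 * D\<^sup>2 * v\<^sup>2 * (20 * lam\<^sup>2 * (1 + m\<^sup>2) - 3 * (51 + 10 * lam - lam\<^sup>2) * (9 + (v - m)\<^sup>2))"
    unfolding V_def W_def by algebra
  also have "\<dots> = 0" using c5 by simp
  finally have "27 * lam\<^sup>2 * (lam - 1) * (109 * lam + 339) * V\<^sup>2
      + 36 * D * (339 * lam ^ 3 + 593 * lam ^ 2 - 6459 * lam - 12393) * V + 256 * D\<^sup>2 * (23 * lam ^ 2 - 30 * lam - 153) = 0"
    unfolding W D_def by algebra
  then show ?th5 by (simp only: V_def)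
qed

text \<open>Condition \<open>c5\<close> confines \<open>lam\<close> to a bounded interval, since its
  first term is positive. There the two quadratics in v^2 and two combinations of them linear in v^2
  contradict v^2 > 0 by the signs of their coefficients.\<close>

lemma branch_2_impossible:
  fixes lam v m :: real
  assumes lam: "lam \<noteq> 0"
    and rel: "6 * (5 * lam + 9) * (v * m) = 9 * (lam + 6) * v\<^sup>2 + 16 * (5 * lam + 9)"
    and c4: "branch_2_quartic lam v m = 0"
    and c5: "20 * lam\<^sup>2 * (1 + m\<^sup>2) - 3 * (51 + 10 * lam - lam\<^sup>2) * (9 + (v - m)\<^sup>2) = 0"
  shows False
proof -
  define D where "D = 5 * lam + 9"
  have "0 < 20 * lam\<^sup>2 * (1 + m\<^sup>2)" using lam by (simp add: add_pos_nonneg)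
  then have "0 < 3 * (51 + 10 * lam - lam\<^sup>2) * (9 + (v - m)\<^sup>2)" using c5 by linarith
  then have "0 < 51 + 10 * lam - lam\<^sup>2"
    by (smt (verit) mult_nonpos_nonneg zero_le_power2)
  \<comment> \<open>The inequality reads (lam - 5)^2 < 76, and 76 < 8.72^2 = 76.0384.\<close>
  then have "(lam - 5)\<^sup>2 < (872 / 100)\<^sup>2" by (simp add: power2_eq_square algebra_simps)
  then have "\<bar>lam - 5\<bar> < 872 / 100" using power2_less_imp_less[of "\<bar>lam - 5\<bar>" "872 / 100"] by simp
  then have range: "- 93 / 25 < lam" "lam < 14" by linarith+
  show False
  proof (cases "D = 0")
    case True
    then have l: "lam = - 9 / 5" by (simp add: D_def)
    then have "v = 0" using rel by simp
    then have "3060 * m\<^sup>2 + 92340 = 0" using c5 unfolding l by (simp add: power2_eq_square)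
    then show False using zero_le_power2[of m] by linarith
  next
    case False
    then have "v \<noteq> 0" using rel by (auto simp: D_def)
    then have V: "v\<^sup>2 > 0" by simp
    note q = branch_2_eliminate[OF rel c4 c5 \<open>v \<noteq> 0\<close>, folded D_def]
    \<comment> \<open>The combination of the two quadratics in which the terms with the square of
      v^2 cancel.\<close>
    have lin: "3 * lam * (1285 * lam ^ 4 - 6580 * lam ^ 3 - 48642 * lam ^ 2 + 434052 * lam + 1764909) * v\<^sup>2
        + 4 * D * (- 223 * lam ^ 4 - 8120 * lam ^ 3 + 127950 * lam ^ 2 + 778680 * lam + 741393) = 0"
    proof -
      have "432 * D\<^sup>2 * (3 * lam * (1285 * lam ^ 4 - 6580 * lam ^ 3 - 48642 * lam ^ 2 + 434052 * lam + 1764909) * v\<^sup>2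
          + 4 * D * (- 223 * lam ^ 4 - 8120 * lam ^ 3 + 127950 * lam ^ 2 + 778680 * lam + 741393))
        = 81 * lam * (7 * lam + 51) * (19 * lam + 51) * (27 * lam\<^sup>2 * (lam - 1) * (109 * lam + 339) * (v\<^sup>2)\<^sup>2
      + 36 * D * (339 * lam ^ 3 + 593 * lam ^ 2 - 6459 * lam - 12393) * v\<^sup>2 + 256 * D\<^sup>2 * (23 * lam ^ 2 - 30 * lam - 153))
          - 27 * (109 * lam + 339) * (81 * lam ^ 3 * (lam - 1) * (7 * lam + 51) * (19 * lam + 51) * (v\<^sup>2)\<^sup>2
      + 12 * lam * D * (3487 * lam ^ 4 + 33566 * lam ^ 3 - 26496 * lam ^ 2 - 697086 * lam - 1043199) * v\<^sup>2
          + 64 * D\<^sup>2 * (lam + 9) * (347 * lam ^ 3 - 893 * lam ^ 2 - 4131 * lam - 2187))"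
        unfolding D_def by algebra
      then show ?thesis using False unfolding q by simp
    qed
    \<comment> \<open>The combination in which the constant terms cancel, divided by v^2.\<close>
    have con: "9 * lam\<^sup>2 * (lam - 1) * (- 223 * lam ^ 4 - 8120 * lam ^ 3 + 127950 * lam ^ 2 + 778680 * lam
        + 741393) * v\<^sup>2 + 4 * D * (- 6419 * lam ^ 6 - 31564 * lam ^ 5 + 1363197 * lam ^ 4 + 4806072 * lam ^ 3
        - 20436705 * lam ^ 2 - 88888428 * lam - 81310473) = 0"
    proof -
      have "192 * D * v\<^sup>2 * (9 * lam\<^sup>2 * (lam - 1) * (- 223 * lam ^ 4 - 8120 * lam ^ 3 + 127950 * lam ^ 2
          + 778680 * lam + 741393) * v\<^sup>2 + 4 * D * (- 6419 * lam ^ 6 - 31564 * lam ^ 5 + 1363197 * lam ^ 4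
          + 4806072 * lam ^ 3 - 20436705 * lam ^ 2 - 88888428 * lam - 81310473))
        = 256 * (23 * lam ^ 2 - 30 * lam - 153) * (81 * lam ^ 3 * (lam - 1) * (7 * lam + 51) * (19 * lam + 51) * (v\<^sup>2)\<^sup>2
      + 12 * lam * D * (3487 * lam ^ 4 + 33566 * lam ^ 3 - 26496 * lam ^ 2 - 697086 * lam - 1043199) * v\<^sup>2
          + 64 * D\<^sup>2 * (lam + 9) * (347 * lam ^ 3 - 893 * lam ^ 2 - 4131 * lam - 2187))
          - 64 * (lam + 9) * (347 * lam ^ 3 - 893 * lam ^ 2 - 4131 * lam - 2187) * (27 * lam\<^sup>2 * (lam - 1) * (109 * lam
              + 339) * (v\<^sup>2)\<^sup>2
      + 36 * D * (339 * lam ^ 3 + 593 * lam ^ 2 - 6459 * lam - 12393) * v\<^sup>2 + 256 * D\<^sup>2 * (23 * lam ^ 2 - 30 * lam - 153))"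
        unfolding D_def by algebra
      then show ?thesis using False \<open>v \<noteq> 0\<close> unfolding q by simp
    qed
    \<comment> \<open>To the left of - 9 / 5 the equation \<open>con\<close> has two positive
      summands, in the middle range all three terms of the second quadratic are negative, and for
      positive \<open>lam\<close> both terms of \<open>lin\<close> are positive.\<close>
    consider "lam < - 9 / 5" | "- 9 / 5 < lam" "lam < 0" | "lam > 0"
      using False lam by (auto simp: D_def) linarith
    then show False
    proof cases
      case 1
      then have "D < 0" by (simp add: D_def)
      then have "0 < D * (- 6419 * lam ^ 6 - 31564 * lam ^ 5 + 1363197 * lam ^ 4 + 4806072 * lam ^ 3 - 20436705 * lam ^ 2
          - 88888428 * lam - 81310473)" using sign_r_left[OF range(1) 1] by (rule mult_neg_neg)
      moreover have "0 < (lam - 1) * (- 223 * lam ^ 4 - 8120 * lam ^ 3 + 127950 * lam ^ 2 + 778680 * lam + 741393)" using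
          sign_q_left[OF range(1) 1] 1 by (intro mult_neg_neg) auto
      then have "0 < lam\<^sup>2 * v\<^sup>2 * ((lam - 1) * (- 223 * lam ^ 4 - 8120 * lam ^ 3 + 127950 * lam ^ 2 + 778680 * lam
          + 741393))" using lam V by simp
      moreover have "9 * (lam\<^sup>2 * v\<^sup>2 * ((lam - 1) * (- 223 * lam ^ 4 - 8120 * lam ^ 3 + 127950 * lam ^ 2
          + 778680 * lam + 741393))) + 4 * (D * (- 6419 * lam ^ 6 - 31564 * lam ^ 5 + 1363197 * lam ^ 4 + 4806072 * lam ^ 3
          - 20436705 * lam ^ 2 - 88888428 * lam - 81310473)) = 0"
        using con by algebra
      ultimately show False by linarith
    next
      case 2
      then have D: "D > 0" by (simp add: D_def)
      have "27 * lam\<^sup>2 * (lam - 1) * (109 * lam + 339) * (v\<^sup>2)\<^sup>2 < 0"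
        using 2 V by (intro mult_neg_pos mult_pos_neg mult_pos_pos) auto
      moreover have "36 * D * (339 * lam ^ 3 + 593 * lam ^ 2 - 6459 * lam - 12393) * v\<^sup>2 < 0"
        using D V sign_p_mid[of lam] 2 by (intro mult_neg_pos mult_pos_neg) auto
      moreover have "256 * D\<^sup>2 * (23 * lam ^ 2 - 30 * lam - 153) < 0"
        using D sign_c_mid[of lam] 2 by (intro mult_pos_neg) auto
      ultimately show False using q(2) by linarith
    next
      case 3
      then have D: "D > 0" by (simp add: D_def)
      have "1285 * lam ^ 4 - 6580 * lam ^ 3 - 48642 * lam ^ 2 + 434052 * lam + 1764909 > 0"
        using sign_p_right1[of lam] sign_p_right2[of lam] 3 range(2) by linarith
      then have "3 * lam * (1285 * lam ^ 4 - 6580 * lam ^ 3 - 48642 * lam ^ 2 + 434052 * lam + 1764909) * v\<^sup>2 > 0" using 3 V by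
          simp
      moreover have "4 * D * (- 223 * lam ^ 4 - 8120 * lam ^ 3 + 127950 * lam ^ 2 + 778680 * lam + 741393) > 0" using D
          sign_q_right[of lam] 3 range(2) by simp
      ultimately show False using lin by linarith
    qed
  qed
qed

text \<open>The first two alternatives are the normalized conditions (iii) and (iv). The third
  contains (v) and (vi), together with the value - 16 / 5, which these equations cannot
  exclude.\<close>

theorem obstr_equations_solutions:
  fixes lam a k m :: real
  assumes lam: "lam \<noteq> 0"
    and l2: "(lam + 6) * (3 * a\<^sup>2 + 6 * a * k * m + 4 * k\<^sup>2) + 14 * (3 * a * m + 2 * k) = 0"
    and l3: "(a * (1 - 3 * m\<^sup>2) - 2 * k * m) * (lam * k + 3 * k + 4) * (lam * k + 9 * k + 12) = 0"
    and l4: "\<And>s. obstr_poly_4 lam s (s * a) (s * k) m = 0"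
    and l5: "\<And>s. obstr_poly_5 lam s (s * a) (s * k) m = 0"
  shows "(a = 0 \<and> k = 0) \<or> (lam = 1 \<and> a = 0 \<and> k = - 1) \<or>
    ((lam + 6) * a = - 14 * m \<and> (lam + 6) * k = - 7 * (1 - 3 * m\<^sup>2) \<and> (lam = 1 \<or> lam = 9 / 2 \<or> lam = - 16 / 5))"
proof -
  \<comment> \<open>Modulo the first factor of \<open>l3\<close>, the second condition becomes a
    ((lam + 6) a + 14 m) = 0. This fixes \<open>a\<close> and \<open>k\<close> in terms of
    \<open>m\<close>, except when m = 0, where \<open>a\<close> vanishes and \<open>l2\<close> is an
    equation for \<open>k\<close>. The fourth condition then restricts \<open>lam\<close>.\<close>
  have aligned: ?thesis if X: "a * (1 - 3 * m\<^sup>2) - 2 * k * m = 0"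
  proof -
    have "(a = 0 \<and> k = 0) \<or> ((lam + 6) * a = - 14 * m \<and> (lam + 6) * k = - 7 * (1 - 3 * m\<^sup>2))"
    proof (cases "m = 0")
      case True
      then have "a = 0" using X by simp
      then have "4 * k * ((lam + 6) * k + 7) = 0" using l2 True by (simp add: power2_eq_square algebra_simps)
      then show ?thesis using True \<open>a = 0\<close> by auto
    next
      case False
      have "a * ((lam + 6) * a + 14 * m) = 0" using l2 X by algebra
      then consider "a = 0" | "(lam + 6) * a = - 14 * m" by fastforce
      then show ?thesis
      proof cases
        case 1
        then show ?thesis using X False by simp
      next
        case 2
        then have "2 * m * ((lam + 6) * k + 7 * (1 - 3 * m\<^sup>2)) = 0" using X by algebra
        then show ?thesis using 2 False by simp
      qed
    qed
    moreover have "lam = 1 \<or> lam = 9 / 2 \<or> lam = - 16 / 5"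
      if "(lam + 6) * a = - 14 * m" "(lam + 6) * k = - 7 * (1 - 3 * m\<^sup>2)"
    proof -
      have "lam + 6 \<noteq> 0" using that by auto
      moreover have "- 128 / 715 * (lam - 1) * (lam + 6) * (2 * lam - 9) * (5 * lam + 16) = 0"
        using l4[of "lam + 6"] unfolding that obstr_poly_4_aligned .
      ultimately show ?thesis by auto
    qed
    ultimately show ?thesis by blast
  qed
  consider "a * (1 - 3 * m\<^sup>2) - 2 * k * m = 0" | "lam * k + 3 * k + 4 = 0" | "lam * k + 9 * k + 12 = 0"
    using l3 by auto
  then show ?thesis
  proof cases
    case 1
    then show ?thesis by (rule aligned)
  next
    case 2
    then have k: "(lam + 3) * k = - 4" by algebra
    then have "lam + 3 \<noteq> 0" by auto
    define w where "w = (lam + 3) * a"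
    have "- 1 / 192 * lam\<^sup>2 * (lam - 1) * (lam + 3)\<^sup>2 * (3 * w * m\<^sup>2 - w - 8 * m) * (9 + (w - m)\<^sup>2) = 0"
      using l5[of "lam + 3"] unfolding k w_def[symmetric] obstr_poly_5_branch_1 .
    moreover have "9 + (w - m)\<^sup>2 \<noteq> 0" by (smt (verit) zero_le_power2)
    ultimately consider "lam = 1" | "3 * w * m\<^sup>2 - w - 8 * m = 0" using lam \<open>lam + 3 \<noteq> 0\<close> by auto
    then show ?thesis
    proof cases
      case 1
      then have "k = - 1" using k by simp
      \<comment> \<open>For lam = 1 and k = - 1 the mixed and constant terms of \<open>l2\<close>
        cancel, leaving 21 a^2 = 0.\<close>
      then have "a = 0" using l2 1 by (simp add: algebra_simps)
      then show ?thesis using 1 \<open>k = - 1\<close> by simp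
    next
      case 2
      then have "(lam + 3) * (a * (1 - 3 * m\<^sup>2) - 2 * k * m) = 0" using k unfolding w_def by algebra
      then show ?thesis using \<open>lam + 3 \<noteq> 0\<close> by (intro aligned) simp
    qed
  next
    case 3
    then have k: "(lam + 9) * k = - 12" by algebra
    then have "lam + 9 \<noteq> 0" by auto
    define v where "v = (lam + 9) * a / 3"
    have a: "(lam + 9) * a = 3 * v" by (simp add: v_def)
    have e4: "2 / 5005 * (lam + 9) * branch_2_quartic lam v m = 0"
      using l4[of "lam + 9"] unfolding k a obstr_poly_4_branch_2 .
    then have c4: "branch_2_quartic lam v m = 0"
      using \<open>lam + 9 \<noteq> 0\<close> by simp
    have e5: "3 / 64 * lam\<^sup>2 * (lam + 9) * (3 * v * m\<^sup>2 - v - 8 * m)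
      * (20 * lam\<^sup>2 * (1 + m\<^sup>2) - 3 * (51 + 10 * lam - lam\<^sup>2) * (9 + (v - m)\<^sup>2)) = 0"
      using l5[of "lam + 9"] unfolding k a obstr_poly_5_branch_2 .
    have "3 * (9 * (lam + 6) * v\<^sup>2 + 16 * (5 * lam + 9) - 6 * (5 * lam + 9) * (v * m)) = 0"
      using l2 k a by algebra
    then have rel: "6 * (5 * lam + 9) * (v * m) = 9 * (lam + 6) * v\<^sup>2 + 16 * (5 * lam + 9)" by algebra
    have "3 * v * m\<^sup>2 - v - 8 * m = 0"
      using e5 lam \<open>lam + 9 \<noteq> 0\<close> branch_2_impossible[OF lam rel c4] by auto
    then have "(lam + 9) * (a * (1 - 3 * m\<^sup>2) - 2 * k * m) = 0" using k a by algebra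
    then show ?thesis using \<open>lam + 9 \<noteq> 0\<close> by (intro aligned) simp
  qed
qed

text \<open>The two linear relations are what makes P proportional to x - x^3. The equation then
  depends on the angle only through x and its derivative.\<close>

lemma aligned_forms:
  fixes lam a k m t :: real
  defines "x \<equiv> form [1, m]" and "e \<equiv> - (a + k * m) / 3"
  assumes a: "(lam + 6) * a = - 14 * m" and k: "(lam + 6) * k = - 7 * (1 - 3 * m\<^sup>2)" and lam: "lam + 6 \<noteq> 0"
  shows "form [0, a, - k, e] t = 7 / (lam + 6) * (x t - x t ^ 3)"
    and "form [a, - 2 * k, 3 * e - 2 * a, k] t = 7 / (lam + 6) * ((1 - 3 * x t ^ 2) * form [m, - 1] t)"
proof -
  have e: "3 * e = - (a + k * m)" by (simp add: e_def)
  have x: "x t = cos t + m * sin t" "form [m, - 1] t = m * cos t - sin t" by (simp_all add: x_def)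
  have f: "form [0, a, - k, e] t = sin t * (a * (cos t * cos t) + sin t * (- k * cos t + sin t * e))"
    "form [a, - 2 * k, 3 * e - 2 * a, k] t = a * (cos t * (cos t * cos t)) +
      sin t * (- 2 * k * (cos t * cos t) + sin t * ((3 * e - 2 * a) * cos t + sin t * k))"
    by (simp_all add: power3_eq_cube power2_eq_square)
  have 1: "3 * (lam + 6) * (s * (a * (c * c) + s * (- k * c + s * e))) = 3 * 7 * ((c + m * s) - (c + m * s) ^ 3)"
    and 2: "(lam + 6) * (a * (c * (c * c)) + s * (- 2 * k * (c * c) + s * ((3 * e - 2 * a) * c + s * k)))
      = 7 * ((1 - 3 * (c + m * s) ^ 2) * (m * c - s))"
    if "c * c + s * s = 1" for c s
    using that e a k by algebra+
  show "form [0, a, - k, e] t = 7 / (lam + 6) * (x t - x t ^ 3)"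
    unfolding x f using lam 1[OF sin_cos_squared_add3[of t]] by (simp add: field_simps)
  show "form [a, - 2 * k, 3 * e - 2 * a, k] t = 7 / (lam + 6) * ((1 - 3 * x t ^ 2) * form [m, - 1] t)"
    unfolding x f using lam 2[OF sin_cos_squared_add3[of t]] by (simp add: field_simps)
qed

lemma integral_obstr_substitution:
  fixes x x' H h :: "real \<Rightarrow> real"
  assumes x: "\<And>s. (x has_real_derivative x' s) (at s within {0..t})"
    and H: "\<And>y. (H has_real_derivative h y) (at y)" and t: "t \<ge> 0"
    and obs: "\<And>s. s \<in> {0..t} \<Longrightarrow> obstr E q n s = h (x s) * x' s"
  shows "integral {0..t} (obstr E q n) = H (x t) - H (x 0)"
proof (rule integral_unique, rule fundamental_theorem_of_calculus[OF t])
  fix s assume "s \<in> {0..t}"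
  then show "((\<lambda>s. H (x s)) has_vector_derivative obstr E q n s) (at s within {0..t})"
    unfolding obs[OF \<open>s \<in> {0..t}\<close>] using DERIV_chain2[OF H x]
    by (simp add: has_real_derivative_iff_has_vector_derivative)
qed

text \<open>Here P = 5/2 (x - x^3), so every obstruction is a polynomial in x times x', and
  \<open>H1\<close> to \<open>H6\<close> are the primitives normalized to vanish at x = 1. The first
  five are compatible with a center. Apart from its constant - 2048 / 1105, \<open>H6\<close> is
  odd, so H6 1 = 0 makes its value at x = - 1 twice that constant, which is not zero.\<close>

lemma not_obstr_free_exceptional:
  assumes "(- 16 / 5 + 6) * a = - 14 * m" "(- 16 / 5 + 6) * k = - 7 * (1 - 3 * m\<^sup>2)"
  shows "\<not> obstr_free (- 16 / 5) a k m"
proof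
  assume free: "obstr_free (- 16 / 5) a k m"
  define x where "x = form [1, m]"
  define x' where "x' = form [m, - 1]"
  define E where "E t = - 16 / 5 * form [a, - 2 * k, 3 * (- (a + k * m) / 3) - 2 * a, k] t
      * (form [1, m] t - 3 * form [0, a, - k, - (a + k * m) / 3] t)" for t
  define q where "q t = (- 16 / 5 + 3) * form [0, a, - k, - (a + k * m) / 3] t - form [1, m] t" for t
  have dx: "(x has_real_derivative x' s) (at s within S)" for s S
    unfolding x_def x'_def by (rule has_derivative_line)
  have xend: "x 0 = 1" "x pi = - 1" by (simp_all add: x_def)
  have lam: "- 16 / 5 + 6 \<noteq> (0 :: real)" and c: "7 / (- 16 / 5 + 6) = (5 / 2 :: real)" by simp_all
  note al = aligned_forms[OF assms lam, folded x_def x'_def, unfolded c]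
  have E: "E s = (180 * y^5 - 216 * y^3 + 52 * y) * x' s" if "y = x s" for s y
    unfolding E_def al x_def[symmetric] that by algebra
  have q: "q s = 1/2 * y^3 - 3/2 * y" if "y = x s" for s y
    unfolding q_def al x_def[symmetric] that by algebra
  define H1 where "H1 y = - 30 * y^6 + 54 * y^4 - 26 * y^2 + 2" for y :: real
  define H2 where "H2 y = - 10 * y^9 + 54 * y^7 - 70 * y^5 + 26 * y^3" for y :: real
  define H3 where "H3 y = - 1815/4 * y^12 + 8262/5 * y^10 - 9323/4 * y^8 + 1558 * y^6 - 1901/4 * y^4 + 52 * y^2
      - 53/20" for y :: real
  define H4 where "H4 y = - 843/2 * y^15 + 6183/2 * y^13 - 7607 * y^11 + 8651 * y^9 - 9567/2 * y^7 + 2243/2 * y^5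
      - 52 * y^3" for y :: real
  define H5 where "H5 y = - 110305/8 * y^18 + 2431809/32 * y^16 - 7149337/40 * y^14 + 4623109/20 * y^12 - 7053387/40 * y^10
      + 1264241/16 * y^8 - 157007/8 * y^6 + 12579/5 * y^4 - 2067/10 * y^2 + 1353/160" for y :: real
  define H6 where "H6 y = - 162885/8 * y^21 + 1503279/8 * y^19 - 452430349/680 * y^17 + 49558759/40 * y^15
      - 701732459/520 * y^13 + 7055209/8 * y^11 - 2674171/8 * y^9 + 2627797/40 * y^7 - 10447/2 * y^5 + 2067/10 * y^3
      - 2048/1105" for y :: real
  define h1 where "h1 y = - (180 * y^5 - 216 * y^3 + 52 * y)" for y :: real
  define h2 where "h2 y = (1/2 * y^3 - 3/2 * y) * h1 y" for y :: real
  define h3 where "h3 y = (1/2 * y^3 - 3/2 * y) * h2 y + 1 * H1 y * (180 * y^5 - 216 * y^3 + 52 * y)" for y :: real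
  define h4 where "h4 y = (1/2 * y^3 - 3/2 * y) * h3 y + 2 * H2 y * (180 * y^5 - 216 * y^3 + 52 * y)" for y :: real
  define h5 where "h5 y = (1/2 * y^3 - 3/2 * y) * h4 y + 3 * H3 y * (180 * y^5 - 216 * y^3 + 52 * y)" for y :: real
  define h6 where "h6 y = (1/2 * y^3 - 3/2 * y) * h5 y + 4 * H4 y * (180 * y^5 - 216 * y^3 + 52 * y)" for y :: real
  have d1: "(H1 has_real_derivative h1 y) (at y)" for y
    unfolding H1_def[abs_def] h1_def 
    by (rule DERIV_cong, (rule derivative_eq_intros refl)+, (simp; algebra))
  have o1: "obstr E q (Suc 0) s = h1 (x s) * x' s" if "s \<ge> 0" for s
    by (simp only: obstr.simps E[OF refl] h1_def mult_minus_left)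
  have i1: "integral {0..t} (obstr E q (Suc 0)) = H1 (x t)" if "t \<ge> 0" for t
    using integral_obstr_substitution[OF dx d1 that, of E q "Suc 0"] o1 by (simp add: xend H1_def)
  have d2: "(H2 has_real_derivative h2 y) (at y)" for y
    unfolding H2_def[abs_def] h2_def h1_def 
    by (rule DERIV_cong, (rule derivative_eq_intros refl)+, (simp; algebra))
  have o2: "obstr E q (Suc (Suc 0)) s = h2 (x s) * x' s" if "s \<ge> 0" for s
    unfolding obstr.simps h2_def h1_def q[OF refl] E[OF refl] by simp algebra
  have i2: "integral {0..t} (obstr E q (Suc (Suc 0))) = H2 (x t)" if "t \<ge> 0" for t
    using integral_obstr_substitution[OF dx d2 that, of E q "Suc (Suc 0)"] o2 by (simp add: xend H2_def)
  have d3: "(H3 has_real_derivative h3 y) (at y)" for y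
    unfolding H3_def[abs_def] h3_def h2_def h1_def H1_def
    by (rule DERIV_cong, (rule derivative_eq_intros refl)+, (simp; algebra))
  have o3: "obstr E q (Suc (Suc (Suc 0))) s = h3 (x s) * x' s" if "s \<ge> 0" for s
    unfolding obstr.simps(3)[of E q "Suc 0"] o2[OF that] i1[OF that] h3_def q[OF refl] E[OF refl] by simp algebra
  have i3: "integral {0..t} (obstr E q (Suc (Suc (Suc 0)))) = H3 (x t)" if "t \<ge> 0" for t
    using integral_obstr_substitution[OF dx d3 that, of E q "Suc (Suc (Suc 0))"] o3 by (simp add: xend H3_def)
  have d4: "(H4 has_real_derivative h4 y) (at y)" for y
    unfolding H4_def[abs_def] h4_def h3_def h2_def h1_def H1_def H2_def
    by (rule DERIV_cong, (rule derivative_eq_intros refl)+, (simp; algebra))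
  have o4: "obstr E q (Suc (Suc (Suc (Suc 0)))) s = h4 (x s) * x' s" if "s \<ge> 0" for s
    unfolding obstr.simps(3)[of E q "Suc (Suc 0)"] o3[OF that] i2[OF that] h4_def q[OF refl] E[OF refl] by simp algebra
  have i4: "integral {0..t} (obstr E q (Suc (Suc (Suc (Suc 0))))) = H4 (x t)" if "t \<ge> 0" for t
    using integral_obstr_substitution[OF dx d4 that, of E q "Suc (Suc (Suc (Suc 0)))"] o4 by (simp add: xend H4_def)
  have d5: "(H5 has_real_derivative h5 y) (at y)" for y
    unfolding H5_def[abs_def] h5_def h4_def h3_def h2_def h1_def H1_def H2_def H3_def
    by (rule DERIV_cong, (rule derivative_eq_intros refl)+, (simp; algebra))
  have o5: "obstr E q (Suc (Suc (Suc (Suc (Suc 0))))) s = h5 (x s) * x' s" if "s \<ge> 0" for s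
    unfolding obstr.simps(3)[of E q "Suc (Suc (Suc 0))"] o4[OF that] i3[OF that] h5_def q[OF refl] E[OF refl] by simp algebra
  have d6: "(H6 has_real_derivative h6 y) (at y)" for y
    unfolding H6_def[abs_def] h6_def h5_def h4_def h3_def h2_def h1_def H1_def H2_def H3_def H4_def
    by (rule DERIV_cong, (rule derivative_eq_intros refl)+, (simp; algebra))
  have o6: "obstr E q (Suc (Suc (Suc (Suc (Suc (Suc 0)))))) s = h6 (x s) * x' s" if "s \<ge> 0" for s
    unfolding obstr.simps(3)[of E q "Suc (Suc (Suc (Suc 0)))"] o5[OF that] i4[OF that] h6_def q[OF refl] E[OF refl] by simp
        algebra
  have i6: "integral {0..t} (obstr E q (Suc (Suc (Suc (Suc (Suc (Suc 0))))))) = H6 (x t)" if "t \<ge> 0" for t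
    using integral_obstr_substitution[OF dx d6 that, of E q "Suc (Suc (Suc (Suc (Suc (Suc 0)))))"] o6 by (simp add: xend H6_def)
  have "integral {0..pi} (obstr E q (Suc (Suc (Suc (Suc (Suc (Suc 0))))))) = 0"
    using free unfolding obstr_free_def E_def[abs_def] q_def[abs_def] by blast
  then show False using i6[of pi] by (simp add: xend H6_def)
qed

section \<open>Necessity\<close>

text \<open>The conjunct b20 \<noteq> 0 in the last two conditions is essential: for b20 = 0 their
  equations say no more than a20 = b11 = 0 and leave a11, a02 and b02 free, which violates even the
  mean value condition a11 + b20 + 2 b02 = 0.\<close>

theorem center_necessary:
  fixes lam delta a20 a11 a02 b20 b11 b02 :: real
  assumes lam: "lam \<noteq> 0"
    and center: "switching_center lam (upper_field lam delta a20 a11 a02 b20 b11 b02) (lower_field delta)"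
  shows "(delta = 0 \<and> a11 = 0 \<and> b20 = 0 \<and> b02 = 0) \<or>
    (delta = 0 \<and> b20 = 0 \<and> a11 + 2 * b02 = 0 \<and> b11 + 2 * a20 = 0) \<or>
    (delta = 0 \<and> a20 = 0 \<and> b02 = 0 \<and> a11 + b20 = 0 \<and> b11 + a02 = 0) \<or>
    (delta = 0 \<and> lam - 1 = 0 \<and> a02 = 0 \<and> a20 = 0 \<and> b02 + b20 = 0 \<and> a11 - b20 = 0) \<or>
    (b20 \<noteq> 0 \<and> delta = 0 \<and> lam - 1 = 0 \<and>
      2 * a11 * b20 + 3 * a20\<^sup>2 - 2 * b20\<^sup>2 = 0 \<and> 2 * b11 + 5 * a20 = 0 \<and>
      8 * a02 * b20\<^sup>2 + a20 * (8 * b20\<^sup>2 - 3 * a20\<^sup>2) = 0 \<and>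
      4 * b02 * b20 - 3 * a20\<^sup>2 + 4 * b20\<^sup>2 = 0) \<or>
    (b20 \<noteq> 0 \<and> delta = 0 \<and> lam - 9 / 2 = 0 \<and>
      12 * a11 * b20 + 27 * a20\<^sup>2 - 4 * b20\<^sup>2 = 0 \<and> 4 * b11 + 11 * a20 = 0 \<and>
      32 * a02 * b20\<^sup>2 + 3 * a20 * (8 * b20\<^sup>2 - 9 * a20\<^sup>2) = 0 \<and>
      24 * b02 * b20 - 27 * a20\<^sup>2 + 16 * b20\<^sup>2 = 0)"
proof -
  have delta: "delta = 0" by (rule center_delta_zero[OF assms])
  note center0 = center[unfolded delta]
  have "a11 + b20 + 2 * b02 = 0" by (rule center_mean_zero[OF lam center0])
  then have a11: "a11 = - b20 - 2 * b02" by simp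
  \<comment> \<open>\<open>m\<close> and \<open>e\<close> invert the parametrization of
    \<open>line_angular_form\<close>.\<close>
  define m where "m = b11 + 2 * a20"
  define e where "e = (a02 + m) / 3"
  have par: "3 * e - m = a02" "m - 2 * a20 = b11" by (simp_all add: m_def e_def field_simps)
  show ?thesis
  proof (cases "b20 = 0")
    case True
    have "b20 * (a20 + 3 * e) + b02 * m = 0"
      by (rule center_first_condition[OF lam]) (use center0 in \<open>simp only: par a11\<close>)
    then have "b02 = 0 \<or> m = 0" using True by simp
    then show ?thesis using True delta a11 by (auto simp: m_def)
  next
    case False
    define a where "a = a20 / b20"
    define k where "k = b02 / b20"
    define \<mu> where "\<mu> = m / b20"
    define \<epsilon> where "\<epsilon> = e / b20"
    have sc: "a20 = b20 * a" "b02 = b20 * k" "m = b20 * \<mu>" "e = b20 * \<epsilon>"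
      using False by (simp_all add: a_def k_def \<mu>_def \<epsilon>_def)
    have c: "switching_center lam (upper_field lam 0 (b20 * a) (- b20 - 2 * (b20 * k)) (3 * (b20 * \<epsilon>) - b20 * \<mu>) b20
        (b20 * \<mu> - 2 * (b20 * a)) (b20 * k)) (lower_field 0)"
      using center0 by (simp only: par a11 flip: sc)
    note free = center_obstr_free[OF lam False c]
    note eqs = obstr_free_equations[OF lam free(2)]
    have lam': "lam \<noteq> - 16 / 5" if "(lam + 6) * a = - 14 * \<mu>" "(lam + 6) * k = - 7 * (1 - 3 * \<mu>\<^sup>2)"
      using not_obstr_free_exceptional[of a \<mu> k] that free(2) by auto
    have b11: "b11 = b20 * (\<mu> - 2 * a)" and a02: "a02 = b20 * (3 * \<epsilon> - \<mu>)"
      using par sc by (simp_all add: algebra_simps)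
    note eps = free(1)
    from obstr_equations_solutions[OF lam eqs(1,2) eqs(3) eqs(4)] show ?thesis
    proof (elim disjE conjE, goal_cases)
      case 1
      then show ?thesis using delta a11 sc b11 a02 eps by (simp add: algebra_simps)
    next
      case 2
      then show ?thesis using delta a11 sc b11 a02 eps by (simp add: algebra_simps)
    next
      case 3
      then have "7 * a = - 14 * \<mu>" "7 * k = - 7 * (1 - 3 * \<mu>\<^sup>2)" by simp_all
      then have mu: "\<mu> = - a / 2" and k: "k = 3 / 4 * a\<^sup>2 - 1" by (auto simp: power2_eq_square)
      have "\<epsilon> = - (a + k * \<mu>) / 3" by (rule eps)
      then have e3: "3 * \<epsilon> = - a + (3 / 4 * a\<^sup>2 - 1) * a / 2" by (simp add: mu k)
      have "2 * a11 * b20 + 3 * a20\<^sup>2 - 2 * b20\<^sup>2 = 0" unfolding a11 sc(1,2) k by algebra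
      moreover have "2 * b11 + 5 * a20 = 0" unfolding b11 sc(1) mu by simp
      moreover have "8 * a02 * b20\<^sup>2 + a20 * (8 * b20\<^sup>2 - 3 * a20\<^sup>2) = 0"
        unfolding a02 sc(1) e3 mu by (simp add: field_simps power2_eq_square power3_eq_cube)
      moreover have "4 * b02 * b20 - 3 * a20\<^sup>2 + 4 * b20\<^sup>2 = 0" unfolding sc(1,2) k by algebra
      ultimately show ?thesis using False delta 3 by simp
    next
      case 4
      then have c: "21 / 2 * a = - 14 * \<mu>" "21 / 2 * k = - 7 * (1 - 3 * \<mu>\<^sup>2)" by simp_all
      have mu: "\<mu> = - 3 / 4 * a" using c(1) by linarith
      have k: "k = 9 / 8 * a\<^sup>2 - 2 / 3" using c(2) unfolding mu by (simp add: power2_eq_square)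
      have "\<epsilon> = - (a + k * \<mu>) / 3" by (rule eps)
      then have e3: "3 * \<epsilon> = - a + (9 / 8 * a\<^sup>2 - 2 / 3) * (3 / 4 * a)" by (simp add: mu k)
      have "12 * a11 * b20 + 27 * a20\<^sup>2 - 4 * b20\<^sup>2 = 0" unfolding a11 sc(1,2) k by algebra
      moreover have "4 * b11 + 11 * a20 = 0" unfolding b11 sc(1) mu by simp
      moreover have "32 * a02 * b20\<^sup>2 + 3 * a20 * (8 * b20\<^sup>2 - 9 * a20\<^sup>2) = 0"
        unfolding a02 sc(1) e3 mu by (simp add: field_simps power2_eq_square power3_eq_cube)
      moreover have "24 * b02 * b20 - 27 * a20\<^sup>2 + 16 * b20\<^sup>2 = 0" unfolding sc(1,2) k by algebra
      ultimately show ?thesis using False delta 4 by simp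
    next
      case 5
      from lam'[OF 5(1,2)] 5(3) show ?thesis by (rule notE)
    qed
  qed
qed

section \<open>Sufficiency\<close>

lemma recip_orbit_unique:
  assumes "continuous_on {0..pi} A" "continuous_on {0..pi} B"
    and "recip_orbit lam A B u" "recip_orbit lam A B w" "c \<in> {0..pi}" "u c = w c" "t \<in> {0..pi}"
  shows "u t = w t"
  using polar_orbit_unique[OF assms(1,2) assms(3,4)[folded recip_orbit_iff] assms(5) _ assms(7)] assms(6) by simp

text \<open>Condition (iii): the radial form vanishes identically, so r is constant along
  orbits.\<close>

lemma center_of_vanishing_radial:
  fixes lam a11 a02 :: real
  assumes lam: "lam \<noteq> 0"
  shows "switching_center lam (upper_field lam 0 0 a11 a02 (- a11) (- a02) 0) (lower_field 0)"
proof (rule centerI[OF lam], intro exI[of _ 0] allI impI)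
  fix v :: real and u
  assume u: "u 0 = v" "recip_orbit lam (radial_form 0 a11 a02 (- a11) (- a02) 0) (angular_form 0 a11 a02 (- a11) (- a02) 0) u"
  have "radial_form 0 a11 a02 (- a11) (- a02) 0 t = 0" for t
    by (simp add: radial_form_def algebra_simps power2_eq_square)
  then have "\<exists>c. \<forall>t\<in>{0..pi}. u t = c"
    using u(2) unfolding recip_orbit_def by (intro has_field_derivative_zero_constant) auto
  then show "u pi = v" using u(1) pi_ge_zero by (metis atLeastAtMost_iff order_refl)
qed

lemma recip_orbit_reflect:
  assumes u: "recip_orbit lam A B u" and A: "\<And>t. A (pi - t) = - A t" and B: "\<And>t. B (pi - t) = B t"
  shows "recip_orbit lam A B (\<lambda>t. u (pi - t))"
  unfolding recip_orbit_def
proof (intro ballI conjI)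
  fix t assume t: "t \<in> {0..pi}"
  then have t': "pi - t \<in> {0..pi}" by auto
  then show "u (pi - t) > 0" "u (pi - t) + B t \<noteq> 0"
    using u B[of t] unfolding recip_orbit_def by metis+
  have "(\<lambda>t. pi - t) ` {0..pi} = {0..pi}" by (auto simp: image_iff intro!: bexI[of _ "pi - _"])
  then have "(u has_real_derivative - lam * A (pi - t) * u (pi - t) / (u (pi - t) + B (pi - t)))
      (at (pi - t) within (\<lambda>t. pi - t) ` {0..pi})"
    using u t' unfolding recip_orbit_def by simp
  moreover have "((\<lambda>t. pi - t) has_real_derivative - 1) (at t within {0..pi})"
    by (auto intro!: derivative_eq_intros)
  ultimately have "((\<lambda>t. u (pi - t)) has_real_derivative - lam * A (pi - t) * u (pi - t) / (u (pi - t) + B (pi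
      - t)) * - 1) (at t within {0..pi})"
    using DERIV_image_chain[of u _ "\<lambda>t. pi - t"] by (simp only: o_def)
  then show "((\<lambda>t. u (pi - t)) has_real_derivative - lam * A t * u (pi - t) / (u (pi - t) + B t)) (at t within {0..pi})"
    by (simp add: A B)
qed

text \<open>Condition (i): an orbit and its reflection in the vertical axis agree at pi / 2, hence
  everywhere by uniqueness, in particular at 0 and pi.\<close>

lemma center_of_reflection_symmetry:
  fixes lam a20 a02 b11 :: real
  assumes lam: "lam \<noteq> 0"
  shows "switching_center lam (upper_field lam 0 a20 0 a02 0 b11 0) (lower_field 0)"
proof (rule centerI[OF lam], intro exI[of _ 0] allI impI)
  fix v :: real and u
  assume u: "u 0 = v" "recip_orbit lam (radial_form a20 0 a02 0 b11 0) (angular_form a20 0 a02 0 b11 0) u"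
  have "u pi = u (pi - pi)"
    by (rule recip_orbit_unique[OF continuous_on_forms(1) continuous_on_forms(2) u(2)
        recip_orbit_reflect[OF u(2)], where c = "pi / 2"])
      (auto simp: radial_form_def angular_form_def)
  then show "u pi = v" using u(1) by simp
qed

text \<open>With \<open>B = - 3 P\<close> and \<open>A = P'\<close> the orbits satisfy a linear equation for \<open>P\<close> as a function of \<open>u\<close>;
  its integrating factor gives the first integral used here.\<close>

lemma center_of_divergence_free:
  fixes lam a k e :: real
  assumes lam: "lam \<noteq> 0"
  shows "switching_center lam (upper_field lam 0 a (- 2 * k) (3 * e) 0 (- 2 * a) k) (lower_field 0)"
proof (rule centerI[OF lam], intro exI[of _ 0] allI impI)
  fix v :: real and u
  define P where "P = form [0, a, - k, e]"
  define P' where "P' = form [a, - 2 * k, 3 * e - 2 * a, k]"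
  assume u0: "u 0 = v" and u: "recip_orbit lam (radial_form a (- 2 * k) (3 * e) 0 (- 2 * a) k) (angular_form a (- 2 * k) (3 * e)
      0 (- 2 * a) k) u"
  have A: "radial_form a (- 2 * k) (3 * e) 0 (- 2 * a) k = P'"
    unfolding P'_def radial_form_eq by simp
  have B: "angular_form a (- 2 * k) (3 * e) 0 (- 2 * a) k t = - 3 * P t" for t
    using line_angular_form[of a 0 k e 0 t] by (simp add: P_def)
  \<comment> \<open>A primitive of y powr (- 3 / lam), logarithmic for lam = 3. As P vanishes at
    both ends, the first integral reduces there to h u, and \<open>h\<close> is injective on
    positive arguments.\<close>
  define h where "h y = (if lam = 3 then ln y else y powr (1 - 3 / lam) / (1 - 3 / lam))" for y :: real
  have dh: "(h has_real_derivative y powr (- 3 / lam)) (at y)" if "y > 0" for y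
  proof (cases "lam = 3")
    case True
    then have "h = ln" "y powr (- 3 / lam) = inverse y"
      using that by (simp_all add: h_def fun_eq_iff powr_minus)
    then show ?thesis using DERIV_ln[OF that] by simp
  next
    case False
    then have "1 - 3 / lam \<noteq> 0" using lam by (simp add: field_simps)
    moreover have "((\<lambda>y. y powr (1 - 3 / lam) / (1 - 3 / lam)) has_real_derivative
        (1 - 3 / lam) * y powr (1 - 3 / lam - 1) / (1 - 3 / lam)) (at y)"
      by (intro DERIV_cdivide has_real_derivative_powr that)
    ultimately show ?thesis using False unfolding h_def by simp
  qed
  have pos: "u t > 0" "u t - 3 * P t \<noteq> 0"
    "(u has_real_derivative - lam * P' t * u t / (u t - 3 * P t)) (at t within {0..pi})" if "t \<in> {0..pi}" for t
    using u that unfolding recip_orbit_def A B by auto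
  have "((\<lambda>t. lam * (P t * u t powr (- 3 / lam)) + h (u t)) has_real_derivative 0) (at t within {0..pi})"
    if t: "t \<in> {0..pi}" for t
  proof -
    define u' where "u' = - lam * P' t * u t / (u t - 3 * P t)"
    have du: "(u has_real_derivative u') (at t within {0..pi})" using pos(3)[OF t] by (simp add: u'_def)
    have dP: "(P has_real_derivative P' t) (at t within {0..pi})"
      unfolding P_def P'_def by (rule has_derivative_cubic)
    define w where "w = u t powr (- 3 / lam)"
    have w: "u t powr (- 3 / lam - 1) = w / u t"
      unfolding w_def powr_diff using pos(1)[OF t] by simp
    have dw: "((\<lambda>t. u t powr (- 3 / lam)) has_real_derivative (- 3 / lam) * (w / u t) * u') (at t within {0..pi})"
      by (rule DERIV_cong[OF DERIV_chain2[OF has_real_derivative_powr[OF pos(1)[OF t]] du]]) (simp only: w)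
    have dhu: "((\<lambda>t. h (u t)) has_real_derivative w * u') (at t within {0..pi})"
      using DERIV_chain2[OF dh[OF pos(1)[OF t]] du] by (simp add: w_def)
    have "((\<lambda>t. lam * (P t * u t powr (- 3 / lam)) + h (u t)) has_real_derivative
        lam * (P' t * w + (- 3 / lam) * (w / u t) * u' * P t) + w * u') (at t within {0..pi})"
      using DERIV_add[OF DERIV_cmult[OF DERIV_mult[OF dP dw], of lam] dhu] unfolding w_def .
    moreover have "lam * (P' t * w + (- 3 / lam) * (w / u t) * u' * P t) + w * u' = 0"
    proof -
      have "(u t - 3 * P t) * u' = - lam * P' t * u t" using pos(2)[OF t] by (simp add: u'_def)
      then have "w / u t * (lam * P' t * u t + (u t - 3 * P t) * u') = 0" by simp
      moreover have "lam * (P' t * w + (- 3 / lam) * (w / u t) * u' * P t) + w * u'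
          = w / u t * (lam * P' t * u t + (u t - 3 * P t) * u')"
        using pos(1)[OF t] lam by (simp add: field_simps)
      ultimately show ?thesis by simp
    qed
    ultimately show ?thesis by simp
  qed
  then have "\<exists>c. \<forall>t\<in>{0..pi}. lam * (P t * u t powr (- 3 / lam)) + h (u t) = c"
    by (intro has_field_derivative_zero_constant) auto
  then have "lam * (P 0 * u 0 powr (- 3 / lam)) + h (u 0) = lam * (P pi * u pi powr (- 3 / lam)) + h (u pi)"
    using pi_ge_zero by (metis atLeastAtMost_iff order_refl)
  then have eq: "h (u 0) = h (u pi)" by (simp add: P_def)
  have mono: "strict_mono_on {0<..} h"
  proof (rule strict_mono_onI)
    fix y z :: real assume "y \<in> {0<..}" "z \<in> {0<..}" "y < z"
    then show "h y < h z"
      by (intro DERIV_pos_imp_increasing[of y z h]) (auto intro!: exI[of _ "_ powr (- 3 / lam)"] dh)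
  qed
  have "u 0 > 0" "u pi > 0" using pos(1) by auto
  then have "u 0 = u pi"
    using eq strict_mono_onD[OF mono, of "u 0" "u pi"] strict_mono_onD[OF mono, of "u pi" "u 0"]
    by (cases "u 0" "u pi" rule: linorder_cases) auto
  then show "u pi = v" using u0 by simp
qed

lemma aligned_center_forms:
  fixes lam b a k m t :: real
  defines "x \<equiv> form [1, m]" and "e \<equiv> - (a + k * m) / 3"
  assumes "(lam + 6) * a = - 14 * m" and "(lam + 6) * k = - 7 * (1 - 3 * m\<^sup>2)" and lam: "lam + 6 \<noteq> 0"
  defines "c \<equiv> 7 / (lam + 6)"
  shows "radial_form (b * a) (- b - 2 * (b * k)) (3 * (b * e) - b * m) b (b * m - 2 * (b * a)) (b * k) t
      = c * b * (1 - 3 * x t ^ 2) * form [m, - 1] t"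
    and "angular_form (b * a) (- b - 2 * (b * k)) (3 * (b * e) - b * m) b (b * m - 2 * (b * a)) (b * k) t
      = b * x t - 3 * c * b * (x t - x t ^ 3)"
proof -
  note al = aligned_forms[OF assms(3-5), of t, folded x_def e_def c_def]
  have s: "form [0, b * a, - (b * k), b * e] t = b * form [0, a, - k, e] t" "form [b, b * m] t = b * x t"
    "form [b * a, - b - 2 * (b * k) + b, 3 * (b * e) - b * m + (b * m - 2 * (b * a)), b * k] t = b * form [a,
        - 2 * k, 3 * e - 2 * a, k] t"
    unfolding x_def by (simp_all add: algebra_simps)
  show "radial_form (b * a) (- b - 2 * (b * k)) (3 * (b * e) - b * m) b (b * m - 2 * (b * a)) (b * k) t
      = c * b * (1 - 3 * x t ^ 2) * form [m, - 1] t"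
    unfolding radial_form_eq s al(2) by simp
  show "angular_form (b * a) (- b - 2 * (b * k)) (3 * (b * e) - b * m) b (b * m - 2 * (b * a)) (b * k) t
      = b * x t - 3 * c * b * (x t - x t ^ 3)"
    unfolding line_angular_form s al(1) by simp
qed

text \<open>Condition (v). With X = r x the equation becomes d(r^2)/dX = 2 b (r^2 - 3 X^2) / (1 - b
  X), which is linear in r^2. The integrating factor (1 - b X)^2 gives the first integral r^2 (1 - b
  X)^2 + 2 b X^3 - 3/2 b^2 X^4, which is \<open>H\<close>.\<close>

lemma aligned_center_1:
  fixes b a k m :: real
  assumes "7 * a = - 14 * m" "7 * k = - 7 * (1 - 3 * m\<^sup>2)"
  defines "e \<equiv> - (a + k * m) / 3"
  shows "switching_center 1 (upper_field 1 0 (b * a) (- b - 2 * (b * k)) (3 * (b * e) - b * m) b (b * m - 2 * (b * a)) (b * k))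
      (lower_field 0)"
    (is "switching_center 1 (upper_field 1 0 ?a20 ?a11 ?a02 ?b20 ?b11 ?b02) _")
proof (rule centerI)
  fix C :: real
  define x where "x = form [1, m]"
  define x' where "x' = form [m, - 1]"
  have dx: "(x has_real_derivative x' t) (at t within S)" for t S
    unfolding x_def x'_def by (rule has_derivative_line)
  have one: "1 + 6 \<noteq> (0 :: real)" "(1 + 6) * a = - 14 * m" "(1 + 6) * k = - 7 * (1 - 3 * m\<^sup>2)" "7 / (1 + 6) = (1 :: real)"
    using assms by simp_all
  have A: "radial_form ?a20 ?a11 ?a02 ?b20 ?b11 ?b02 t = b * (1 - 3 * x t ^ 2) * x' t"
    and B: "angular_form ?a20 ?a11 ?a02 ?b20 ?b11 ?b02 t = b * (3 * x t ^ 3 - 2 * x t)" for t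
    using aligned_center_forms[OF one(2,3,1), of b t] unfolding one(4) x_def x'_def e_def by (simp_all add: algebra_simps)
  show "\<exists>U. \<forall>v\<ge>U. \<forall>u. u 0 = v \<longrightarrow> (\<forall>t\<in>{0..pi}. \<bar>u t - v\<bar> \<le> C) \<longrightarrow>
      recip_orbit 1 (radial_form ?a20 ?a11 ?a02 ?b20 ?b11 ?b02) (angular_form ?a20 ?a11 ?a02 ?b20 ?b11 ?b02) u \<longrightarrow> u pi = v"
  \<comment> \<open>Beyond this threshold b^2 r^2 < 1, so r^2 - b^2 r^4 / 2 takes equal values at
    the two ends only for equal radii.\<close>
  proof (intro exI[of _ "\<bar>C\<bar> + \<bar>b\<bar> + 1"] allI impI)
    fix v u
    assume v: "\<bar>C\<bar> + \<bar>b\<bar> + 1 \<le> v" and u0: "u 0 = v" and uC: "\<forall>t\<in>{0..pi}. \<bar>u t - v\<bar> \<le> C"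
      and u: "recip_orbit 1 (radial_form ?a20 ?a11 ?a02 ?b20 ?b11 ?b02) (angular_form ?a20 ?a11 ?a02 ?b20 ?b11 ?b02) u"
    define r where "r t = 1 / u t" for t
    have "polar_orbit 1 0 (radial_form ?a20 ?a11 ?a02 ?b20 ?b11 ?b02) (angular_form ?a20 ?a11 ?a02 ?b20 ?b11 ?b02) {0..pi} r"
      using u unfolding r_def recip_orbit_iff .
    then have r: "1 + r t * (b * (3 * x t ^ 3 - 2 * x t)) \<noteq> 0"
      "(r has_real_derivative r t * (r t * (b * (1 - 3 * x t ^ 2) * x' t)) / (1 + r t * (b * (3 * x t ^ 3
          - 2 * x t)))) (at t within {0..pi})"
      if "t \<in> {0..pi}" for t
      using that unfolding polar_orbit_def A B by auto
    define H where "H t = r t ^ 2 * (1 - x t ^ 2) * (1 - b * r t * x t) ^ 2 + r t ^ 2 * x t ^ 2 - 1 / 2 * (b ^ 2 * r t ^ 4 * x t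
        ^ 4)" for t
    have "(H has_real_derivative 0) (at t within {0..pi})" if t: "t \<in> {0..pi}" for t
    proof -
      define r' where "r' = r t * (r t * (b * (1 - 3 * x t ^ 2) * x' t)) / (1 + r t * (b * (3 * x t ^ 3 - 2 * x t)))"
      have dr: "(r has_real_derivative r') (at t within {0..pi})" using r(2)[OF t] by (simp add: r'_def)
      have r': "(1 + r t * (b * (3 * x t ^ 3 - 2 * x t))) * r' = r t ^ 2 * b * (1 - 3 * x t ^ 2) * x' t"
        using r(1)[OF t] by (simp add: r'_def power2_eq_square)
      define h where "h = (2 * r t * (1 - x t ^ 2) * (1 - b * r t * x t) ^ 2 - 2 * r t ^ 2 * (1 - x t ^ 2) * (1
          - b * r t * x t) * (b * x t)
          + 2 * r t * x t ^ 2 - 2 * b ^ 2 * r t ^ 3 * x t ^ 4) * r'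
        + (- 2 * r t ^ 2 * x t * (1 - b * r t * x t) ^ 2 - 2 * r t ^ 2 * (1 - x t ^ 2) * (1 - b * r t * x t) * (b * r t)
          + 2 * r t ^ 2 * x t - 2 * b ^ 2 * r t ^ 4 * x t ^ 3) * x' t"
      have "(1 + r t * (b * (3 * x t ^ 3 - 2 * x t))) * h = 0"
        unfolding h_def using r' by algebra
      then have "h = 0" using r(1)[OF t] by simp
      moreover have "(H has_real_derivative h) (at t within {0..pi})"
        unfolding H_def h_def
        by (rule DERIV_cong, (rule derivative_eq_intros dr dx refl)+, simp only: power_derivative_simps, algebra)
      ultimately show ?thesis by simp
    qed
    then have "\<exists>c. \<forall>t\<in>{0..pi}. H t = c" by (intro has_field_derivative_zero_constant) auto
    then have "H 0 = H pi" using pi_ge_zero by (metis atLeastAtMost_iff order_refl)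
    then have "r 0 ^ 2 - 1 / 2 * (b ^ 2 * r 0 ^ 4) = r pi ^ 2 - 1 / 2 * (b ^ 2 * r pi ^ 4)"
      by (simp add: H_def x_def)
    then have "(r 0 ^ 2 - r pi ^ 2) * (2 - b ^ 2 * (r 0 ^ 2 + r pi ^ 2)) = 0" by algebra
    moreover have small: "b ^ 2 * r t ^ 2 < 1" "r t > 0" if "t \<in> {0..pi}" for t
    proof -
      have "\<bar>u t - v\<bar> \<le> C" using uC that by blast
      then have ut: "u t > \<bar>b\<bar>" "u t > 0" using v by linarith+
      then have "b ^ 2 < u t ^ 2" using power_strict_mono[of "\<bar>b\<bar>" "u t" 2] by simp
      then show "b ^ 2 * r t ^ 2 < 1" using ut by (simp add: r_def field_simps)
      show "r t > 0" using ut by (simp add: r_def)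
    qed
    have "b ^ 2 * r 0 ^ 2 < 1" "b ^ 2 * r pi ^ 2 < 1" "r 0 > 0" "r pi > 0" using small by auto
    then have "2 - b ^ 2 * (r 0 ^ 2 + r pi ^ 2) \<noteq> 0" unfolding distrib_left by linarith
    ultimately have "r 0 ^ 2 = r pi ^ 2" by simp
    then have "r 0 = r pi" using \<open>r 0 > 0\<close> \<open>r pi > 0\<close> by (simp add: power2_eq_iff)
    then show "u pi = v" using u0 by (simp add: r_def)
  qed
qed simp

text \<open>Condition (vi). With y = r^(-1/3) and X = x / y the equation becomes d(y^2)/dX = - 3
  \<beta> (1 - 3 X^2 y^2) / (1 - 3/2 \<beta> X^3), which is linear in y^2. The integrating factor (1
  - 3/2 \<beta> X^3)^2 gives \<open>H\<close> = 3/2 y^2 (1 - 3/2 \<beta> X^3)^2 + 9/2 \<beta> X -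
  27/16 \<beta>^2 X^4.\<close>

lemma aligned_center_2:
  fixes b a k m :: real
  assumes "21 / 2 * a = - 14 * m" "21 / 2 * k = - 7 * (1 - 3 * m\<^sup>2)"
  defines "e \<equiv> - (a + k * m) / 3"
  shows "switching_center (9 / 2) (upper_field (9 / 2) 0 (b * a) (- b - 2 * (b * k)) (3 * (b * e) - b * m) b (b * m
      - 2 * (b * a)) (b * k)) (lower_field 0)"
    (is "switching_center _ (upper_field _ 0 ?a20 ?a11 ?a02 ?b20 ?b11 ?b02) _")
proof (rule centerI)
  fix C :: real
  define x where "x = form [1, m]"
  define x' where "x' = form [m, - 1]"
  define \<beta> where "\<beta> = 2 / 3 * b"
  have dx: "(x has_real_derivative x' t) (at t within S)" for t S
    unfolding x_def x'_def by (rule has_derivative_line)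
  have c: "9 / 2 + 6 \<noteq> (0 :: real)" "(9 / 2 + 6) * a = - 14 * m" "(9 / 2 + 6) * k = - 7 * (1 - 3 * m\<^sup>2)" "7 / (9 / 2
      + 6) = (2 / 3 :: real)"
    using assms by simp_all
  have A: "radial_form ?a20 ?a11 ?a02 ?b20 ?b11 ?b02 t = \<beta> * (1 - 3 * x t ^ 2) * x' t"
    and B: "angular_form ?a20 ?a11 ?a02 ?b20 ?b11 ?b02 t = 3 / 2 * \<beta> * (2 * x t ^ 3 - x t)" for t
    using aligned_center_forms[OF c(2,3,1), of b t] unfolding c(4) x_def x'_def e_def \<beta>_def by (simp_all add: algebra_simps)
  \<comment> \<open>At both ends \<open>H\<close> equals 3/2 y^2 + 27/16 \<beta>^2 y^(-4). For y at
    least \<open>S\<close> this determines y, and u at least S^3 ensures that y is so large.\<close>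
  define S where "S = 1 + 3 * \<beta> ^ 2"
  have S: "S \<ge> 1" "S \<ge> 3 * \<beta> ^ 2" by (simp_all add: S_def)
  show "\<exists>U. \<forall>v\<ge>U. \<forall>u. u 0 = v \<longrightarrow> (\<forall>t\<in>{0..pi}. \<bar>u t - v\<bar> \<le> C) \<longrightarrow>
      recip_orbit (9 / 2) (radial_form ?a20 ?a11 ?a02 ?b20 ?b11 ?b02) (angular_form ?a20 ?a11 ?a02 ?b20 ?b11 ?b02) u \<longrightarrow> u pi = v"
  proof (intro exI[of _ "\<bar>C\<bar> + S ^ 3"] allI impI)
    fix v u
    assume v: "\<bar>C\<bar> + S ^ 3 \<le> v" and u0: "u 0 = v" and uC: "\<forall>t\<in>{0..pi}. \<bar>u t - v\<bar> \<le> C"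
      and u: "recip_orbit (9 / 2) (radial_form ?a20 ?a11 ?a02 ?b20 ?b11 ?b02) (angular_form ?a20 ?a11 ?a02 ?b20 ?b11 ?b02) u"
    have orb: "u t > 0" "u t + 3 / 2 * \<beta> * (2 * x t ^ 3 - x t) \<noteq> 0"
      "(u has_real_derivative - (9 / 2) * (\<beta> * (1 - 3 * x t ^ 2) * x' t) * u t / (u t + 3 / 2 * \<beta> * (2 * x t ^ 3
          - x t))) (at t within {0..pi})"
      if "t \<in> {0..pi}" for t
      using u that unfolding recip_orbit_def A B by auto
    define y where "y t = u t powr (1 / 3)" for t
    have y3: "y t ^ 3 = u t" "y t > 0" if "t \<in> {0..pi}" for t
      using orb(1)[OF that] by (simp_all add: y_def powr_power)
    define H where "H t = 3 / 2 * y t ^ 2 + 9 / 2 * \<beta> * ((x t - x t ^ 3) * inverse (y t))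
        - 27 / 4 * \<beta> ^ 2 * ((1 / 4 * x t ^ 4 - 1 / 2 * x t ^ 6) * inverse (y t) ^ 4)" for t
    have "(H has_real_derivative 0) (at t within {0..pi})" if t: "t \<in> {0..pi}" for t
    proof -
      define w where "w = inverse (y t)"
      have yw: "y t * w = 1" using y3(2)[OF t] by (simp add: w_def)
      define D where "D = y t ^ 3 + 3 / 2 * \<beta> * (2 * x t ^ 3 - x t)"
      have D: "D \<noteq> 0" using orb(2)[OF t] y3(1)[OF t] by (simp add: D_def)
      define u' where "u' = - (9 / 2) * (\<beta> * (1 - 3 * x t ^ 2) * x' t) * y t ^ 3 / D"
      have du: "(u has_real_derivative u') (at t within {0..pi})"
        using orb(3)[OF t] by (simp add: u'_def D_def y3(1)[OF t])
      define y' where "y' = 1 / 3 * w ^ 2 * u'"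
      have "(y has_real_derivative 1 / 3 * u t powr (1 / 3 - 1) * u') (at t within {0..pi})"
        unfolding y_def by (rule DERIV_chain2[OF has_real_derivative_powr[OF orb(1)[OF t]] du])
      moreover have "u t powr (1 / 3 - 1) = w ^ 2"
      proof -
        have "u t powr (1 / 3 - 1) = y t / y t ^ 3"
          unfolding powr_diff using orb(1)[OF t] y3(1)[OF t] by (simp add: y_def)
        also have "\<dots> = w ^ 2" using y3(2)[OF t] by (simp add: w_def field_simps power2_eq_square power3_eq_cube)
        finally show ?thesis .
      qed
      ultimately have dy: "(y has_real_derivative y') (at t within {0..pi})" by (simp add: y'_def)
      have "D * u' = - (9 / 2) * (\<beta> * (1 - 3 * x t ^ 2) * x' t) * y t ^ 3" using D by (simp add: u'_def)
      then have "D * y' = 1 / 3 * w ^ 2 * (- (9 / 2) * (\<beta> * (1 - 3 * x t ^ 2) * x' t) * y t ^ 3)" unfolding y'_def by algebra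
      then have y': "D * y' = - 3 / 2 * \<beta> * (1 - 3 * x t ^ 2) * x' t * y t" using yw by algebra
      have dw: "((\<lambda>t. inverse (y t)) has_real_derivative - (w ^ 2 * y')) (at t within {0..pi})"
        using DERIV_inverse_fun[OF dy] y3(2)[OF t] by (simp add: w_def power2_eq_square mult_ac)
      define h where "h = (3 * y t - 9 / 2 * \<beta> * (x t - x t ^ 3) * w ^ 2 + 27 * \<beta> ^ 2 * (1 / 4 * x t ^ 4 - 1 / 2 * x t ^ 6) * w
          ^ 5) * y'
        + (9 / 2 * \<beta> * (1 - 3 * x t ^ 2) * w - 27 / 4 * \<beta> ^ 2 * (x t ^ 3 - 3 * x t ^ 5) * w ^ 4) * x' t"
      have "D * h = 0"
        unfolding h_def distrib_left using y' yw unfolding D_def by algebra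
      then have "h = 0" using D by simp
      moreover have "(H has_real_derivative h) (at t within {0..pi})"
        unfolding H_def h_def
        by (rule DERIV_cong, (rule derivative_eq_intros dy dx dw refl)+, simp only: power_derivative_simps w_def[symmetric],
            algebra)
      ultimately show ?thesis by simp
    qed
    then have "\<exists>c. \<forall>t\<in>{0..pi}. H t = c" by (intro has_field_derivative_zero_constant) auto
    then have H: "H 0 = H pi" using pi_ge_zero by (metis atLeastAtMost_iff order_refl)
    define p where "p = y 0"
    define s where "s = y pi"
    have big: "y t \<ge> S" if "t \<in> {0..pi}" for t
    proof -
      have "\<bar>u t - v\<bar> \<le> C" using uC that by blast
      then have "S ^ 3 \<le> y t ^ 3" unfolding y3(1)[OF that] using v by linarith
      then show ?thesis using y3(2)[OF that] by (intro power_le_imp_le_base[of S 2 "y t"]) (simp_all add: eval_nat_numeral)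
    qed
    have ps: "p \<ge> S" "s \<ge> S" using big by (auto simp: p_def s_def)
    have pos: "p > 0" "s > 0" using ps S by linarith+
    have "3 / 2 * p ^ 2 + 27 / 16 * \<beta> ^ 2 * inverse p ^ 4 = 3 / 2 * s ^ 2 + 27 / 16 * \<beta> ^ 2 * inverse s ^ 4"
      using H by (simp add: H_def x_def p_def s_def)
    then have "(p ^ 2 - s ^ 2) * (3 / 2 * (p ^ 4 * s ^ 4) - 27 / 16 * \<beta> ^ 2 * (p ^ 2 + s ^ 2)) = 0"
      using pos by (simp add: field_simps) algebra?
    moreover have "3 / 2 * (p ^ 4 * s ^ 4) - 27 / 16 * \<beta> ^ 2 * (p ^ 2 + s ^ 2) > 0"
    proof -
      have P: "p ^ 2 \<ge> 1" "s ^ 2 \<ge> 1" using ps S by (simp_all add: one_le_power)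
      have "p ^ 2 * s ^ 2 \<ge> p ^ 2" "p ^ 2 * s ^ 2 \<ge> s ^ 2" using P by (simp_all add: mult_le_cancel_left1 mult_le_cancel_right1)
      then have 1: "p ^ 2 + s ^ 2 \<le> 2 * (p ^ 2 * s ^ 2)" by linarith
      have "p * s \<ge> S * 1" using ps S by (intro mult_mono) auto
      then have "1 \<le> p * s" "3 * \<beta> ^ 2 \<le> p * s" using S by linarith+
      then have "p * s * 1 \<le> p * s * (p * s)" by (intro mult_left_mono) linarith+
      with \<open>3 * \<beta> ^ 2 \<le> p * s\<close> have "(3 * \<beta> ^ 2) * 1 \<le> (p * s) * (p * s)" by linarith
      then have "3 * \<beta> ^ 2 * (p ^ 2 * s ^ 2) \<le> (p ^ 2 * s ^ 2) * (p ^ 2 * s ^ 2)"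
        using pos by (intro mult_right_mono) (simp_all add: power2_eq_square mult_ac)
      moreover have "27 / 16 * \<beta> ^ 2 * (p ^ 2 + s ^ 2) \<le> 27 / 16 * \<beta> ^ 2 * (2 * (p ^ 2 * s ^ 2))"
        using 1 by (intro mult_left_mono) auto
      moreover have "(p ^ 2 * s ^ 2) * (p ^ 2 * s ^ 2) > 0" using pos by simp
      moreover have "p ^ 4 * s ^ 4 = (p ^ 2 * s ^ 2) * (p ^ 2 * s ^ 2)" by (simp add: eval_nat_numeral mult_ac)
      ultimately show ?thesis by linarith
    qed
    ultimately have "p ^ 2 = s ^ 2" by auto
    then have "p = s" using pos by (simp add: power2_eq_iff)
    then show "u pi = v" using u0 y3(1)[of 0] y3(1)[of pi] by (simp add: p_def s_def)
  qed
qed simp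

text \<open>In the coordinates \<open>X = x\<close>, \<open>Y = y (1 - b x)\<close> the system of this case reads \<open>X' = - Y\<close>,
  \<open>Y' = X (1 - b\<^sup>2 X\<^sup>2) + k X Y\<close>, so that \<open>Y\<close> satisfies one and the same equation as a function of \<open>X\<close> and of \<open>- X\<close>.\<close>

lemma even_graph:
  fixes f :: "real \<Rightarrow> real"
  assumes r: "r0 > 0" "r1 > 0"
    and cont: "continuous_on {- r1..r0} f" and ends: "f (- r1) = 0" "f r0 = 0"
    and pos: "\<And>x. - r1 < x \<Longrightarrow> x < r0 \<Longrightarrow> f x > 0"
    and ode: "\<And>x. - r1 < x \<Longrightarrow> x < r0 \<Longrightarrow> (f has_real_derivative - (x * (1 - b\<^sup>2 * x\<^sup>2) + k * x * f x) / f x) (at x)"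
  shows "r0 = r1"
proof -
  define M where "M = min r0 r1"
  have M: "M > 0" "M \<le> r0" "M \<le> r1" using r by (auto simp: M_def)
  \<comment> \<open>The terms without \<open>k\<close> cancel in the derivative of \<open>w\<close>,
    since f x and f (- x) solve the same equation. What remains is linear in w, with denominator f x
    + f (- x).\<close>
  define w where "w x = (f x)\<^sup>2 - (f (- x))\<^sup>2" for x
  have w0: "w x = 0" if x: "0 \<le> x" "x < M" for x
  proof (rule linear_ode_zero[where w = w and t = x and a = 0 and b = x and c = 0 and K = "\<lambda>x. - 2 * k * x / (f x + f (- x))"])
    have inner: "- r1 < y" "y < r0" "- r1 < - y" "- y < r0" if "y \<in> {0..x}" for y using that x M r by auto
    have cf: "continuous_on {0..x} f" "continuous_on {0..x} (\<lambda>y. f (- y))"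
      using inner by (auto intro!: continuous_on_subset[OF cont] continuous_on_compose2[OF cont] continuous_intros
          simp: less_imp_le)
    have fpos: "f y + f (- y) > 0" if "y \<in> {0..x}" for y
      using pos inner[OF that] by (intro add_pos_pos) auto
    then have "f y + f (- y) \<noteq> 0" if "y \<in> {0..x}" for y using that by (metis less_irrefl)
    then show "continuous_on {0..x} (\<lambda>x. - 2 * k * x / (f x + f (- x)))"
      by (intro continuous_intros cf) auto
    fix y assume y: "y \<in> {0..x}"
    define d where "d = - (y * (1 - b\<^sup>2 * y\<^sup>2) + k * y * f y) / f y"
    define d' where "d' = - ((- y) * (1 - b\<^sup>2 * (- y)\<^sup>2) + k * (- y) * f (- y)) / f (- y)"
    have df: "(f has_real_derivative d) (at y)" "(f has_real_derivative d') (at (- y))"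
      unfolding d_def d'_def by (intro ode inner y)+
    have fp: "f y > 0" "f (- y) > 0" by (intro pos inner y)+
    have "((\<lambda>y. f (- y)) has_real_derivative d' * - 1) (at y)"
      by (rule DERIV_chain2[where f = f and g = "\<lambda>y. - y" and x = y, OF df(2)]) (auto intro!: derivative_eq_intros)
    then have "(w has_real_derivative 2 * f y * d + 2 * f (- y) * d') (at y)"
      unfolding w_def using df(1) by (auto intro!: derivative_eq_intros)
    moreover have "f y * d = - (y * (1 - b\<^sup>2 * y\<^sup>2) + k * y * f y)" "f (- y) * d' = y * (1 - b\<^sup>2 * y\<^sup>2) + k * y * f (- y)"
      using fp by (simp_all add: d_def d'_def)
    then have "2 * f y * d + 2 * f (- y) * d' = - 2 * k * y * (f y - f (- y))" by algebra
    moreover have "\<dots> = - 2 * k * y / (f y + f (- y)) * w y"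
      unfolding w_def using fpos[OF y] by (simp add: field_simps power2_eq_square)
    ultimately show "(w has_real_derivative - 2 * k * y / (f y + f (- y)) * w y) (at y within {0..x})"
      using has_field_derivative_at_within by simp
  qed (use x in \<open>auto simp: w_def\<close>)
  \<comment> \<open>The denominator f x + f (- x) may vanish at \<open>M\<close>, so the end point
    is reached by continuity.\<close>
  have "continuous_on {0..M} w"
    unfolding w_def using M r
    by (intro continuous_intros continuous_on_subset[OF cont] continuous_on_compose2[OF cont]) auto
  then have "continuous_on (closure {0..<M}) w" using M by (simp add: closure_atLeastLessThan)
  then have "w M = 0"
    by (rule continuous_constant_on_closure[where S = "{0..<M}"]) (use w0 M in \<open>auto simp: closure_atLeastLessThan\<close>)
  then have eq: "(f M)\<^sup>2 = (f (- M))\<^sup>2" by (simp add: w_def)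
  show ?thesis
  proof (rule ccontr)
    \<comment> \<open>Then one of \<open>M\<close> and - M is an end point, where f vanishes, and
      the other is an interior point, where f is positive.\<close>
    assume "r0 \<noteq> r1"
    then consider "r0 < r1" | "r1 < r0" by linarith
    then show False
    proof cases
      case 1
      then show False using eq ends pos[of "- r0"] r by (simp add: M_def)
    next
      case 2
      then show False using eq ends pos[of r1] r by (simp add: M_def)
    qed
  qed
qed

text \<open>A curve whose abscissa decreases strictly is a graph over that abscissa, with slope Y' /
  x'. The sign of x' is required only inside the interval because in the application x' vanishes on
  the switching line.\<close>

lemma has_derivative_inverse_graph:
  fixes x Y :: "real \<Rightarrow> real"
  assumes p: "p > 0"
    and x: "\<And>t. t \<in> {0..p} \<Longrightarrow> (x has_real_derivative x' t) (at t within {0..p})"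
    and Y: "\<And>t. t \<in> {0..p} \<Longrightarrow> (Y has_real_derivative Y' t) (at t within {0..p})"
    and neg: "\<And>t. 0 < t \<Longrightarrow> t < p \<Longrightarrow> x' t < 0"
  obtains g where "\<And>t. t \<in> {0..p} \<Longrightarrow> g (x t) = t" "continuous_on {x p..x 0} (\<lambda>y. Y (g y))"
    "\<And>y. x p < y \<Longrightarrow> y < x 0 \<Longrightarrow> 0 < g y \<and> g y < p \<and> x (g y) = y"
    "\<And>y. x p < y \<Longrightarrow> y < x 0 \<Longrightarrow> ((\<lambda>y. Y (g y)) has_real_derivative Y' (g y) / x' (g y)) (at y)"
proof -
  have cx: "continuous_on {0..p} x" and cY: "continuous_on {0..p} Y"
    using DERIV_continuous_on[OF x] DERIV_continuous_on[OF Y] by blast+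
  have at: "(x has_real_derivative x' t) (at t)" "(Y has_real_derivative Y' t) (at t)" if "0 < t" "t < p" for t
    using x[of t] Y[of t] that at_within_Icc_at[of 0 t p] by auto
  have dec: "x t < x s" if "0 \<le> s" "s < t" "t \<le> p" for s t
  proof (rule DERIV_neg_imp_decreasing_open[OF that(2)])
    show "\<exists>y. (x has_real_derivative y) (at r) \<and> y < 0" if "s < r" "r < t" for r
      using at(1)[of r] neg[of r] that \<open>0 \<le> s\<close> \<open>t \<le> p\<close> by (intro exI[of _ "x' r"]) auto
    show "continuous_on {s..t} x" using that by (intro continuous_on_subset[OF cx]) auto
  qed
  have inj: "inj_on x {0..p}"
    by (rule linorder_inj_onI) (use dec in \<open>fastforce+\<close>)
  define g where "g = inv_into {0..p} x"
  have gx: "g (x t) = t" if "t \<in> {0..p}" for t unfolding g_def using inj that by (rule inv_into_f_f)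
  have img: "x ` {0..p} = {x p..x 0}"
  proof (intro equalityI subsetI)
    fix y assume "y \<in> x ` {0..p}"
    then obtain t where t: "t \<in> {0..p}" "y = x t" by blast
    then show "y \<in> {x p..x 0}"
      using dec[of 0 t] dec[of t p] by (cases "t = 0"; cases "t = p") auto
  next
    fix y assume "y \<in> {x p..x 0}"
    then show "y \<in> x ` {0..p}"
      using IVT2'[of x p y 0] cx p by auto
  qed
  have gc: "continuous_on {x p..x 0} g"
    using continuous_on_inv[OF cx compact_Icc, of g] gx unfolding img by blast
  have gin: "g y \<in> {0..p}" "x (g y) = y" if "y \<in> {x p..x 0}" for y
  proof -
    have "y \<in> x ` {0..p}" using that unfolding img .
    then obtain t where "t \<in> {0..p}" "y = x t" by blast
    then show "g y \<in> {0..p}" "x (g y) = y" using gx[of t] by simp_all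
  qed
  have gopen: "0 < g y \<and> g y < p \<and> x (g y) = y" if "x p < y" "y < x 0" for y
  proof -
    have y: "g y \<in> {0..p}" "x (g y) = y" using gin[of y] that by auto
    then have "g y \<noteq> 0" "g y \<noteq> p" using that by auto
    then show ?thesis using y by auto
  qed
  show ?thesis
  proof (rule that[of g])
    show "continuous_on {x p..x 0} (\<lambda>y. Y (g y))"
      using gin by (intro continuous_on_compose2[OF cY gc]) auto
    show "((\<lambda>y. Y (g y)) has_real_derivative Y' (g y) / x' (g y)) (at y)" if y: "x p < y" "y < x 0" for y
    proof -
      note gy = gopen[OF y]
      have "isCont g y" using gc y by (intro continuous_on_interior[OF gc]) auto
      then have "(g has_real_derivative inverse (x' (g y))) (at y)"
        using gy neg[of "g y"] at(1)[of "g y"] gopen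
        by (intro DERIV_inverse_function[where f = x and a = "x p" and b = "x 0"] y) auto
      then show ?thesis
        using DERIV_chain2[where f = Y and g = g and x = y, OF at(2)[of "g y"]] gy by (simp add: divide_inverse)
    qed
  qed (use gx gopen in auto)
qed

text \<open>Condition (iv). Parametrizing by the angle instead of time divides both components of
  the field by the angular speed \<open>N\<close>, which cancels in the slope dY/dX. As lam = 1, r
  is the Euclidean radius, so the graph of \<open>Y\<close> over \<open>X\<close> ends at - r pi and
  r 0, and its evenness says that these radii agree.\<close>

lemma center_of_even_graph:
  fixes b k :: real
  shows "switching_center 1 (upper_field 1 0 0 b 0 b k (- b)) (lower_field 0)"
proof (rule centerI)
  fix C :: real
  define A where "A = radial_form 0 b 0 b k (- b)"
  define B where "B = angular_form 0 b 0 b k (- b)"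
  have Bc: "continuous_on {0..pi} B" unfolding B_def by (rule continuous_on_forms)
  obtain K where K: "K \<ge> 0" "\<And>t. t \<in> {0..pi} \<Longrightarrow> \<bar>B t\<bar> \<le> K" using bounded_on_interval[OF Bc] by blast
  show "\<exists>U. \<forall>v\<ge>U. \<forall>u. u 0 = v \<longrightarrow> (\<forall>t\<in>{0..pi}. \<bar>u t - v\<bar> \<le> C) \<longrightarrow>
      recip_orbit 1 (radial_form 0 b 0 b k (- b)) (angular_form 0 b 0 b k (- b)) u \<longrightarrow> u pi = v"
    unfolding A_def[symmetric] B_def[symmetric]
  \<comment> \<open>The threshold guarantees that b r has modulus below 1, so that \<open>Y\<close>
    has the sign of the sine, and that \<open>N\<close> is positive.\<close>
  proof (intro exI[of _ "\<bar>C\<bar> + \<bar>b\<bar> + K + 1"] allI impI)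
    fix v u
    assume v: "\<bar>C\<bar> + \<bar>b\<bar> + K + 1 \<le> v" and u0: "u 0 = v" and uC: "\<forall>t\<in>{0..pi}. \<bar>u t - v\<bar> \<le> C"
      and u: "recip_orbit 1 A B u"
    define r where "r t = 1 / u t" for t
    have "polar_orbit 1 0 A B {0..pi} r" using u unfolding r_def recip_orbit_iff .
    then have dr: "(r has_real_derivative r t * (r t * A t) / (1 + r t * B t)) (at t within {0..pi})"
      if "t \<in> {0..pi}" for t
      using that unfolding polar_orbit_def by simp
    have ub: "u t > \<bar>b\<bar>" "u t > K" "u t > 0" if "t \<in> {0..pi}" for t
    proof -
      have "\<bar>u t - v\<bar> \<le> C" using uC that by blast
      then show "u t > \<bar>b\<bar>" "u t > K" "u t > 0" using v K by linarith+
    qed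
    have rb: "r t > 0" "\<bar>b * r t\<bar> < 1" "1 + r t * B t > 0" if t: "t \<in> {0..pi}" for t
    proof -
      show "r t > 0" using ub[OF t] by (simp add: r_def)
      show "\<bar>b * r t\<bar> < 1" using ub[OF t] by (simp add: r_def abs_mult)
      have "u t + B t > 0" using ub[OF t] K(2)[OF t] by linarith
      then have "(u t + B t) / u t > 0" using ub[OF t] by simp
      then show "1 + r t * B t > 0" using ub(3)[OF t] by (simp add: r_def add_divide_distrib)
    qed
    define X where "X t = r t * cos t" for t
    define Y where "Y t = r t * sin t * (1 - b * (r t * cos t))" for t
    define N where "N t = 1 + r t * B t" for t
    define Y' where "Y' t = (X t * (1 - b\<^sup>2 * (X t)\<^sup>2) + k * X t * Y t) / N t" for t
    have dXY: "(X has_real_derivative - Y t / N t) (at t within {0..pi})"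
       "(Y has_real_derivative Y' t) (at t within {0..pi})" if t: "t \<in> {0..pi}" for t
    proof -
      define r' where "r' = r t * (r t * A t) / N t"
      have d: "(r has_real_derivative r') (at t within {0..pi})" using dr[OF t] by (simp add: r'_def N_def)
      have N: "N t \<noteq> 0" using rb(3)[OF t] by (simp add: N_def)
      have r': "N t * r' = r t ^ 2 * A t" using N by (simp add: r'_def power2_eq_square)
      have cs: "cos t * cos t + sin t * sin t = 1" by (rule sin_cos_squared_add3)
      have A: "A t = cos t * (b * cos t * sin t) + sin t * (b * cos t ^ 2 + k * cos t * sin t - b * sin t ^ 2)"
        and B: "B t = cos t * (b * cos t ^ 2 + k * cos t * sin t - b * sin t ^ 2) - sin t * (b * cos t * sin t)"
        by (simp_all add: A_def B_def radial_form_def angular_form_def)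
      have "N t * (r' * cos t - r t * sin t) = - Y t"
        unfolding right_diff_distrib mult.assoc[symmetric] r' unfolding Y_def N_def A B using cs by algebra
      then have x': "r' * cos t - r t * sin t = - Y t / N t" using N by (simp add: field_simps)
      have "(X has_real_derivative r' * cos t - r t * sin t) (at t within {0..pi})"
        unfolding X_def using d by (auto intro!: derivative_eq_intros)
      then show "(X has_real_derivative - Y t / N t) (at t within {0..pi})" unfolding x' .
      define y' where "y' = (r' * sin t + r t * cos t) * (1 - b * (r t * cos t)) - r t * sin t * (b * (r' * cos t
          - r t * sin t))"
      have "N t * y' = (N t * r' * sin t + N t * (r t * cos t)) * (1 - b * (r t * cos t))
          - r t * sin t * (b * (N t * r' * cos t - N t * (r t * sin t)))"
        unfolding y'_def by algebra
      also have "\<dots> = X t * (1 - b\<^sup>2 * (X t)\<^sup>2) + k * X t * Y t"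
        unfolding r' unfolding Y_def X_def N_def A B using cs by algebra
      finally have "y' = Y' t" unfolding Y'_def using N by (simp add: field_simps)
      moreover have "(Y has_real_derivative y') (at t within {0..pi})"
        unfolding Y_def y'_def using d by (auto intro!: derivative_eq_intros simp: algebra_simps)
      ultimately show "(Y has_real_derivative Y' t) (at t within {0..pi})" by simp
    qed
    have Ypos: "Y t > 0" if "0 < t" "t < pi" for t
    proof -
      have t: "t \<in> {0..pi}" using that by simp
      have "\<bar>b * r t * cos t\<bar> \<le> \<bar>b * r t\<bar> * 1" unfolding abs_mult by (intro mult_left_mono) auto
      then have "1 - b * r t * cos t > 0" using rb(2)[OF t] abs_ge_self[of "b * r t * cos t"] by linarith
      then have "1 - b * (r t * cos t) > 0" by (simp add: mult.assoc)
      then show ?thesis using rb(1)[OF t] sin_gt_zero[OF that] by (simp add: Y_def)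
    qed
    have Npos: "N t > 0" if "t \<in> {0..pi}" for t using rb(3)[OF that] by (simp add: N_def)
    obtain g where g: "\<And>t. t \<in> {0..pi} \<Longrightarrow> g (X t) = t" "continuous_on {X pi..X 0} (\<lambda>y. Y (g y))"
      "\<And>y. X pi < y \<Longrightarrow> y < X 0 \<Longrightarrow> 0 < g y \<and> g y < pi \<and> X (g y) = y"
      "\<And>y. X pi < y \<Longrightarrow> y < X 0 \<Longrightarrow> ((\<lambda>y. Y (g y)) has_real_derivative Y' (g y) / (- Y (g y) / N (g y))) (at y)"
    proof (rule has_derivative_inverse_graph[OF pi_gt_zero dXY])
      show "- Y t / N t < 0" if "0 < t" "t < pi" for t
        using Ypos[OF that] Npos[of t] that by simp
    qed auto
    have "r 0 = r pi"
    proof (rule even_graph[where f = "\<lambda>y. Y (g y)" and b = b and k = k])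
      have X: "X pi = - r pi" "X 0 = r 0" by (simp_all add: X_def)
      show "r 0 > 0" "r pi > 0" using rb(1) by auto
      show "continuous_on {- r pi..r 0} (\<lambda>y. Y (g y))" using g(2) unfolding X .
      show "Y (g (- r pi)) = 0" "Y (g (r 0)) = 0" using g(1)[of pi] g(1)[of 0] by (simp_all add: X Y_def)
      fix y assume y: "- r pi < y" "y < r 0"
      have gy: "0 < g y" "g y < pi" "X (g y) = y" using g(3)[of y] y unfolding X by auto
      show Yg: "Y (g y) > 0" by (rule Ypos[OF gy(1,2)])
      have "Y' (g y) / (- Y (g y) / N (g y)) = - (y * (1 - b\<^sup>2 * y\<^sup>2) + k * y * Y (g y)) / Y (g y)"
        unfolding Y'_def gy(3) using Yg Npos[of "g y"] gy by (simp add: field_simps)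
      then show "((\<lambda>y. Y (g y)) has_real_derivative - (y * (1 - b\<^sup>2 * y\<^sup>2) + k * y * Y (g y)) / Y (g y)) (at y)"
        using g(4)[of y] y unfolding X by simp
    qed
    then show "u pi = v" using u0 by (simp add: r_def)
  qed
qed simp

lemma center_case_5:
  fixes a20 a11 a02 b20 b11 b02 :: real
  assumes b: "b20 \<noteq> 0"
    and "2 * a11 * b20 + 3 * a20\<^sup>2 - 2 * b20\<^sup>2 = 0" "2 * b11 + 5 * a20 = 0"
      "8 * a02 * b20\<^sup>2 + a20 * (8 * b20\<^sup>2 - 3 * a20\<^sup>2) = 0" "4 * b02 * b20 - 3 * a20\<^sup>2 + 4 * b20\<^sup>2 = 0"
  shows "switching_center 1 (upper_field 1 0 a20 a11 a02 b20 b11 b02) (lower_field 0)"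
proof -
  define a where "a = a20 / b20"
  define m where "m = - a / 2"
  define k where "k = 3 / 4 * a\<^sup>2 - 1"
  define e where "e = - (a + k * m) / 3"
  have a20: "a20 = b20 * a" using b by (simp add: a_def)
  have e3: "3 * e = - (a + k * m)" by (simp add: e_def)
  have "b20 * (a11 - (- b20 - 2 * (b20 * k))) = 0" using assms(2) unfolding a20 k_def by algebra
  moreover have "b20\<^sup>2 * (a02 - (3 * (b20 * e) - b20 * m)) = 0"
    using assms(4) e3 unfolding a20 k_def m_def by algebra
  moreover have "b11 = b20 * m - 2 * (b20 * a)" using assms(3) unfolding a20 m_def by algebra
  moreover have "b20 * (b02 - b20 * k) = 0" using assms(5) unfolding a20 k_def by algebra
  ultimately have "a11 = - b20 - 2 * (b20 * k)" "a02 = 3 * (b20 * e) - b20 * m" "b11 = b20 * m - 2 * (b20 * a)" "b02 = b20 * k"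
    using b by simp_all
  moreover have "7 * a = - 14 * m" "7 * k = - 7 * (1 - 3 * m\<^sup>2)" by (simp_all add: m_def k_def power2_eq_square)
  ultimately show ?thesis using aligned_center_1[of a m k b20] unfolding a20 e_def by simp
qed

lemma center_case_6:
  fixes a20 a11 a02 b20 b11 b02 :: real
  assumes b: "b20 \<noteq> 0"
    and "12 * a11 * b20 + 27 * a20\<^sup>2 - 4 * b20\<^sup>2 = 0" "4 * b11 + 11 * a20 = 0"
      "32 * a02 * b20\<^sup>2 + 3 * a20 * (8 * b20\<^sup>2 - 9 * a20\<^sup>2) = 0" "24 * b02 * b20 - 27 * a20\<^sup>2 + 16 * b20\<^sup>2 = 0"
  shows "switching_center (9 / 2) (upper_field (9 / 2) 0 a20 a11 a02 b20 b11 b02) (lower_field 0)"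
proof -
  define a where "a = a20 / b20"
  define m where "m = - 3 / 4 * a"
  define k where "k = 9 / 8 * a\<^sup>2 - 2 / 3"
  define e where "e = - (a + k * m) / 3"
  have a20: "a20 = b20 * a" using b by (simp add: a_def)
  have e3: "3 * e = - (a + k * m)" by (simp add: e_def)
  have "b20 * (a11 - (- b20 - 2 * (b20 * k))) = 0" using assms(2) unfolding a20 k_def by algebra
  moreover have "b20\<^sup>2 * (a02 - (3 * (b20 * e) - b20 * m)) = 0"
    using assms(4) e3 unfolding a20 k_def m_def by algebra
  moreover have "b11 = b20 * m - 2 * (b20 * a)" using assms(3) unfolding a20 m_def by algebra
  moreover have "b20 * (b02 - b20 * k) = 0" using assms(5) unfolding a20 k_def by algebra
  ultimately have "a11 = - b20 - 2 * (b20 * k)" "a02 = 3 * (b20 * e) - b20 * m" "b11 = b20 * m - 2 * (b20 * a)" "b02 = b20 * k"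
    using b by simp_all
  moreover have "21 / 2 * a = - 14 * m" "21 / 2 * k = - 7 * (1 - 3 * m\<^sup>2)" by (simp_all add: m_def k_def power2_eq_square)
  ultimately show ?thesis using aligned_center_2[of a m k b20] unfolding a20 e_def by simp
qed

theorem theorem3p2:
  fixes lam delta a20 a11 a02 b20 b11 b02 :: real
  assumes "lam \<noteq> 0"
  shows "switching_center lam (upper_field lam delta a20 a11 a02 b20 b11 b02) (lower_field delta) \<longleftrightarrow>
    (delta = 0 \<and> a11 = 0 \<and> b20 = 0 \<and> b02 = 0) \<or>
    (delta = 0 \<and> b20 = 0 \<and> a11 + 2 * b02 = 0 \<and> b11 + 2 * a20 = 0) \<or>
    (delta = 0 \<and> a20 = 0 \<and> b02 = 0 \<and> a11 + b20 = 0 \<and> b11 + a02 = 0) \<or>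
    (delta = 0 \<and> lam - 1 = 0 \<and> a02 = 0 \<and> a20 = 0 \<and> b02 + b20 = 0 \<and> a11 - b20 = 0) \<or>
    (b20 \<noteq> 0 \<and> delta = 0 \<and> lam - 1 = 0 \<and>
      2 * a11 * b20 + 3 * a20\<^sup>2 - 2 * b20\<^sup>2 = 0 \<and> 2 * b11 + 5 * a20 = 0 \<and>
      8 * a02 * b20\<^sup>2 + a20 * (8 * b20\<^sup>2 - 3 * a20\<^sup>2) = 0 \<and>
      4 * b02 * b20 - 3 * a20\<^sup>2 + 4 * b20\<^sup>2 = 0) \<or>
    (b20 \<noteq> 0 \<and> delta = 0 \<and> lam - 9 / 2 = 0 \<and>
      12 * a11 * b20 + 27 * a20\<^sup>2 - 4 * b20\<^sup>2 = 0 \<and> 4 * b11 + 11 * a20 = 0 \<and>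
      32 * a02 * b20\<^sup>2 + 3 * a20 * (8 * b20\<^sup>2 - 9 * a20\<^sup>2) = 0 \<and>
      24 * b02 * b20 - 27 * a20\<^sup>2 + 16 * b20\<^sup>2 = 0)"
proof (rule iffI, goal_cases)
  case 1
  show ?case by (rule center_necessary[OF assms 1])
next
  case 2
  then show ?case
  proof (elim disjE conjE, goal_cases)
    case 1
    then show ?thesis using center_of_reflection_symmetry[OF assms] by simp
  next
    case 2
    then have "a11 = - 2 * b02" "b11 = - 2 * a20" by linarith+
    then show ?thesis using 2(1,2) center_of_divergence_free[OF assms, of a20 b02 "a02 / 3"] by simp
  next
    case 3
    then have "b20 = - a11" "b11 = - a02" by linarith+
    then show ?thesis using 3(1-3) center_of_vanishing_radial[OF assms] by simp
  next
    case 4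
    then have "b02 = - b20" "a11 = b20" "lam = 1" by linarith+
    then show ?thesis using 4(1,3,4) center_of_even_graph by simp
  next
    case 5
    then show ?thesis using center_case_5[OF 5(1,4-)] by simp
  next
    case 6
    then have "lam = 9 / 2" by simp
    show ?thesis unfolding 6(2) \<open>lam = 9 / 2\<close> by (rule center_case_6[OF 6(1,4-)])
  qed
qed

end
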